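(* The following four statements are equivalent for a group $G$. (i) $G$ is amenable. (ii) Every ring with a full and boundedly free $G$-grading has UGN if and only if its base ring has UGN. (iii) Every crossed product of $G$ over a ring $R$ has UGN if and only if $R$ has UGN (for every ring $R$). (iv) Every skew group ring of $G$ over a ring $R$ has UGN if and only if $R$ has UGN (for every ring $R$).
   Context: Rings, subrings and ring homomorphisms are unital; "module" means right module unless stated otherwise. A ring $S$ has unbounded generating number (UGN) if, for every positive integer $n$, there is no $S$-module epimorphism $S^n\to S^{n+1}$. $S^0$ denotes the zero module. A ring $R$ is graded by a group $G$ ($G$-graded) if there are additive subgroups $R_g$ ($g\in G$) with $R=\bigoplus_{g\in G}R_g$ as additive groups and $R_gR_h\subseteq R_{gh}$ for all $g,h\in G$. The base ring is the subring $R_1$, where $1$ is the identity of $G$. The grading is full if $R_g\neq 0$ for all $g\in G$. The grading is boundedly free if there is a positive integer $r$ such that at least one of the following holds: (a) for each $g\in G$ there is an integer $i\in[0,r]$ with $R_g\cong (R_1)^i$ as right $R_1$-modules; (b) for each $g\in G$ there is an integer $i\in[0,r]$ with $R_g\cong (R_1)^i$ as left $R_1$-modules. A $G$-graded ring $T$ is a crossed product of $G$ over $R$ if its base ring is $T_1=R$ and each homogeneous component $T_g$ contains a unit of $T$. A skew group ring of $G$ over $R$ is a crossed product $T$ of $G$ over $R$ for which there is a group monomorphism $\phi:G\to T^\ast$ (where $T^\ast$ is the group of units of $T$) with $\phi(g)\in T_g$ for all $g\in G$. Equivalently, it is the ring of formal finite sums $\sum_{g\in G} r_g g$ ($r_g\in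 R$) with multiplication $(r_g g)(r_h h)=r_g(g\cdot r_h)\,gh$, for some action of $G$ on $R$ by ring automorphisms. A group $G$ is amenable if there is a function $\mu:\mathcal P(G)\to[0,\infty]$ that is finitely additive on disjoint sets, satisfies $\mu(gA)=\mu(A)$ for all $A\subseteq G$, $g\in G$, and has $\mu(G)=1$. *)

theory Defs
  imports
    "HOL-Algebra.Algebra"
    "HOL-Library.Equipollence"
    "HOL-Library.Extended_Nonnegative_Real"
begin

text \<open>
  HOL-Algebra has only left modules over commutative rings, so one-sided modules over an
  arbitrary ring are represented here by the library's \<open>module\<close> record: \<open>a \<odot> x\<close> is the action of
  the scalar \<open>a\<close> on \<open>x\<close>, from the right (\<open>x a\<close>) in a right module and from the left (\<open>a x\<close>) in a
  left module.  The fields \<open>mult\<close> and \<open>one\<close> of these records are never used.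
\<close>

definition right_free_module :: "('a, 'm) ring_scheme \<Rightarrow> nat \<Rightarrow> ('a, nat \<Rightarrow> 'a) module" where
  "right_free_module S n =
     \<lparr>carrier = {..<n} \<rightarrow>\<^sub>E carrier S, monoid.mult = undefined, one = undefined,
      ring.zero = (\<lambda>i\<in>{..<n}. \<zero>\<^bsub>S\<^esub>),
      add = (\<lambda>v w. \<lambda>i\<in>{..<n}. v i \<oplus>\<^bsub>S\<^esub> w i),
      smult = (\<lambda>a v. \<lambda>i\<in>{..<n}. v i \<otimes>\<^bsub>S\<^esub> a)\<rparr>"

definition left_free_module :: "('a, 'm) ring_scheme \<Rightarrow> nat \<Rightarrow> ('a, nat \<Rightarrow> 'a) module" where
  "left_free_module S n =
     \<lparr>carrier = {..<n} \<rightarrow>\<^sub>E carrier S, monoid.mult = undefined, one = undefined,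
      ring.zero = (\<lambda>i\<in>{..<n}. \<zero>\<^bsub>S\<^esub>),
      add = (\<lambda>v w. \<lambda>i\<in>{..<n}. v i \<oplus>\<^bsub>S\<^esub> w i),
      smult = (\<lambda>a v. \<lambda>i\<in>{..<n}. a \<otimes>\<^bsub>S\<^esub> v i)\<rparr>"

definition mod_hom ::
  "('a, 'm) ring_scheme \<Rightarrow> ('a, 'b, 'p) module_scheme \<Rightarrow> ('a, 'c, 'q) module_scheme \<Rightarrow> ('b \<Rightarrow> 'c) set"
where
  "mod_hom S M N =
     {f \<in> carrier M \<rightarrow> carrier N.
        (\<forall>x\<in>carrier M. \<forall>y\<in>carrier M. f (x \<oplus>\<^bsub>M\<^esub> y) = f x \<oplus>\<^bsub>N\<^esub> f y) \<and>
        (\<forall>a\<in>carrier S. \<forall>x\<in>carrier M. f (a \<odot>\<^bsub>M\<^esub> x) = a \<odot>\<^bsub>N\<^esub> f x)}"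

definition mod_epi ::
  "('a, 'm) ring_scheme \<Rightarrow> ('a, 'b, 'p) module_scheme \<Rightarrow> ('a, 'c, 'q) module_scheme \<Rightarrow> ('b \<Rightarrow> 'c) set"
where
  "mod_epi S M N = {f \<in> mod_hom S M N. f ` carrier M = carrier N}"

definition mod_isomorphic ::
  "('a, 'm) ring_scheme \<Rightarrow> ('a, 'b, 'p) module_scheme \<Rightarrow> ('a, 'c, 'q) module_scheme \<Rightarrow> bool"
where
  "mod_isomorphic S M N \<longleftrightarrow> (\<exists>f\<in>mod_hom S M N. bij_betw f (carrier M) (carrier N))"

definition UGN :: "('a, 'm) ring_scheme \<Rightarrow> bool" where
  "UGN S \<longleftrightarrow>
     (\<forall>n>0. mod_epi S (right_free_module S n) (right_free_module S (n + 1)) = {})"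

text \<open>
  The first clause on \<open>f\<close> makes it extensional outside \<open>carrier G\<close>, so that \<open>\<exists>!\<close> expresses exactly
  the uniqueness of the homogeneous components of \<open>x\<close>.
\<close>

definition graded_ring ::
  "('g, 'n) monoid_scheme \<Rightarrow> ('a, 'm) ring_scheme \<Rightarrow> ('g \<Rightarrow> 'a set) \<Rightarrow> bool"
where
  "graded_ring G T D \<longleftrightarrow>
     ring T \<and>
     (\<forall>g\<in>carrier G. additive_subgroup (D g) T) \<and>
     (\<forall>x\<in>carrier T. \<exists>!f.
        f \<in> (\<Pi>\<^sub>E g\<in>carrier G. D g) \<and>
        finite {g \<in> carrier G. f g \<noteq> \<zero>\<^bsub>T\<^esub>} \<and>
        x = finsum T f {g \<in> carrier G. f g \<noteq> \<zero>\<^bsub>T\<^esub>}) \<and>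
     (\<forall>g\<in>carrier G. \<forall>h\<in>carrier G. \<forall>x\<in>D g. \<forall>y\<in>D h. x \<otimes>\<^bsub>T\<^esub> y \<in> D (g \<otimes>\<^bsub>G\<^esub> h))"

definition base_ring ::
  "('g, 'n) monoid_scheme \<Rightarrow> ('a, 'm) ring_scheme \<Rightarrow> ('g \<Rightarrow> 'a set) \<Rightarrow> ('a, 'm) ring_scheme"
where
  "base_ring G T D = T\<lparr>carrier := D \<one>\<^bsub>G\<^esub>\<rparr>"

definition full_grading ::
  "('g, 'n) monoid_scheme \<Rightarrow> ('a, 'm) ring_scheme \<Rightarrow> ('g \<Rightarrow> 'a set) \<Rightarrow> bool"
where
  "full_grading G T D \<longleftrightarrow> (\<forall>g\<in>carrier G. D g \<noteq> {\<zero>\<^bsub>T\<^esub>})"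

definition right_component ::
  "('a, 'm) ring_scheme \<Rightarrow> ('g \<Rightarrow> 'a set) \<Rightarrow> 'g \<Rightarrow> ('a, 'a) module"
where
  "right_component T D g =
     \<lparr>carrier = D g, monoid.mult = undefined, one = undefined, ring.zero = \<zero>\<^bsub>T\<^esub>, add = add T,
      smult = (\<lambda>a x. x \<otimes>\<^bsub>T\<^esub> a)\<rparr>"

definition left_component ::
  "('a, 'm) ring_scheme \<Rightarrow> ('g \<Rightarrow> 'a set) \<Rightarrow> 'g \<Rightarrow> ('a, 'a) module"
where
  "left_component T D g =
     \<lparr>carrier = D g, monoid.mult = undefined, one = undefined, ring.zero = \<zero>\<^bsub>T\<^esub>, add = add T,
      smult = (\<lambda>a x. a \<otimes>\<^bsub>T\<^esub> x)\<rparr>"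

definition boundedly_free ::
  "('g, 'n) monoid_scheme \<Rightarrow> ('a, 'm) ring_scheme \<Rightarrow> ('g \<Rightarrow> 'a set) \<Rightarrow> bool"
where
  "boundedly_free G T D \<longleftrightarrow>
     (\<exists>r>0.
        (\<forall>g\<in>carrier G. \<exists>i\<le>r.
           mod_isomorphic (base_ring G T D) (right_component T D g)
             (right_free_module (base_ring G T D) i)) \<or>
        (\<forall>g\<in>carrier G. \<exists>i\<le>r.
           mod_isomorphic (base_ring G T D) (left_component T D g)
             (left_free_module (base_ring G T D) i)))"

definition crossed_product ::
  "('g, 'n) monoid_scheme \<Rightarrow> ('a, 'm) ring_scheme \<Rightarrow> ('a, 'm) ring_scheme \<Rightarrow> ('g \<Rightarrow> 'a set) \<Rightarrow> bool"
where
  "crossed_product G R T D \<longleftrightarrow>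
     graded_ring G T D \<and> base_ring G T D = R \<and> (\<forall>g\<in>carrier G. \<exists>u\<in>Units T. u \<in> D g)"

definition skew_group_ring ::
  "('g, 'n) monoid_scheme \<Rightarrow> ('a, 'm) ring_scheme \<Rightarrow> ('a, 'm) ring_scheme \<Rightarrow> ('g \<Rightarrow> 'a set) \<Rightarrow> bool"
where
  "skew_group_ring G R T D \<longleftrightarrow>
     crossed_product G R T D \<and>
     (\<exists>\<phi>\<in>mon G (units_of T). \<forall>g\<in>carrier G. \<phi> g \<in> D g)"

definition amenable :: "('g, 'n) monoid_scheme \<Rightarrow> bool" where
  "amenable G \<longleftrightarrow>
     (\<exists>\<mu> :: 'g set \<Rightarrow> ennreal.
        (\<forall>A B. A \<subseteq> carrier G \<longrightarrow> B \<subseteq> carrier G \<longrightarrow> A \<inter> B = {} \<longrightarrow> \<mu> (A \<union> B) = \<mu> A + \<mu> B) \<and>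
        (\<forall>A g. A \<subseteq> carrier G \<longrightarrow> g \<in> carrier G \<longrightarrow> \<mu> (g <#\<^bsub>G\<^esub> A) = \<mu> A) \<and>
        \<mu> (carrier G) = 1)"

end

theory Submission
  imports Defs "HOL-Analysis.Function_Topology"
begin

text \<open>
  UGN of \<open>S\<close> means that no matrices over \<open>S\<close> of sizes \<open>(n+1) \<times> n\<close> and \<open>n \<times> (n+1)\<close> with \<open>n > 0\<close>
  have the identity as their product (\<open>UGN_iff_no_mat_retract\<close>).  In this form UGN passes to the
  opposite ring, and to \<open>S\<close> from any ring to which \<open>S\<close> has a homomorphism; in particular a graded
  ring with UGN has a base ring with UGN.

  Amenability enters through the condition \<open>doubling\<close>: some finite \<open>K \<subseteq> G\<close> satisfies
  \<open>|KF| \<ge> 2|F|\<close> for all finite \<open>F \<subseteq> G\<close>.  A group is non-amenable if and only if it has this property.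
  If doubling fails, then \<open>G\<close> has almost invariant finite sets, and a compactness argument yields an
  invariant mean (\<open>not_amenable_imp_doubling\<close>).  If doubling holds, then Hall's marriage theorem
  yields two piecewise translations \<open>G \<rightarrow> G\<close> that are injective and have disjoint images
  (\<open>doubling_imp_two_to_one\<close>), which an invariant mean forbids (\<open>doubling_imp_not_amenable\<close>).

  Let \<open>T\<close> be graded by \<open>G\<close>, with free components of positive bounded rank and a base ring with UGN.
  If \<open>T\<close> does not have UGN, then cutting the matrices that witness this down to the finitely many
  degrees in \<open>F\<close> and in \<open>SF\<close>, for a suitable finite \<open>S\<close>, shows that the total rank over \<open>SF\<close> is at
  least \<open>(n+1)/n\<close> times the total rank over \<open>F\<close> (\<open>right_growth\<close>).  Iterating this gives doubling, so
  \<open>G\<close> is not amenable (\<open>amenable_UGN_iff\<close>).  Left-free gradings are reduced to right-free ones by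
  passing to the opposite ring and the opposite group.  Crossed products over nonzero rings are full
  and free of rank \<open>1\<close>, and skew group rings are crossed products, so the equivalence for graded
  rings contains those for crossed products and skew group rings.

  Conversely, let \<open>G\<close> be non-amenable, and let \<open>\<A>\<close> be a translation-invariant Boolean algebra of
  subsets of \<open>G\<close> that contains the pieces of the two piecewise translations.  As a nonzero Boolean
  ring it maps to the field with two elements and so has UGN.  In the skew group ring of \<open>G\<close> over
  \<open>\<A>\<close> the two piecewise translations have left inverses that annihilate each other's image, which
  gives a \<open>2 \<times> 1\<close> matrix times a \<open>1 \<times> 2\<close> matrix equal to the identity
  (\<open>not_amenable_skew_group_ring\<close>).
\<close>

section \<open>Amenability and doubling\<close>

text \<open>
  Hall's marriage theorem for an arbitrary index type and finite neighbourhoods.  The proof is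
  Rado's: in a minimal subgraph that still satisfies Hall's condition every vertex has exactly one
  edge.  If a vertex \<open>i\<close> had two edges, then removing either of them would violate Hall's
  condition on two sets \<open>J\<close> and \<open>K\<close>, and counting neighbours of \<open>J \<union> K\<close> and \<open>J \<inter> K\<close> gives a
  contradiction.
\<close>

lemma hall_marriage_locally_finite:
  fixes E :: "('i \<times> 'b) set"
  assumes fin: "\<And>i. finite (E `` {i})"
    and hall: "\<And>J. finite J \<Longrightarrow> card J \<le> card (E `` J)"
  shows "\<exists>f. inj f \<and> (\<forall>i. (i, f i) \<in> E)"
proof -
  have fin': "finite (E `` J)" if "finite J" for J
  proof -
    have "E `` J = (\<Union>i\<in>J. E `` {i})" by auto
    then show ?thesis using fin that by simp
  qed
  \<comment> \<open>Sets of removable edges; a maximal one leaves a minimal subgraph.\<close>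
  define M where "M = {Z. Z \<subseteq> E \<and> (\<forall>J. finite J \<longrightarrow> card J \<le> card ((E - Z) `` J))}"
  have "\<exists>B\<in>M. \<forall>Q\<in>M. B \<subseteq> Q \<longrightarrow> Q = B"
  proof (rule subset_Zorn')
    fix C assume C: "subset.chain M C"
    then have CM: "C \<subseteq> M" by (auto simp: subset.chain_def)
    have "card J \<le> card ((E - \<Union>C) `` J)" if J: "finite J" for J
    proof (cases "C = {}")
      case True
      then show ?thesis using hall[OF J] by simp
    next
      case False
      \<comment> \<open>Only finitely many edges leave \<open>J\<close>, so one member of the chain already removes all
        those that the union removes.\<close>
      have "finite (\<Union>C \<inter> (J \<times> UNIV))"
      proof (rule finite_subset)
        show "\<Union>C \<inter> (J \<times> UNIV) \<subseteq> J \<times> (E `` J)" using CM by (auto simp: M_def)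
        show "finite (J \<times> (E `` J))" using J fin'[OF J] by simp
      qed
      moreover have "\<Union>C \<inter> (J \<times> UNIV) \<subseteq> \<Union>C" by auto
      ultimately obtain B where B: "B \<in> C" "\<Union>C \<inter> (J \<times> UNIV) \<subseteq> B"
        using finite_subset_Union_chain[OF _ _ False C] by metis
      then have "(E - B) `` J = (E - \<Union>C) `` J" by auto
      moreover have "card J \<le> card ((E - B) `` J)" using B CM J by (auto simp: M_def)
      ultimately show ?thesis by simp
    qed
    then show "\<Union>C \<in> M" using CM by (auto simp: M_def)
  qed
  then obtain Z where Z: "Z \<in> M" and max: "\<And>Q. Q \<in> M \<Longrightarrow> Z \<subseteq> Q \<Longrightarrow> Q = Z" by blast
  define D where "D = E - Z"
  have hallD: "card J \<le> card (D `` J)" if "finite J" for J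
    using Z that by (auto simp: M_def D_def)
  have finD: "finite (D `` J)" if "finite J" for J
    by (rule finite_subset[OF _ fin'[OF that]]) (auto simp: D_def)
  \<comment> \<open>By minimality, deleting the edge \<open>(i, x)\<close> makes some set containing \<open>i\<close> deficient;
    \<open>J\<close> is that set without \<open>i\<close>.\<close>
  have critical: "\<exists>J. finite J \<and> i \<notin> J \<and> card (D `` J \<union> (D `` {i} - {x})) \<le> card J"
    if ix: "(i, x) \<in> D" for i x
  proof -
    have "insert (i, x) Z \<notin> M" using max[of "insert (i, x) Z"] ix by (auto simp: D_def)
    moreover have "insert (i, x) Z \<subseteq> E" using ix Z by (auto simp: D_def M_def)
    ultimately obtain J where J: "finite J" "card ((E - insert (i, x) Z) `` J) < card J"
      by (auto simp: M_def not_le)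
    have J2: "card ((D - {(i, x)}) `` J) < card J"
    proof -
      have "E - insert (i, x) Z = D - {(i, x)}" by (auto simp: D_def)
      then show ?thesis using J by simp
    qed
    have iJ: "i \<in> J"
    proof (rule ccontr)
      assume "i \<notin> J"
      then have "(D - {(i, x)}) `` J = D `` J" by auto
      then show False using J2 hallD[OF J(1)] by simp
    qed
    have sub: "D `` (J - {i}) \<union> (D `` {i} - {x}) \<subseteq> (D - {(i, x)}) `` J"
      using iJ by auto
    have "finite ((D - {(i, x)}) `` J)"
      by (rule finite_subset[OF _ finD[OF J(1)]]) auto
    then have "card (D `` (J - {i}) \<union> (D `` {i} - {x})) \<le> card ((D - {(i, x)}) `` J)"
      using sub by (rule card_mono)
    also have "\<dots> \<le> card (J - {i})" using J2 J(1) iJ by simp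
    finally show ?thesis using J(1) by (intro exI[of _ "J - {i}"]) auto
  qed
  have unique: "x = y" if x: "(i, x) \<in> D" and y: "(i, y) \<in> D" for i x y
  proof (rule ccontr)
    assume "x \<noteq> y"
    obtain J where J: "finite J" "i \<notin> J" "card (D `` J \<union> (D `` {i} - {x})) \<le> card J"
      using critical[OF x] by blast
    obtain K where K: "finite K" "i \<notin> K" "card (D `` K \<union> (D `` {i} - {y})) \<le> card K"
      using critical[OF y] by blast
    let ?P = "D `` J \<union> (D `` {i} - {x})" and ?Q = "D `` K \<union> (D `` {i} - {y})"
    have fP: "finite ?P" "finite ?Q" using finD[of J] finD[of K] finD[of "{i}"] J K by auto
    have "D `` insert i (J \<union> K) \<subseteq> ?P \<union> ?Q" using \<open>x \<noteq> y\<close> by auto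
    then have "card (D `` insert i (J \<union> K)) \<le> card (?P \<union> ?Q)" using fP by (intro card_mono) auto
    moreover have "card (insert i (J \<union> K)) \<le> card (D `` insert i (J \<union> K))"
      using J K by (intro hallD) auto
    moreover have "card (insert i (J \<union> K)) = Suc (card (J \<union> K))" using J K by simp
    moreover have "D `` (J \<inter> K) \<subseteq> ?P \<inter> ?Q" by auto
    then have "card (D `` (J \<inter> K)) \<le> card (?P \<inter> ?Q)" using fP by (intro card_mono) auto
    moreover have "card (J \<inter> K) \<le> card (D `` (J \<inter> K))" using J by (intro hallD) auto
    moreover have "card ?P + card ?Q = card (?P \<union> ?Q) + card (?P \<inter> ?Q)"
      using fP by (rule card_Un_Int)
    moreover have "card J + card K = card (J \<union> K) + card (J \<inter> K)"
      using J K by (intro card_Un_Int) auto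
    ultimately show False using J(3) K(3) by linarith
  qed
  have "\<exists>x. (i, x) \<in> D" for i
    using hallD[of "{i}"] by (cases "D `` {i} = {}") auto
  then obtain f where f: "\<And>i. (i, f i) \<in> D" by metis
  have "inj f"
  proof (rule injI, rule ccontr)
    fix i j assume eq: "f i = f j" and ne: "i \<noteq> j"
    have "y = f i" if "(i, y) \<in> D \<or> (j, y) \<in> D" for y
      using that unique[OF _ f[of i]] unique[OF _ f[of j]] eq by auto
    then have "D `` {i, j} \<subseteq> {f i}" by auto
    then have "card (D `` {i, j}) \<le> card {f i}" by (intro card_mono) auto
    moreover have "card {i, j} \<le> card (D `` {i, j})" by (intro hallD) auto
    ultimately show False using ne by simp
  qed
  then show ?thesis using f by (auto simp: D_def)
qed

text \<open>
  One finite set \<open>K\<close> of left translations at least doubles the size of every finite set.  For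
  groups this is equivalent to non-amenability.
\<close>

definition doubling :: "('g, 'n) monoid_scheme \<Rightarrow> bool" where
  "doubling G \<longleftrightarrow>
     (\<exists>K. finite K \<and> K \<subseteq> carrier G \<and>
        (\<forall>F. finite F \<longrightarrow> F \<subseteq> carrier G \<longrightarrow> 2 * card F \<le> card (K <#>\<^bsub>G\<^esub> F)))"

lemma finite_set_mult: "finite A \<Longrightarrow> finite B \<Longrightarrow> finite (A <#>\<^bsub>G\<^esub> B)"
  by (auto simp: set_mult_def)

text \<open>
  Expansion by any factor \<open>c > 1\<close> suffices, even if it is measured by a weight that is only
  comparable to the cardinality: replace \<open>S\<close> by a power \<open>S\<^sup>k\<close> with \<open>c\<^sup>k > 2 r\<close>.
\<close>

lemma (in group) doublingI_expansion:
  fixes w :: "'a set \<Rightarrow> real" and r :: real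
  assumes S: "finite S" "S \<subseteq> carrier G" and c: "1 < c" and r: "0 < r"
    and w_lower: "\<And>F. finite F \<Longrightarrow> F \<subseteq> carrier G \<Longrightarrow> card F \<le> w F"
    and w_upper: "\<And>F. finite F \<Longrightarrow> F \<subseteq> carrier G \<Longrightarrow> w F \<le> r * card F"
    and w_grow: "\<And>F. finite F \<Longrightarrow> F \<subseteq> carrier G \<Longrightarrow> c * w F \<le> w (S <#> F)"
  shows "doubling G"
proof -
  define P where "P k = ((<#>) S ^^ k) {\<one>}" for k
  have PSuc: "P (Suc k) = S <#> P k" for k by (simp add: P_def)
  have P: "finite (P k) \<and> P k \<subseteq> carrier G" for k
  proof (induction k)
    case 0 show ?case by (simp add: P_def)
  next
    case (Suc k)
    then show ?case unfolding PSuc using S by (simp add: finite_set_mult set_mult_closed)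
  qed
  have grow: "c ^ k * w F \<le> w (P k <#> F)" if F: "finite F" "F \<subseteq> carrier G" for k F
  proof (induction k)
    case 0
    have "{\<one>} <#> F = F" using F by (force simp: set_mult_def)
    then show ?case by (simp add: P_def)
  next
    case (Suc k)
    have "c ^ Suc k * w F \<le> c * w (P k <#> F)" using Suc c by simp
    also have "\<dots> \<le> w (S <#> (P k <#> F))"
      using P[of k] F by (intro w_grow) (auto simp: finite_set_mult set_mult_closed)
    also have "S <#> (P k <#> F) = P (Suc k) <#> F"
      unfolding PSuc using P[of k] F S by (simp add: set_mult_assoc)
    finally show ?case .
  qed
  obtain k where k: "2 * r < c ^ k" using real_arch_pow[OF c] by blast
  have "2 * card F \<le> card (P k <#> F)" if F: "finite F" "F \<subseteq> carrier G" for F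
  proof -
    have "2 * r * card F \<le> c ^ k * card F" using k by (intro mult_right_mono) auto
    also have "\<dots> \<le> c ^ k * w F" using c w_lower[OF F] by (intro mult_left_mono) auto
    also have "\<dots> \<le> w (P k <#> F)" by (rule grow[OF F])
    also have "\<dots> \<le> r * card (P k <#> F)"
      using P[of k] F by (intro w_upper) (auto simp: finite_set_mult set_mult_closed)
    finally have "r * (2 * card F) \<le> r * card (P k <#> F)" by (simp add: algebra_simps)
    then have "real (2 * card F) \<le> real (card (P k <#> F))" using r by simp
    then show ?thesis by linarith
  qed
  then show ?thesis unfolding doubling_def using P[of k] by blast
qed

text \<open>
  Hall's theorem turns doubling into two injections \<open>G \<rightarrow> G\<close> with disjoint images, each of which
  agrees at every point with a left translation by an element of a fixed finite set, that is, into
  a paradoxical decomposition.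
\<close>

lemma (in group) doubling_imp_two_to_one:
  assumes "doubling G"
  obtains K f where "finite K" "K \<subseteq> carrier G"
    and "inj_on (\<lambda>(x, i). f x i) (carrier G \<times> UNIV)"
    and "\<And>x i. x \<in> carrier G \<Longrightarrow> \<exists>k\<in>K. f x (i::bool) = k \<otimes> x"
proof -
  obtain K where K: "finite K" "K \<subseteq> carrier G"
    and dbl: "\<And>F. finite F \<Longrightarrow> F \<subseteq> carrier G \<Longrightarrow> 2 * card F \<le> card (K <#> F)"
    using assms by (auto simp: doubling_def)
  \<comment> \<open>The marriage lemma is applied to all of the index type, so an index outside \<open>carrier G\<close> is
    married to a private dummy partner.\<close>
  define E :: "(('a \<times> bool) \<times> ('a + ('a \<times> bool))) set" where
    "E = {(p, Inl (k \<otimes> fst p)) | p k. fst p \<in> carrier G \<and> k \<in> K} \<union>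
         {(p, Inr p) | p. fst p \<notin> carrier G}"
  have fin: "finite (E `` {p})" for p
  proof (rule finite_subset)
    show "E `` {p} \<subseteq> (\<lambda>k. Inl (k \<otimes> fst p)) ` K \<union> {Inr p}" by (auto simp: E_def)
    show "finite ((\<lambda>k. Inl (k \<otimes> fst p)) ` K \<union> {Inr p})" using K by simp
  qed
  have "card J \<le> card (E `` J)" if J: "finite J" for J
  proof -
    define F where "F = {x \<in> fst ` J. x \<in> carrier G}"
    define J' where "J' = {p \<in> J. fst p \<notin> carrier G}"
    have F: "finite F" "F \<subseteq> carrier G" and J': "finite J'" using J by (auto simp: F_def J'_def)
    have "J \<subseteq> (F \<times> UNIV) \<union> J'" by (force simp: F_def J'_def)
    then have "card J \<le> card ((F \<times> (UNIV :: bool set)) \<union> J')" using F J' by (intro card_mono) auto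
    also have "\<dots> \<le> card (F \<times> (UNIV :: bool set)) + card J'" by (rule card_Un_le)
    also have "\<dots> = 2 * card F + card J'" by (simp add: card_cartesian_product)
    also have "\<dots> \<le> card (K <#> F) + card J'" using dbl[OF F] by simp
    also have "\<dots> = card (E `` J)"
    proof -
      have "E `` J = Inl ` (K <#> F) \<union> Inr ` J'"
        by (force simp: E_def set_mult_def F_def J'_def)
      moreover have "finite (K <#> F)" using K F by (simp add: finite_set_mult)
      moreover have "Inl ` (K <#> F) \<inter> Inr ` J' = {}" by auto
      ultimately have "card (E `` J) = card (Inl ` (K <#> F) :: ('a + 'a \<times> bool) set) +
          card (Inr ` J' :: ('a + 'a \<times> bool) set)"
        using J' by (simp only: card_Un_disjoint finite_imageI)
      then show ?thesis by (simp add: card_image)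
    qed
    finally show ?thesis .
  qed
  from hall_marriage_locally_finite[OF fin this]
  obtain h where h: "inj h" "\<And>p. (p, h p) \<in> E" by blast
  have ex: "\<exists>k\<in>K. h (x, i) = Inl (k \<otimes> x)" if "x \<in> carrier G" for x i
    using h(2)[of "(x, i)"] that by (auto simp: E_def)
  define f where "f x i = projl (h (x, i))" for x i
  show ?thesis
  proof
    show "inj_on (\<lambda>(x, i). f x i) (carrier G \<times> UNIV)"
    proof (rule inj_onI)
      fix p q assume p: "p \<in> carrier G \<times> (UNIV::bool set)" and q: "q \<in> carrier G \<times> (UNIV::bool set)"
        and eq: "(case p of (x, i) \<Rightarrow> f x i) = (case q of (x, i) \<Rightarrow> f x i)"
      have "projl (h p) = projl (h q)" using eq by (auto simp: f_def split: prod.splits)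
      moreover have "\<exists>u. h p = Inl u" "\<exists>u. h q = Inl u"
        using ex[of "fst p" "snd p"] ex[of "fst q" "snd q"] p q by auto
      ultimately have "h p = h q" by auto
      then show "p = q" using h(1) by (auto dest: injD)
    qed
    show "\<exists>k\<in>K. f x i = k \<otimes> x" if "x \<in> carrier G" for x i
      using ex[OF that, of i] by (auto simp: f_def)
  qed (use K in auto)
qed

lemma (in group) doubling_imp_not_amenable:
  assumes "doubling G"
  shows "\<not> amenable G"
proof
  assume "amenable G"
  then obtain \<mu> :: "'a set \<Rightarrow> ennreal" where
    add: "\<And>A B. A \<subseteq> carrier G \<Longrightarrow> B \<subseteq> carrier G \<Longrightarrow> A \<inter> B = {} \<Longrightarrow> \<mu> (A \<union> B) = \<mu> A + \<mu> B"
    and inv: "\<And>A g. A \<subseteq> carrier G \<Longrightarrow> g \<in> carrier G \<Longrightarrow> \<mu> (g <# A) = \<mu> A"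
    and one: "\<mu> (carrier G) = 1"
    unfolding amenable_def by blast
  obtain K f where K: "finite K" "K \<subseteq> carrier G"
    and inj: "inj_on (\<lambda>(x, i). f x i) (carrier G \<times> UNIV)"
    and f: "\<And>x i. x \<in> carrier G \<Longrightarrow> \<exists>k\<in>K. f x (i::bool) = k \<otimes> x"
    using doubling_imp_two_to_one[OF assms] by metis
  have fG: "f x i \<in> carrier G" if "x \<in> carrier G" for x i
    using f[OF that, of i] K that by auto
  have injD: "x = y \<and> i = j" if "x \<in> carrier G" "y \<in> carrier G" "f x i = f y j" for x y i j
    using inj_onD[OF inj, of "(x, i)" "(y, j)"] that by auto
  \<comment> \<open>\<open>f _ i\<close> is a piecewise left translation with pieces indexed by \<open>K\<close>, hence preserves \<open>\<mu>\<close>.\<close>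
  have piecewise: "\<mu> ((\<lambda>x. f x i) ` {x \<in> carrier G. \<exists>k\<in>K'. f x i = k \<otimes> x}) =
      \<mu> {x \<in> carrier G. \<exists>k\<in>K'. f x i = k \<otimes> x}" if "finite K'" "K' \<subseteq> K" for i K'
    using that
  proof (induction K' rule: finite_induct)
    case empty
    then show ?case by simp
  next
    case (insert k K')
    let ?A = "\<lambda>L. {x \<in> carrier G. \<exists>k\<in>L. f x i = k \<otimes> x}"
    have kG: "k \<in> carrier G" using insert.prems K by auto
    have un: "?A (insert k K') = ?A {k} \<union> ?A K'" by auto
    have disj: "?A {k} \<inter> ?A K' = {}"
      using insert.hyps insert.prems K kG by (auto simp: subset_iff)
    have img: "(\<lambda>x. f x i) ` ?A {k} = k <# ?A {k}" by (auto simp: l_coset_def)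
    have "\<mu> ((\<lambda>x. f x i) ` ?A (insert k K')) =
        \<mu> ((\<lambda>x. f x i) ` ?A {k} \<union> (\<lambda>x. f x i) ` ?A K')" by (simp only: un image_Un)
    also have "\<dots> = \<mu> ((\<lambda>x. f x i) ` ?A {k}) + \<mu> ((\<lambda>x. f x i) ` ?A K')"
    proof (rule add)
      show "(\<lambda>x. f x i) ` ?A {k} \<inter> (\<lambda>x. f x i) ` ?A K' = {}"
      proof (rule ccontr)
        assume "\<not> ?thesis"
        then obtain x y where x: "x \<in> ?A {k}" and y: "y \<in> ?A K'" and eq: "f x i = f y i"
          by blast
        then have "x = y" using injD[of x y i i] by simp
        then show False using x y disj by blast
      qed
    qed (use fG kG in auto)
    also have "\<dots> = \<mu> (?A {k}) + \<mu> (?A K')"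
      unfolding img using insert kG by (simp add: inv)
    also have "\<dots> = \<mu> (?A {k} \<union> ?A K')"
      by (intro add[symmetric] disj) auto
    finally show ?case by (simp only: un)
  qed
  have full: "\<mu> ((\<lambda>x. f x i) ` carrier G) = 1" for i
  proof -
    have "{x \<in> carrier G. \<exists>k\<in>K. f x i = k \<otimes> x} = carrier G" using f by auto
    then show ?thesis using piecewise[OF K(1) order_refl, of i] one by simp
  qed
  let ?U = "(\<lambda>x. f x True) ` carrier G \<union> (\<lambda>x. f x False) ` carrier G"
  have "\<mu> ?U = \<mu> ((\<lambda>x. f x True) ` carrier G) + \<mu> ((\<lambda>x. f x False) ` carrier G)"
  proof (rule add)
    show "(\<lambda>x. f x True) ` carrier G \<inter> (\<lambda>x. f x False) ` carrier G = {}"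
    proof (rule ccontr)
      assume "\<not> ?thesis"
      then obtain x y where "x \<in> carrier G" "y \<in> carrier G" "f x True = f y False" by blast
      then show False using injD by blast
    qed
  qed (use fG in auto)
  then have "\<mu> ?U = 1 + 1" by (simp only: full)
  moreover have "\<mu> (carrier G) = \<mu> ?U + \<mu> (carrier G - ?U)"
  proof -
    have "?U \<subseteq> carrier G" using fG by auto
    then have "carrier G = ?U \<union> (carrier G - ?U)" by blast
    then show ?thesis using add[of ?U "carrier G - ?U"] \<open>?U \<subseteq> carrier G\<close> by simp
  qed
  ultimately have "(1::ennreal) + 1 \<le> 1" using one by (metis le_iff_add)
  then show False by simp
qed

text \<open>
  Without doubling, no \<open>1 + e\<close> is a growth factor, so every finite \<open>S\<close> admits finite sets
  \<open>F\<close> that are almost invariant under \<open>S\<close> (Folner sets).  An invariant mean is a limit point of the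
  normalised counting measures \<open>A \<mapsto> |A \<inter> F| / |F|\<close> in the compact space \<open>[0,1]\<^bsup>P(G)\<^esup>\<close>; instead
  of a net, the proof uses the finite intersection property of the closed conditions \<open>C (s, n)\<close>.
\<close>

lemma (in group) not_amenable_imp_doubling:
  assumes na: "\<not> amenable G"
  shows "doubling G"
proof (rule ccontr)
  assume nd: "\<not> doubling G"
  have folner: "\<exists>F. finite F \<and> F \<subseteq> carrier G \<and> F \<noteq> {} \<and>
      real (card ((S <#> F) - F)) \<le> e * card F"
    if S: "finite S" "S \<subseteq> carrier G" and e: "0 < e" for S and e :: real
  proof (rule ccontr)
    assume neg: "\<not> ?thesis"
    have "doubling G"
    proof (rule doublingI_expansion[where S = "insert \<one> S" and c = "1 + e" and r = 1 and w = card])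
      fix F assume F: "finite F" "F \<subseteq> carrier G"
      have grow: "e * card F \<le> card ((S <#> F) - F)"
      proof (cases "F = {}")
        case False
        then have "\<not> real (card ((S <#> F) - F)) \<le> e * card F" using neg F by blast
        then show ?thesis by linarith
      qed simp
      have eq: "insert \<one> S <#> F = F \<union> ((S <#> F) - F)"
        using F by (force simp: set_mult_def)
      have "card (insert \<one> S <#> F) = card F + card ((S <#> F) - F)"
        unfolding eq using F S by (intro card_Un_disjoint) (auto simp: finite_set_mult)
      then show "(1 + e) * card F \<le> card (insert \<one> S <#> F)"
        using grow by (simp add: algebra_simps)
    qed (use S e in auto)
    then show False using nd by simp
  qed
  define Q where "Q = (\<Pi>\<^sub>E A\<in>(UNIV :: 'a set set). {0..1::real})"
  have Q: "compact Q"
    unfolding Q_def compactin_euclidean_iff[symmetric] euclidean_product_topology[symmetric]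
    by (subst compactin_PiE) auto
  \<comment> \<open>Normalised, finitely additive, and invariant under \<open>s\<close> up to \<open>1/(n+1)\<close>.\<close>
  define C where "C = (\<lambda>(s, n::nat). {m :: 'a set \<Rightarrow> real. m (carrier G) = 1 \<and>
      (\<forall>A B. A \<subseteq> carrier G \<and> B \<subseteq> carrier G \<and> A \<inter> B = {} \<longrightarrow> m (A \<union> B) = m A + m B) \<and>
      (\<forall>A. A \<subseteq> carrier G \<longrightarrow> \<bar>m (s <# A) - m A\<bar> \<le> 1 / Suc n)})"
  have "Q \<inter> (\<Inter>p\<in>carrier G \<times> UNIV. C p) \<noteq> {}"
  proof (rule compact_imp_fip_image[OF Q])
    fix p :: "'a \<times> nat"
    show "closed (C p)"
      unfolding C_def case_prod_unfold
      by (intro closed_Collect_conj closed_Collect_all closed_Collect_imp closed_Collect_eq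
          closed_Collect_le open_Collect_const continuous_intros continuous_on_product_coordinates)
  next
    fix I :: "('a \<times> nat) set" assume I: "finite I" "I \<subseteq> carrier G \<times> UNIV"
    \<comment> \<open>Inverses are included so that both \<open>m A\<close> and \<open>m (s A)\<close> can be bounded by the other.\<close>
    define S where "S = fst ` I \<union> (\<lambda>p. inv (fst p)) ` I"
    define n where "n = Max (insert 0 (snd ` I))"
    have S: "finite S" "S \<subseteq> carrier G" using I by (auto simp: S_def)
    obtain F where F: "finite F" "F \<subseteq> carrier G" "F \<noteq> {}"
      and Fs: "real (card ((S <#> F) - F)) \<le> (1 / Suc n) * card F"
      using folner[OF S, of "1 / Suc n"] by auto
    have F0: "0 < card F" using F by (simp add: card_gt_0_iff)
    define m where "m A = real (card (A \<inter> F)) / card F" for A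
    have "m \<in> Q"
    proof -
      have "card (A \<inter> F) \<le> card F" for A using F by (intro card_mono) auto
      then show ?thesis using F0 by (auto simp: Q_def m_def divide_le_eq_1)
    qed
    moreover have "m \<in> C (s, k)" if sk: "(s, k) \<in> I" for s k
    proof -
      have s: "s \<in> carrier G" "s \<in> S" "inv s \<in> S" using sk I by (force simp: S_def)+
      have kn: "k \<le> n" using sk I by (auto simp: n_def intro!: Max_ge image_eqI[of _ snd])
      have m1: "m (carrier G) = 1" using F F0 by (simp add: m_def Int_absorb1)
      have m2: "m (A \<union> B) = m A + m B" if "A \<inter> B = {}" for A B
      proof -
        have "card ((A \<union> B) \<inter> F) = card (A \<inter> F) + card (B \<inter> F)"
          unfolding Int_Un_distrib2 using F that by (intro card_Un_disjoint) auto
        then show ?thesis by (simp add: m_def add_divide_distrib)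
      qed
      \<comment> \<open>Translating by \<open>t\<close> loses at most the points that \<open>t\<close> moves out of \<open>F\<close>.\<close>
      have shift: "real (card (B \<inter> F)) \<le> card ((t <# B) \<inter> F) + (1 / Suc n) * card F"
        if t: "t \<in> S" and B: "B \<subseteq> carrier G" for t B
      proof -
        have tG: "t \<in> carrier G" using t S by auto
        have "card (B \<inter> F) = card ((\<lambda>x. t \<otimes> x) ` (B \<inter> F))"
          using tG B by (intro card_image[symmetric] inj_onI) (auto simp: subset_iff)
        also have "\<dots> \<le> card (((t <# B) \<inter> F) \<union> ((S <#> F) - F))"
          using t F S by (intro card_mono) (auto simp: l_coset_def set_mult_def finite_set_mult)
        also have "\<dots> \<le> card ((t <# B) \<inter> F) + card ((S <#> F) - F)" by (rule card_Un_le)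
        finally show ?thesis using Fs by linarith
      qed
      have m3: "\<bar>m (s <# A) - m A\<bar> \<le> 1 / Suc k" if A: "A \<subseteq> carrier G" for A
      proof -
        have sA: "s <# A \<subseteq> carrier G" using s A by (auto simp: l_coset_def)
        have "inv s <# (s <# A) = A" using s A by (simp add: lcos_m_assoc lcos_mult_one)
        then have "\<bar>real (card ((s <# A) \<inter> F)) - card (A \<inter> F)\<bar> \<le> (1 / Suc n) * card F"
          using shift[OF s(2) A] shift[OF s(3) sA] by (simp add: abs_le_iff)
        then have "\<bar>m (s <# A) - m A\<bar> \<le> 1 / Suc n"
          using F0 by (simp add: m_def diff_divide_distrib[symmetric] abs_divide divide_le_eq)
        also have "\<dots> \<le> 1 / Suc k" using kn by (simp add: frac_le)
        finally show ?thesis .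
      qed
      show ?thesis using m1 m2 m3 by (simp add: C_def)
    qed
    ultimately show "Q \<inter> (\<Inter>p\<in>I. C p) \<noteq> {}" by auto
  qed
  then obtain m where mX: "m \<in> Q" and mC: "\<And>s n. s \<in> carrier G \<Longrightarrow> m \<in> C (s, n)" by auto
  have m0: "0 \<le> m A" for A using mX by (auto simp: Q_def PiE_def Pi_def)
  have inv: "m (g <# A) = m A" if "g \<in> carrier G" "A \<subseteq> carrier G" for g A
  proof -
    have "\<bar>m (g <# A) - m A\<bar> \<le> 1 / Suc n" for n using mC[OF that(1), of n] that(2) by (auto simp: C_def)
    then have "\<bar>m (g <# A) - m A\<bar> < e" if "0 < e" for e
      using nat_approx_posE[OF that] by (metis order_le_less_trans)
    then show ?thesis by (metis abs_0_eq eq_iff_diff_eq_0 less_irrefl zero_less_abs_iff)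
  qed
  have "amenable G"
    unfolding amenable_def
  proof (intro exI[of _ "\<lambda>A. ennreal (m A)"] conjI allI impI)
    show "ennreal (m (A \<union> B)) = ennreal (m A) + ennreal (m B)"
      if "A \<subseteq> carrier G" "B \<subseteq> carrier G" "A \<inter> B = {}" for A B
      using mC[OF one_closed, of 0] that m0 by (simp add: C_def flip: ennreal_plus)
    show "ennreal (m (g <# A)) = ennreal (m A)" if "A \<subseteq> carrier G" "g \<in> carrier G" for A g
      using inv that by simp
    show "ennreal (m (carrier G)) = 1" using mC[OF one_closed, of 0] by (simp add: C_def)
  qed
  then show False using na by simp
qed

section \<open>Unbounded generating number in terms of matrices\<close>

lemma additive_map_finsum:
  assumes "abelian_monoid A" "abelian_monoid B"
    and h: "\<And>x. x \<in> carrier A \<Longrightarrow> h x \<in> carrier B" "h \<zero>\<^bsub>A\<^esub> = \<zero>\<^bsub>B\<^esub>"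
    and add: "\<And>x y. x \<in> carrier A \<Longrightarrow> y \<in> carrier A \<Longrightarrow> h (x \<oplus>\<^bsub>A\<^esub> y) = h x \<oplus>\<^bsub>B\<^esub> h y"
    and f: "f \<in> I \<rightarrow> carrier A"
  shows "h (finsum A f I) = finsum B (\<lambda>i. h (f i)) I"
proof -
  interpret A: abelian_monoid A by fact
  interpret B: abelian_monoid B by fact
  show ?thesis
    using f
  proof (induction I rule: infinite_finite_induct)
    case (insert i I)
    then have "h (finsum A f (insert i I)) = h (f i \<oplus>\<^bsub>A\<^esub> finsum A f I)"
      by (subst A.finsum_insert) auto
    also have "\<dots> = h (f i) \<oplus>\<^bsub>B\<^esub> finsum B (\<lambda>i. h (f i)) I"
      using insert by (subst add) (auto simp: Pi_def)
    also have "\<dots> = finsum B (\<lambda>i. h (f i)) (insert i I)"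
      using insert h by (subst B.finsum_insert) (auto simp: Pi_def)
    finally show ?case .
  qed (simp_all add: h)
qed

lemma (in abelian_monoid) finsum_Sigma:
  assumes "finite I" "\<And>i. i \<in> I \<Longrightarrow> finite (J i)"
    and "\<And>i j. i \<in> I \<Longrightarrow> j \<in> J i \<Longrightarrow> f i j \<in> carrier G"
  shows "(\<Oplus>p\<in>Sigma I J. f (fst p) (snd p)) = (\<Oplus>i\<in>I. \<Oplus>j\<in>J i. f i j)"
  using assms
proof (induction I rule: finite_induct)
  case (insert i I)
  have eq: "Sigma (insert i I) J = Pair i ` J i \<union> Sigma I J" by auto
  have "(\<Oplus>p\<in>Sigma (insert i I) J. f (fst p) (snd p)) =
      (\<Oplus>p\<in>Pair i ` J i. f (fst p) (snd p)) \<oplus> (\<Oplus>p\<in>Sigma I J. f (fst p) (snd p))"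
    unfolding eq using insert by (subst finsum_Un_disjoint) auto
  also have "(\<Oplus>p\<in>Pair i ` J i. f (fst p) (snd p)) = (\<Oplus>j\<in>J i. f i j)"
    using insert by (subst finsum_reindex) (auto simp: inj_on_def)
  also have "(\<Oplus>p\<in>Sigma I J. f (fst p) (snd p)) = (\<Oplus>i\<in>I. \<Oplus>j\<in>J i. f i j)"
    using insert by auto
  also have "(\<Oplus>j\<in>J i. f i j) \<oplus> (\<Oplus>i\<in>I. \<Oplus>j\<in>J i. f i j) = (\<Oplus>i\<in>insert i I. \<Oplus>j\<in>J i. f i j)"
    using insert by (subst finsum_insert) (auto intro!: finsum_closed)
  finally show ?case .
qed simp

lemma (in abelian_monoid) finsum_swap:
  assumes "finite I" "finite J"
    and "\<And>i j. i \<in> I \<Longrightarrow> j \<in> J \<Longrightarrow> f i j \<in> carrier G"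
  shows "(\<Oplus>i\<in>I. \<Oplus>j\<in>J. f i j) = (\<Oplus>j\<in>J. \<Oplus>i\<in>I. f i j)"
  using assms(1,3)
proof (induction I rule: finite_induct)
  case empty
  then show ?case by (simp add: finsum_zero)
next
  case (insert i I)
  have "(\<Oplus>i\<in>insert i I. \<Oplus>j\<in>J. f i j) = (\<Oplus>j\<in>J. f i j) \<oplus> (\<Oplus>j\<in>J. \<Oplus>i\<in>I. f i j)"
    using insert by (subst finsum_insert) (auto intro!: finsum_closed)
  also have "\<dots> = (\<Oplus>j\<in>J. f i j \<oplus> (\<Oplus>i\<in>I. f i j))"
    using insert by (subst finsum_addf) (auto intro!: finsum_closed)
  also have "\<dots> = (\<Oplus>j\<in>J. \<Oplus>i\<in>insert i I. f i j)"
    using insert by (intro finsum_cong') (auto intro!: finsum_closed a_closed)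
  finally show ?case .
qed

lemma (in abelian_monoid) finsum_delta:
  assumes "finite I" "k \<in> I" "f k \<in> carrier G"
  shows "(\<Oplus>i\<in>I. if i = k then f i else \<zero>) = f k"
proof -
  have I: "I = insert k (I - {k})" using assms by auto
  have "(\<Oplus>i\<in>insert k (I - {k}). if i = k then f i else \<zero>) =
      f k \<oplus> (\<Oplus>i\<in>I - {k}. if i = k then f i else \<zero>)"
    using assms by (subst finsum_insert) auto
  also have "(\<Oplus>i\<in>I - {k}. if i = k then f i else \<zero>) = \<zero>"
    by (rule add.finprod_one_eqI) auto
  finally show ?thesis using I assms by simp
qed

text \<open>
  There are matrices \<open>a\<close> (rows \<open>I\<close>, columns \<open>J\<close>) and \<open>b\<close> (rows \<open>J\<close>, columns \<open>I\<close>) over \<open>S\<close> with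
  \<open>a b = 1\<close>; equivalently, the free module on \<open>I\<close> is a retract of the free module on \<open>J\<close>.
  Arbitrary index sets avoid an enumeration of the bases that occur later.
\<close>

definition mat_retract :: "('a, 'm) ring_scheme \<Rightarrow> 'i set \<Rightarrow> 'j set \<Rightarrow> bool" where
  "mat_retract S I J \<longleftrightarrow>
     (\<exists>a b. (\<forall>i\<in>I. \<forall>j\<in>J. a i j \<in> carrier S \<and> b j i \<in> carrier S) \<and>
        (\<forall>i\<in>I. \<forall>k\<in>I. (\<Oplus>\<^bsub>S\<^esub>j\<in>J. a i j \<otimes>\<^bsub>S\<^esub> b j k) = (if i = k then \<one>\<^bsub>S\<^esub> else \<zero>\<^bsub>S\<^esub>)))"

lemma mat_retractE:
  assumes "mat_retract S I J"
  obtains a b where "\<And>i j. i \<in> I \<Longrightarrow> j \<in> J \<Longrightarrow> a i j \<in> carrier S"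
    and "\<And>i j. i \<in> I \<Longrightarrow> j \<in> J \<Longrightarrow> b j i \<in> carrier S"
    and "\<And>i k. i \<in> I \<Longrightarrow> k \<in> I \<Longrightarrow>
      (\<Oplus>\<^bsub>S\<^esub>j\<in>J. a i j \<otimes>\<^bsub>S\<^esub> b j k) = (if i = k then \<one>\<^bsub>S\<^esub> else \<zero>\<^bsub>S\<^esub>)"
  using assms unfolding mat_retract_def by blast

lemma mat_retractI:
  assumes "\<And>i j. i \<in> I \<Longrightarrow> j \<in> J \<Longrightarrow> a i j \<in> carrier S"
    and "\<And>i j. i \<in> I \<Longrightarrow> j \<in> J \<Longrightarrow> b j i \<in> carrier S"
    and "\<And>i k. i \<in> I \<Longrightarrow> k \<in> I \<Longrightarrow>
      (\<Oplus>\<^bsub>S\<^esub>j\<in>J. a i j \<otimes>\<^bsub>S\<^esub> b j k) = (if i = k then \<one>\<^bsub>S\<^esub> else \<zero>\<^bsub>S\<^esub>)"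
  shows "mat_retract S I J"
  using assms unfolding mat_retract_def by blast

lemma (in ring) mat_retract_reindex:
  assumes "mat_retract R I J"
    and p: "inj_on p I'" "p ` I' \<subseteq> I" and q: "bij_betw q J' J"
  shows "mat_retract R I' J'"
proof -
  obtain a b where a: "\<And>i j. i \<in> I \<Longrightarrow> j \<in> J \<Longrightarrow> a i j \<in> carrier R"
    and b: "\<And>i j. i \<in> I \<Longrightarrow> j \<in> J \<Longrightarrow> b j i \<in> carrier R"
    and ab: "\<And>i k. i \<in> I \<Longrightarrow> k \<in> I \<Longrightarrow> (\<Oplus>j\<in>J. a i j \<otimes> b j k) = (if i = k then \<one> else \<zero>)"
    using assms(1) by (rule mat_retractE) (rule that)
  have J: "J = q ` J'" "inj_on q J'" using q by (auto simp: bij_betw_def)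
  show ?thesis
  proof (rule mat_retractI[of _ _ "\<lambda>i j. a (p i) (q j)" _ "\<lambda>j i. b (q j) (p i)"])
    fix i k assume ik: "i \<in> I'" "k \<in> I'"
    then have pik: "p i \<in> I" "p k \<in> I" using p by auto
    have "(\<Oplus>j\<in>J'. a (p i) (q j) \<otimes> b (q j) (p k)) = (\<Oplus>j\<in>J. a (p i) j \<otimes> b j (p k))"
      unfolding J(1) using J pik a b by (subst finsum_reindex) auto
    also have "\<dots> = (if i = k then \<one> else \<zero>)"
      using ab[OF pik] inj_onD[OF p(1) _ ik] by auto
    finally show "(\<Oplus>j\<in>J'. a (p i) (q j) \<otimes> b (q j) (p k)) = (if i = k then \<one> else \<zero>)" .
  qed (use a b p J in auto)
qed

lemma mat_retract_ring_hom:
  assumes "ring S" "ring S'" and h: "h \<in> ring_hom S S'" and "mat_retract S I J"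
  shows "mat_retract S' I J"
proof -
  interpret S: ring S by fact
  interpret S': ring S' by fact
  obtain a b where a: "\<And>i j. i \<in> I \<Longrightarrow> j \<in> J \<Longrightarrow> a i j \<in> carrier S"
    and b: "\<And>i j. i \<in> I \<Longrightarrow> j \<in> J \<Longrightarrow> b j i \<in> carrier S"
    and ab: "\<And>i k. i \<in> I \<Longrightarrow> k \<in> I \<Longrightarrow>
      (\<Oplus>\<^bsub>S\<^esub>j\<in>J. a i j \<otimes>\<^bsub>S\<^esub> b j k) = (if i = k then \<one>\<^bsub>S\<^esub> else \<zero>\<^bsub>S\<^esub>)"
    using assms(4) by (rule mat_retractE) (rule that)
  have h0: "h \<zero>\<^bsub>S\<^esub> = \<zero>\<^bsub>S'\<^esub>" using ring_hom_zero[OF h] assms by simp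
  show ?thesis
  proof (rule mat_retractI[of _ _ "\<lambda>i j. h (a i j)" _ "\<lambda>j i. h (b j i)"])
    fix i k assume ik: "i \<in> I" "k \<in> I"
    have "(\<Oplus>\<^bsub>S'\<^esub>j\<in>J. h (a i j) \<otimes>\<^bsub>S'\<^esub> h (b j k)) = (\<Oplus>\<^bsub>S'\<^esub>j\<in>J. h (a i j \<otimes>\<^bsub>S\<^esub> b j k))"
      using a b ik by (intro S'.finsum_cong') (auto simp: ring_hom_mult[OF h] intro!: ring_hom_closed[OF h])
    also have "\<dots> = h (\<Oplus>\<^bsub>S\<^esub>j\<in>J. a i j \<otimes>\<^bsub>S\<^esub> b j k)"
      using a b ik
      by (intro additive_map_finsum[symmetric] S.abelian_monoid_axioms S'.abelian_monoid_axioms)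
         (auto simp: h0 ring_hom_add[OF h] intro!: ring_hom_closed[OF h])
    also have "\<dots> = (if i = k then \<one>\<^bsub>S'\<^esub> else \<zero>\<^bsub>S'\<^esub>)"
      using ab[OF ik] h0 ring_hom_one[OF h] by auto
    finally show "(\<Oplus>\<^bsub>S'\<^esub>j\<in>J. h (a i j) \<otimes>\<^bsub>S'\<^esub> h (b j k)) = (if i = k then \<one>\<^bsub>S'\<^esub> else \<zero>\<^bsub>S'\<^esub>)" .
  qed (use a b in \<open>auto intro!: ring_hom_closed[OF h]\<close>)
qed

lemma right_free_module_simps:
  "carrier (right_free_module S n) = {..<n} \<rightarrow>\<^sub>E carrier S"
  "v \<oplus>\<^bsub>right_free_module S n\<^esub> w = (\<lambda>i\<in>{..<n}. v i \<oplus>\<^bsub>S\<^esub> w i)"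
  "a \<odot>\<^bsub>right_free_module S n\<^esub> v = (\<lambda>i\<in>{..<n}. v i \<otimes>\<^bsub>S\<^esub> a)"
  by (simp_all add: right_free_module_def)

lemma (in ring) mat_retract_imp_epi:
  assumes "mat_retract R {..<m} {..<n}"
  shows "mod_epi R (right_free_module R n) (right_free_module R m) \<noteq> {}"
proof -
  obtain a b where a: "\<And>i j. i \<in> {..<m} \<Longrightarrow> j \<in> {..<n} \<Longrightarrow> a i j \<in> carrier R"
    and b: "\<And>i j. i \<in> {..<m} \<Longrightarrow> j \<in> {..<n} \<Longrightarrow> b j i \<in> carrier R"
    and ab: "\<And>i k. i \<in> {..<m} \<Longrightarrow> k \<in> {..<m} \<Longrightarrow>
      (\<Oplus>j\<in>{..<n}. a i j \<otimes> b j k) = (if i = k then \<one> else \<zero>)"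
    using assms by (rule mat_retractE) (rule that)
  define f where "f v = (\<lambda>i\<in>{..<m}. \<Oplus>j\<in>{..<n}. a i j \<otimes> v j)" for v
  have fc: "f v \<in> {..<m} \<rightarrow>\<^sub>E carrier R" if "v \<in> {..<n} \<rightarrow>\<^sub>E carrier R" for v
    unfolding f_def using that a by (auto intro!: finsum_closed m_closed)
  have "f \<in> mod_hom R (right_free_module R n) (right_free_module R m)"
    unfolding mod_hom_def right_free_module_simps
  proof (intro CollectI conjI ballI)
    fix v w assume "v \<in> {..<n} \<rightarrow>\<^sub>E carrier R" and "w \<in> {..<n} \<rightarrow>\<^sub>E carrier R"
    then have v: "v j \<in> carrier R" and w: "w j \<in> carrier R" if "j < n" for j
      using that by auto
    have "(\<Oplus>j\<in>{..<n}. a i j \<otimes> (\<lambda>i\<in>{..<n}. v i \<oplus> w i) j) =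
        (\<Oplus>j\<in>{..<n}. a i j \<otimes> v j) \<oplus> (\<Oplus>j\<in>{..<n}. a i j \<otimes> w j)" if "i < m" for i
    proof -
      have "(\<Oplus>j\<in>{..<n}. a i j \<otimes> (\<lambda>i\<in>{..<n}. v i \<oplus> w i) j) =
          (\<Oplus>j\<in>{..<n}. a i j \<otimes> v j \<oplus> a i j \<otimes> w j)"
        using v w a that by (intro finsum_cong') (auto simp: r_distr)
      also have "\<dots> = (\<Oplus>j\<in>{..<n}. a i j \<otimes> v j) \<oplus> (\<Oplus>j\<in>{..<n}. a i j \<otimes> w j)"
        using v w a that by (intro finsum_addf) auto
      finally show ?thesis .
    qed
    then show "f (\<lambda>i\<in>{..<n}. v i \<oplus> w i) = (\<lambda>i\<in>{..<m}. f v i \<oplus> f w i)"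
      by (auto simp: f_def fun_eq_iff)
  next
    fix c v assume c: "c \<in> carrier R" and "v \<in> {..<n} \<rightarrow>\<^sub>E carrier R"
    then have v: "v j \<in> carrier R" if "j < n" for j using that by auto
    have "(\<Oplus>j\<in>{..<n}. a i j \<otimes> (\<lambda>i\<in>{..<n}. v i \<otimes> c) j) =
        (\<Oplus>j\<in>{..<n}. a i j \<otimes> v j) \<otimes> c" if "i < m" for i
    proof -
      have "(\<Oplus>j\<in>{..<n}. a i j \<otimes> (\<lambda>i\<in>{..<n}. v i \<otimes> c) j) =
          (\<Oplus>j\<in>{..<n}. (a i j \<otimes> v j) \<otimes> c)"
        using v c a that by (intro finsum_cong') (auto simp: m_assoc)
      also have "\<dots> = (\<Oplus>j\<in>{..<n}. a i j \<otimes> v j) \<otimes> c"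
        using v c a that by (intro finsum_ldistr[symmetric]) auto
      finally show ?thesis .
    qed
    then show "f (\<lambda>i\<in>{..<n}. v i \<otimes> c) = (\<lambda>i\<in>{..<m}. f v i \<otimes> c)"
      by (auto simp: f_def fun_eq_iff)
  qed (use fc in auto)
  moreover have "f ` ({..<n} \<rightarrow>\<^sub>E carrier R) = {..<m} \<rightarrow>\<^sub>E carrier R"
  proof
    show "{..<m} \<rightarrow>\<^sub>E carrier R \<subseteq> f ` ({..<n} \<rightarrow>\<^sub>E carrier R)"
    proof
      fix w assume wE: "w \<in> {..<m} \<rightarrow>\<^sub>E carrier R"
      then have w: "w k \<in> carrier R" if "k < m" for k using that by auto
      define v where "v = (\<lambda>j\<in>{..<n}. \<Oplus>k\<in>{..<m}. b j k \<otimes> w k)"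
      have v: "v \<in> {..<n} \<rightarrow>\<^sub>E carrier R"
        unfolding v_def using w b by (auto intro!: finsum_closed)
      have "f v i = w i" if i: "i < m" for i
      proof -
        have "f v i = (\<Oplus>j\<in>{..<n}. a i j \<otimes> (\<Oplus>k\<in>{..<m}. b j k \<otimes> w k))"
          unfolding f_def v_def using a b w i
          by (auto intro!: finsum_cong' finsum_closed)
        also have "\<dots> = (\<Oplus>j\<in>{..<n}. \<Oplus>k\<in>{..<m}. a i j \<otimes> b j k \<otimes> w k)"
          using a b w i by (intro finsum_cong' refl)
            (auto intro!: finsum_closed simp: finsum_rdistr m_assoc cong: finsum_cong)
        also have "\<dots> = (\<Oplus>k\<in>{..<m}. \<Oplus>j\<in>{..<n}. a i j \<otimes> b j k \<otimes> w k)"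
          using a b w i by (intro finsum_swap) auto
        also have "\<dots> = (\<Oplus>k\<in>{..<m}. (\<Oplus>j\<in>{..<n}. a i j \<otimes> b j k) \<otimes> w k)"
          using a b w i by (intro finsum_cong' refl finsum_ldistr[symmetric])
            (auto intro!: finsum_closed)
        also have "\<dots> = (\<Oplus>k\<in>{..<m}. if k = i then w k else \<zero>)"
          using ab i w by (intro finsum_cong') auto
        also have "\<dots> = w i" using i w by (intro finsum_delta) auto
        finally show ?thesis .
      qed
      then have "f v = w" by (intro PiE_ext[OF fc[OF v] wE]) simp
      then show "w \<in> f ` ({..<n} \<rightarrow>\<^sub>E carrier R)" using v by blast
    qed
  qed (use fc in auto)
  ultimately have "f \<in> mod_epi R (right_free_module R n) (right_free_module R m)"
    by (simp add: mod_epi_def right_free_module_simps)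
  then show ?thesis by blast
qed

text \<open>
  A homomorphism between free right modules is left multiplication by the matrix whose columns are
  the images of the standard basis vectors.
\<close>

lemma (in ring) mod_hom_free_expand:
  assumes f: "f \<in> mod_hom R (right_free_module R n) (right_free_module R m)"
    and v: "v \<in> {..<n} \<rightarrow>\<^sub>E carrier R" and i: "i < m"
  shows "f v i = (\<Oplus>j\<in>{..<n}. f (\<lambda>i\<in>{..<n}. if i = j then \<one> else \<zero>) i \<otimes> v j)"
proof -
  let ?e = "\<lambda>j. \<lambda>i\<in>{..<n}. if i = j then \<one> else \<zero>"
  have vc: "v j \<in> carrier R" if "j < n" for j using v that by auto
  have e: "?e j \<in> {..<n} \<rightarrow>\<^sub>E carrier R" for j by auto
  have fc: "f w \<in> {..<m} \<rightarrow>\<^sub>E carrier R" if "w \<in> {..<n} \<rightarrow>\<^sub>E carrier R" for w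
    using f that by (auto simp: mod_hom_def right_free_module_simps)
  have fadd: "f (\<lambda>i\<in>{..<n}. v i \<oplus> w i) = (\<lambda>i\<in>{..<m}. f v i \<oplus> f w i)"
    if "v \<in> {..<n} \<rightarrow>\<^sub>E carrier R" "w \<in> {..<n} \<rightarrow>\<^sub>E carrier R" for v w
    using f that by (auto simp: mod_hom_def right_free_module_simps)
  have fmul: "f (\<lambda>i\<in>{..<n}. v i \<otimes> a) = (\<lambda>i\<in>{..<m}. f v i \<otimes> a)"
    if "v \<in> {..<n} \<rightarrow>\<^sub>E carrier R" "a \<in> carrier R" for v a
    using f that by (auto simp: mod_hom_def right_free_module_simps)
  \<comment> \<open>Induction on the number of coordinates of \<open>v\<close> that are kept.\<close>
  have "f (\<lambda>i\<in>{..<n}. if i < k then v i else \<zero>) i = (\<Oplus>j\<in>{..<k}. f (?e j) i \<otimes> v j)"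
    if "k \<le> n" for k
    using that
  proof (induction k)
    case 0
    have "(\<lambda>i\<in>{..<n}. v i \<otimes> \<zero>) = (\<lambda>i\<in>{..<n}. \<zero>)" using vc by auto
    then have "f (\<lambda>i\<in>{..<n}. \<zero>) i = f v i \<otimes> \<zero>" using fmul[OF v zero_closed] i by simp
    moreover have "f v i \<in> carrier R" using fc[OF v] i by auto
    ultimately show ?case by (simp add: restrict_def)
  next
    case (Suc k)
    let ?w = "\<lambda>i\<in>{..<n}. if i < k then v i else \<zero>"
    have vk: "v k \<in> carrier R" using vc Suc by auto
    have w: "?w \<in> {..<n} \<rightarrow>\<^sub>E carrier R" using vc by auto
    have ev: "(\<lambda>i\<in>{..<n}. ?e k i \<otimes> v k) \<in> {..<n} \<rightarrow>\<^sub>E carrier R" using vk by auto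
    have "(\<lambda>i\<in>{..<n}. if i < Suc k then v i else \<zero>) = (\<lambda>i\<in>{..<n}. (\<lambda>i\<in>{..<n}. ?e k i \<otimes> v k) i \<oplus> ?w i)"
      using vc vk by (auto simp: fun_eq_iff less_Suc_eq)
    then have "f (\<lambda>i\<in>{..<n}. if i < Suc k then v i else \<zero>) i = f (?e k) i \<otimes> v k \<oplus> f ?w i"
      using i by (simp only: fadd[OF ev w] fmul[OF e vk]) simp
    also have "\<dots> = f (?e k) i \<otimes> v k \<oplus> (\<Oplus>j\<in>{..<k}. f (?e j) i \<otimes> v j)"
      using Suc.IH[OF Suc_leD[OF Suc.prems]] by (simp only:)
    also have "\<dots> = (\<Oplus>j\<in>{..<Suc k}. f (?e j) i \<otimes> v j)"
    proof -
      have "f (?e j) i \<in> carrier R" for j using fc[OF e[of j]] i by auto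
      moreover have "v j \<in> carrier R" if "j \<le> k" for j using vc that Suc.prems by auto
      ultimately show ?thesis
        unfolding lessThan_Suc by (subst finsum_insert) auto
    qed
    finally show ?case .
  qed
  from this[of n] show ?thesis
    using v by (simp add: PiE_restrict cong: restrict_cong)
qed

lemma (in ring) epi_imp_mat_retract:
  assumes "mod_epi R (right_free_module R n) (right_free_module R m) \<noteq> {}"
  shows "mat_retract R {..<m} {..<n}"
proof -
  obtain f where f: "f \<in> mod_hom R (right_free_module R n) (right_free_module R m)"
    and surj: "f ` ({..<n} \<rightarrow>\<^sub>E carrier R) = {..<m} \<rightarrow>\<^sub>E carrier R"
    using assms by (auto simp: mod_epi_def right_free_module_simps)
  let ?e = "\<lambda>n j. \<lambda>i\<in>{..<n}. if i = j then \<one> else \<zero>"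
  have e: "?e n j \<in> {..<n} \<rightarrow>\<^sub>E carrier R" for j n by auto
  have "\<exists>v. v \<in> {..<n} \<rightarrow>\<^sub>E carrier R \<and> f v = ?e m k" for k
  proof -
    have "?e m k \<in> f ` ({..<n} \<rightarrow>\<^sub>E carrier R)" unfolding surj by (rule e)
    then obtain v where "?e m k = f v" "v \<in> {..<n} \<rightarrow>\<^sub>E carrier R" by (rule imageE)
    then show ?thesis by (intro exI[of _ v] conjI) (simp_all only:)
  qed
  then have "\<exists>v. \<forall>k. v k \<in> {..<n} \<rightarrow>\<^sub>E carrier R \<and> f (v k) = ?e m k" by (intro choice allI)
  then obtain v where v: "\<And>k. v k \<in> {..<n} \<rightarrow>\<^sub>E carrier R" "\<And>k. f (v k) = ?e m k" by blast
  show ?thesis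
  proof (rule mat_retractI[of _ _ "\<lambda>i j. f (?e n j) i" _ "\<lambda>j k. v k j"])
    fix i j assume ij: "i \<in> {..<m}" "j \<in> {..<n}"
    have "f (?e n j) \<in> f ` ({..<n} \<rightarrow>\<^sub>E carrier R)" by (rule imageI) (rule e)
    then have "f (?e n j) \<in> {..<m} \<rightarrow>\<^sub>E carrier R" unfolding surj .
    then show "f (?e n j) i \<in> carrier R" using ij by auto
    show "v i j \<in> carrier R" using v(1)[of i] ij by auto
  next
    fix i k assume "i \<in> {..<m}" "k \<in> {..<m}"
    then show "(\<Oplus>j\<in>{..<n}. f (?e n j) i \<otimes> v k j) = (if i = k then \<one> else \<zero>)"
      using mod_hom_free_expand[OF f v(1)[of k], of i] v(2)[of k] by simp
  qed
qed

text \<open>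
  Free modules are projective, so an epimorphism \<open>S\<^sup>n \<rightarrow> S\<^sup>n\<^sup>+\<^sup>1\<close> splits, and UGN becomes a statement
  about matrices that is visibly left-right symmetric and inherited along ring homomorphisms.
\<close>

lemma (in ring) UGN_iff_no_mat_retract:
  "UGN R \<longleftrightarrow> (\<forall>n::nat>0. \<not> mat_retract R {..<n + 1} {..<n})"
proof -
  have "mat_retract R {..<n + 1} {..<n} \<longleftrightarrow>
      mod_epi R (right_free_module R n) (right_free_module R (n + 1)) \<noteq> {}" for n :: nat
    using mat_retract_imp_epi epi_imp_mat_retract by metis
  then show ?thesis by (simp only: UGN_def not_not)
qed

lemma (in ring) UGN_mat_retract_card:
  assumes ugn: "UGN R" and fin: "finite I" "finite J" and ret: "mat_retract R I J"
  shows "card I \<le> card J"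
proof (rule ccontr)
  assume less: "\<not> card I \<le> card J"
  show False
  proof (cases "J = {}")
    case True
    \<comment> \<open>An empty product matrix equals the identity only if \<open>1 = 0\<close>.\<close>
    obtain i where "i \<in> I" using less by fastforce
    then have "\<one> = \<zero>" using ret True by (elim mat_retractE) (metis finsum_empty)
    then have "mat_retract R {..<1 + 1} {..<1::nat}"
      by (intro mat_retractI[of _ _ "\<lambda>i j. \<zero>" _ "\<lambda>i j. \<zero>"]) auto
    then show False using ugn UGN_iff_no_mat_retract zero_less_one by blast
  next
    case False
    define n where "n = card J"
    obtain q where q: "bij_betw q {..<n} J"
      using ex_bij_betw_nat_finite[OF fin(2)] by (auto simp: n_def lessThan_atLeast0)
    obtain p where p: "bij_betw p {..<card I} I"
      using ex_bij_betw_nat_finite[OF fin(1)] by (auto simp: lessThan_atLeast0)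
    have "{..<n + 1} \<subseteq> {..<card I}" using less by (auto simp: n_def)
    then have "inj_on p {..<n + 1}" "p ` {..<n + 1} \<subseteq> I"
      using p unfolding bij_betw_def by (auto intro: inj_on_subset)
    then have "mat_retract R {..<n + 1} {..<n}"
      using mat_retract_reindex[OF ret _ _ q] by blast
    moreover have "n > 0" using False fin by (simp add: n_def card_gt_0_iff)
    ultimately show False using ugn UGN_iff_no_mat_retract by blast
  qed
qed

lemma UGN_ring_hom:
  assumes "ring S" "ring S'" "h \<in> ring_hom S S'" "UGN S'"
  shows "UGN S"
  using assms mat_retract_ring_hom ring.UGN_iff_no_mat_retract by metis

lemma (in ring) UGN_finite_ring:
  assumes fin: "finite (carrier R)" and nz: "\<one> \<noteq> \<zero>"
  shows "UGN R"
  unfolding UGN_def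
proof (intro allI impI, rule ccontr)
  fix n :: nat
  assume "mod_epi R (right_free_module R n) (right_free_module R (n + 1)) \<noteq> {}"
  then obtain f where surj: "f ` ({..<n} \<rightarrow>\<^sub>E carrier R) = {..<n + 1} \<rightarrow>\<^sub>E carrier R"
    by (auto simp: mod_epi_def right_free_module_simps)
  have "finite ({..<n} \<rightarrow>\<^sub>E carrier R)" using fin by (simp add: finite_PiE)
  then have "card ({..<n + 1} \<rightarrow>\<^sub>E carrier R) \<le> card ({..<n} \<rightarrow>\<^sub>E carrier R)"
    using card_image_le surj by metis
  then have "card (carrier R) ^ (n + 1) \<le> card (carrier R) ^ n"
    by (simp add: card_PiE)
  moreover have "card {\<zero>, \<one>} \<le> card (carrier R)" using fin by (intro card_mono) auto
  then have "1 < card (carrier R)" using nz by simp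
  ultimately show False using power_strict_increasing[of n "n + 1" "card (carrier R)"] by simp
qed

text \<open>The opposite ring.\<close>

definition opp_ring :: "('a, 'm) ring_scheme \<Rightarrow> ('a, 'm) ring_scheme" where
  "opp_ring S = S\<lparr>monoid.mult := \<lambda>x y. y \<otimes>\<^bsub>S\<^esub> x\<rparr>"

lemma opp_ring_simps [simp]:
  "carrier (opp_ring S) = carrier S" "add (opp_ring S) = add S"
  "\<zero>\<^bsub>opp_ring S\<^esub> = \<zero>\<^bsub>S\<^esub>" "\<one>\<^bsub>opp_ring S\<^esub> = \<one>\<^bsub>S\<^esub>"
  "x \<otimes>\<^bsub>opp_ring S\<^esub> y = y \<otimes>\<^bsub>S\<^esub> x" "finsum (opp_ring S) = finsum S"
  by (simp_all add: opp_ring_def finsum_def)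

lemma opp_ring_opp_ring: "opp_ring (opp_ring S) = S"
  by (simp add: opp_ring_def)

lemma ring_opp_ring:
  assumes "ring S"
  shows "ring (opp_ring S)"
proof -
  interpret ring S by fact
  show ?thesis
  proof (rule ringI)
    show "abelian_group (opp_ring S)"
      using abelian_group_axioms
      unfolding abelian_group_def abelian_monoid_def abelian_group_axioms_def by simp
    show "monoid (opp_ring S)"
      by (rule monoidI) (auto simp: m_assoc)
  qed (auto simp: l_distr r_distr)
qed

lemma mat_retract_opp_ring:
  assumes "mat_retract S I J"
  shows "mat_retract (opp_ring S) I J"
proof -
  obtain a b where a: "\<And>i j. i \<in> I \<Longrightarrow> j \<in> J \<Longrightarrow> a i j \<in> carrier S"
    and b: "\<And>i j. i \<in> I \<Longrightarrow> j \<in> J \<Longrightarrow> b j i \<in> carrier S"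
    and ab: "\<And>i k. i \<in> I \<Longrightarrow> k \<in> I \<Longrightarrow>
      (\<Oplus>\<^bsub>S\<^esub>j\<in>J. a i j \<otimes>\<^bsub>S\<^esub> b j k) = (if i = k then \<one>\<^bsub>S\<^esub> else \<zero>\<^bsub>S\<^esub>)"
    using assms by (rule mat_retractE) (rule that)
  show ?thesis
    using a b ab by (intro mat_retractI[of _ _ "\<lambda>i j. b j i" _ "\<lambda>j i. a i j"]) auto
qed

lemma UGN_opp_ring:
  assumes "ring S"
  shows "UGN (opp_ring S) \<longleftrightarrow> UGN S"
proof -
  have "mat_retract (opp_ring S) I J \<longleftrightarrow> mat_retract S I J" for I J :: "nat set"
    using mat_retract_opp_ring[of S] mat_retract_opp_ring[of "opp_ring S"]
    by (auto simp: opp_ring_opp_ring)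
  then show ?thesis
    unfolding ring.UGN_iff_no_mat_retract[OF assms]
      ring.UGN_iff_no_mat_retract[OF ring_opp_ring[OF assms]] by simp
qed

section \<open>Graded rings\<close>

text \<open>
  A \<open>G\<close>-graded ring \<open>T\<close> with homogeneous components \<open>D g\<close>.
\<close>

locale grading = G: group G + T: ring T
  for G :: "('g, 'n) monoid_scheme" and T :: "('a, 'm) ring_scheme" +
  fixes D :: "'g \<Rightarrow> 'a set"
  assumes graded: "graded_ring G T D"
begin

text \<open>
  \<open>f\<close> is the family of homogeneous components of \<open>x\<close>, in the form in which the definition of a
  graded ring asserts its existence and uniqueness.
\<close>

definition components :: "'a \<Rightarrow> ('g \<Rightarrow> 'a) \<Rightarrow> bool" where
  "components x f \<longleftrightarrow> f \<in> (\<Pi>\<^sub>E g\<in>carrier G. D g) \<and> finite {g \<in> carrier G. f g \<noteq> \<zero>\<^bsub>T\<^esub>} \<and>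
     x = finsum T f {g \<in> carrier G. f g \<noteq> \<zero>\<^bsub>T\<^esub>}"

text \<open>
  \<open>hcomp g x\<close> is the homogeneous component of degree \<open>g\<close> of \<open>x\<close>, meaningful for \<open>x \<in> carrier T\<close>
  and \<open>g \<in> carrier G\<close>.
\<close>

definition hcomp :: "'g \<Rightarrow> 'a \<Rightarrow> 'a" where
  "hcomp g x = (THE f. components x f) g"

lemma D_subgroup: "g \<in> carrier G \<Longrightarrow> additive_subgroup (D g) T"
  using graded by (simp add: graded_ring_def)

lemma D_carrier: "g \<in> carrier G \<Longrightarrow> x \<in> D g \<Longrightarrow> x \<in> carrier T"
  using additive_subgroup.a_subset[OF D_subgroup] by blast

lemma D_zero: "g \<in> carrier G \<Longrightarrow> \<zero>\<^bsub>T\<^esub> \<in> D g"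
  using additive_subgroup.zero_closed[OF D_subgroup] .

lemma D_add: "g \<in> carrier G \<Longrightarrow> x \<in> D g \<Longrightarrow> y \<in> D g \<Longrightarrow> x \<oplus>\<^bsub>T\<^esub> y \<in> D g"
  using additive_subgroup.a_closed[OF D_subgroup] .

lemma D_minus: "g \<in> carrier G \<Longrightarrow> x \<in> D g \<Longrightarrow> \<ominus>\<^bsub>T\<^esub> x \<in> D g"
  using additive_subgroup.a_inv_closed[OF D_subgroup] T.ring_axioms ring.is_abelian_group by metis

lemma D_mult:
  "g \<in> carrier G \<Longrightarrow> h \<in> carrier G \<Longrightarrow> x \<in> D g \<Longrightarrow> y \<in> D h \<Longrightarrow> x \<otimes>\<^bsub>T\<^esub> y \<in> D (g \<otimes>\<^bsub>G\<^esub> h)"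
  using graded by (simp add: graded_ring_def)

lemma components_hcomp:
  assumes "x \<in> carrier T"
  shows "components x (\<lambda>g. hcomp g x)"
    and "components x f \<Longrightarrow> f = (\<lambda>g. hcomp g x)"
proof -
  have ex: "\<exists>!f. components x f"
    using graded assms by (simp add: graded_ring_def components_def)
  then show "components x (\<lambda>g. hcomp g x)" unfolding hcomp_def by (rule theI')
  then show "components x f \<Longrightarrow> f = (\<lambda>g. hcomp g x)" using ex by blast
qed

lemma hcomp_mem: "g \<in> carrier G \<Longrightarrow> x \<in> carrier T \<Longrightarrow> hcomp g x \<in> D g"
  using components_hcomp(1)[of x] by (auto simp: components_def)

lemma hcomp_carrier: "g \<in> carrier G \<Longrightarrow> x \<in> carrier T \<Longrightarrow> hcomp g x \<in> carrier T"
  using hcomp_mem D_carrier by blast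

lemma finite_hcomp: "x \<in> carrier T \<Longrightarrow> finite {g \<in> carrier G. hcomp g x \<noteq> \<zero>\<^bsub>T\<^esub>}"
  using components_hcomp(1)[of x] by (auto simp: components_def)

lemma sum_hcomp:
  assumes x: "x \<in> carrier T" and F: "finite F" "F \<subseteq> carrier G"
    and supp: "\<And>g. g \<in> carrier G \<Longrightarrow> hcomp g x \<noteq> \<zero>\<^bsub>T\<^esub> \<Longrightarrow> g \<in> F"
  shows "x = (\<Oplus>\<^bsub>T\<^esub>g\<in>F. hcomp g x)"
proof -
  let ?S = "{g \<in> carrier G. hcomp g x \<noteq> \<zero>\<^bsub>T\<^esub>}"
  have "x = (\<Oplus>\<^bsub>T\<^esub>g\<in>?S. hcomp g x)"
    using components_hcomp(1)[OF x] unfolding components_def by blast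
  also have "\<dots> = (\<Oplus>\<^bsub>T\<^esub>g\<in>F. hcomp g x)"
    using F supp x by (intro T.add.finprod_mono_neutral_cong_left) (auto intro: hcomp_carrier)
  finally show ?thesis .
qed

lemma hcomp_unique:
  assumes F: "finite F" "F \<subseteq> carrier G" and f: "\<And>g. g \<in> F \<Longrightarrow> f g \<in> D g"
    and x: "x = (\<Oplus>\<^bsub>T\<^esub>g\<in>F. f g)" and g: "g \<in> carrier G"
  shows "hcomp g x = (if g \<in> F then f g else \<zero>\<^bsub>T\<^esub>)"
proof -
  let ?f = "\<lambda>g\<in>carrier G. if g \<in> F then f g else \<zero>\<^bsub>T\<^esub>"
  let ?S = "{g \<in> carrier G. ?f g \<noteq> \<zero>\<^bsub>T\<^esub>}"
  have fT: "f g \<in> carrier T" if "g \<in> F" for g using f F that D_carrier by blast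
  have S: "?S \<subseteq> F" by auto
  have "x = finsum T ?f ?S"
    unfolding x using F S fT
    by (intro T.add.finprod_mono_neutral_cong_right) auto
  moreover have "?f \<in> (\<Pi>\<^sub>E g\<in>carrier G. D g)" using f D_zero by auto
  ultimately have "components x ?f"
    unfolding components_def using finite_subset[OF S F(1)] by blast
  moreover have "x \<in> carrier T" unfolding x using fT by (intro T.finsum_closed) auto
  ultimately have "?f = (\<lambda>g. hcomp g x)" using components_hcomp(2) by blast
  then have "hcomp g x = ?f g" by metis
  then show ?thesis using g by simp
qed

lemma hcomp_homogeneous:
  assumes "h \<in> carrier G" "x \<in> D h" "g \<in> carrier G"
  shows "hcomp g x = (if g = h then x else \<zero>\<^bsub>T\<^esub>)"
proof -
  have "x = (\<Oplus>\<^bsub>T\<^esub>g\<in>{h}. x)" using assms D_carrier by simp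
  from hcomp_unique[OF _ _ _ this assms(3)] show ?thesis using assms by auto
qed

lemma hcomp_add:
  assumes x: "x \<in> carrier T" and y: "y \<in> carrier T" and g: "g \<in> carrier G"
  shows "hcomp g (x \<oplus>\<^bsub>T\<^esub> y) = hcomp g x \<oplus>\<^bsub>T\<^esub> hcomp g y"
proof -
  let ?F = "{g \<in> carrier G. hcomp g x \<noteq> \<zero>\<^bsub>T\<^esub>} \<union> {g \<in> carrier G. hcomp g y \<noteq> \<zero>\<^bsub>T\<^esub>}"
  have F: "finite ?F" "?F \<subseteq> carrier G" using finite_hcomp x y by auto
  have "x \<oplus>\<^bsub>T\<^esub> y = (\<Oplus>\<^bsub>T\<^esub>g\<in>?F. hcomp g x) \<oplus>\<^bsub>T\<^esub> (\<Oplus>\<^bsub>T\<^esub>g\<in>?F. hcomp g y)"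
    using sum_hcomp[OF x F] sum_hcomp[OF y F] by auto
  also have "\<dots> = (\<Oplus>\<^bsub>T\<^esub>g\<in>?F. hcomp g x \<oplus>\<^bsub>T\<^esub> hcomp g y)"
    using x y by (intro T.finsum_addf[symmetric]) (auto intro: hcomp_carrier)
  finally have "hcomp g (x \<oplus>\<^bsub>T\<^esub> y) = (if g \<in> ?F then hcomp g x \<oplus>\<^bsub>T\<^esub> hcomp g y else \<zero>\<^bsub>T\<^esub>)"
    using x y g by (intro hcomp_unique[OF F]) (auto intro: D_add hcomp_mem)
  then show ?thesis using g by auto
qed

lemma hcomp_mult_left:
  assumes u: "u \<in> D h" and h: "h \<in> carrier G" and x: "x \<in> carrier T" and g: "g \<in> carrier G"
  shows "hcomp (h \<otimes>\<^bsub>G\<^esub> g) (u \<otimes>\<^bsub>T\<^esub> x) = u \<otimes>\<^bsub>T\<^esub> hcomp g x"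
proof -
  have uT: "u \<in> carrier T" using u h D_carrier by blast
  let ?F = "{g \<in> carrier G. hcomp g x \<noteq> \<zero>\<^bsub>T\<^esub>}"
  have F: "finite ?F" using finite_hcomp x by auto
  let ?F' = "(\<lambda>g. h \<otimes>\<^bsub>G\<^esub> g) ` ?F"
  let ?f = "\<lambda>k. u \<otimes>\<^bsub>T\<^esub> hcomp (inv\<^bsub>G\<^esub> h \<otimes>\<^bsub>G\<^esub> k) x"
  have cancel: "inv\<^bsub>G\<^esub> h \<otimes>\<^bsub>G\<^esub> (h \<otimes>\<^bsub>G\<^esub> k) = k" if "k \<in> carrier G" for k
    using h that by (simp add: G.m_assoc[symmetric])
  have inj: "inj_on (\<lambda>g. h \<otimes>\<^bsub>G\<^esub> g) ?F" using h by (auto intro!: inj_onI)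
  have "u \<otimes>\<^bsub>T\<^esub> x = u \<otimes>\<^bsub>T\<^esub> (\<Oplus>\<^bsub>T\<^esub>g\<in>?F. hcomp g x)"
    using sum_hcomp[OF x F] by auto
  also have "\<dots> = (\<Oplus>\<^bsub>T\<^esub>g\<in>?F. u \<otimes>\<^bsub>T\<^esub> hcomp g x)"
    using F uT x by (intro T.finsum_rdistr) (auto intro: hcomp_carrier)
  also have "\<dots> = (\<Oplus>\<^bsub>T\<^esub>g\<in>?F. ?f (h \<otimes>\<^bsub>G\<^esub> g))"
    using cancel uT x by (intro T.finsum_cong') (auto intro!: hcomp_carrier)
  also have "\<dots> = (\<Oplus>\<^bsub>T\<^esub>k\<in>?F'. ?f k)"
    using inj uT x h cancel by (intro T.finsum_reindex[symmetric]) (auto intro!: hcomp_carrier)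
  finally have "hcomp (h \<otimes>\<^bsub>G\<^esub> g) (u \<otimes>\<^bsub>T\<^esub> x) = (if h \<otimes>\<^bsub>G\<^esub> g \<in> ?F' then ?f (h \<otimes>\<^bsub>G\<^esub> g) else \<zero>\<^bsub>T\<^esub>)"
    using F h g u x by (intro hcomp_unique) (auto simp: cancel intro!: D_mult hcomp_mem)
  moreover have "hcomp g x = \<zero>\<^bsub>T\<^esub>" if "h \<otimes>\<^bsub>G\<^esub> g \<notin> ?F'" using that g by blast
  ultimately show ?thesis using cancel[OF g] uT by auto
qed

lemma hcomp_mult_right:
  assumes u: "u \<in> D h" and h: "h \<in> carrier G" and x: "x \<in> carrier T" and g: "g \<in> carrier G"
  shows "hcomp (g \<otimes>\<^bsub>G\<^esub> h) (x \<otimes>\<^bsub>T\<^esub> u) = hcomp g x \<otimes>\<^bsub>T\<^esub> u"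
proof -
  have uT: "u \<in> carrier T" using u h D_carrier by blast
  let ?F = "{g \<in> carrier G. hcomp g x \<noteq> \<zero>\<^bsub>T\<^esub>}"
  have F: "finite ?F" using finite_hcomp x by auto
  let ?F' = "(\<lambda>g. g \<otimes>\<^bsub>G\<^esub> h) ` ?F"
  let ?f = "\<lambda>k. hcomp (k \<otimes>\<^bsub>G\<^esub> inv\<^bsub>G\<^esub> h) x \<otimes>\<^bsub>T\<^esub> u"
  have cancel: "(k \<otimes>\<^bsub>G\<^esub> h) \<otimes>\<^bsub>G\<^esub> inv\<^bsub>G\<^esub> h = k" if "k \<in> carrier G" for k
    using h that by (simp add: G.m_assoc)
  have inj: "inj_on (\<lambda>g. g \<otimes>\<^bsub>G\<^esub> h) ?F" using h by (auto intro!: inj_onI)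
  have "x \<otimes>\<^bsub>T\<^esub> u = (\<Oplus>\<^bsub>T\<^esub>g\<in>?F. hcomp g x) \<otimes>\<^bsub>T\<^esub> u"
    using sum_hcomp[OF x F] by auto
  also have "\<dots> = (\<Oplus>\<^bsub>T\<^esub>g\<in>?F. hcomp g x \<otimes>\<^bsub>T\<^esub> u)"
    using F uT x by (intro T.finsum_ldistr) (auto intro: hcomp_carrier)
  also have "\<dots> = (\<Oplus>\<^bsub>T\<^esub>g\<in>?F. ?f (g \<otimes>\<^bsub>G\<^esub> h))"
    using cancel uT x by (intro T.finsum_cong') (auto intro!: hcomp_carrier)
  also have "\<dots> = (\<Oplus>\<^bsub>T\<^esub>k\<in>?F'. ?f k)"
    using inj uT x h cancel by (intro T.finsum_reindex[symmetric]) (auto intro!: hcomp_carrier)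
  finally have "hcomp (g \<otimes>\<^bsub>G\<^esub> h) (x \<otimes>\<^bsub>T\<^esub> u) = (if g \<otimes>\<^bsub>G\<^esub> h \<in> ?F' then ?f (g \<otimes>\<^bsub>G\<^esub> h) else \<zero>\<^bsub>T\<^esub>)"
    using F h g u x by (intro hcomp_unique) (auto simp: cancel intro!: D_mult hcomp_mem)
  moreover have "hcomp g x = \<zero>\<^bsub>T\<^esub>" if "g \<otimes>\<^bsub>G\<^esub> h \<notin> ?F'" using that g by blast
  ultimately show ?thesis using cancel[OF g] uT by auto
qed

text \<open>
  By uniqueness of components, the component \<open>e\<close> of \<open>1\<close> in degree \<open>1\<close> satisfies \<open>u e = u\<close> for
  homogeneous \<open>u\<close>, hence \<open>1 e = 1\<close>.
\<close>

lemma one_mem_base: "\<one>\<^bsub>T\<^esub> \<in> D \<one>\<^bsub>G\<^esub>"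
proof -
  define e where "e = hcomp \<one>\<^bsub>G\<^esub> \<one>\<^bsub>T\<^esub>"
  have eT: "e \<in> carrier T" by (auto simp: e_def intro: hcomp_carrier)
  let ?F = "{g \<in> carrier G. hcomp g \<one>\<^bsub>T\<^esub> \<noteq> \<zero>\<^bsub>T\<^esub>}"
  have F: "finite ?F" using finite_hcomp by auto
  have unit: "u \<otimes>\<^bsub>T\<^esub> e = u" if "u \<in> D h" "h \<in> carrier G" for u h
    using hcomp_mult_left[OF that T.one_closed G.one_closed] that D_carrier[OF that(2,1)]
    by (simp add: e_def hcomp_homogeneous)
  have one: "\<one>\<^bsub>T\<^esub> = (\<Oplus>\<^bsub>T\<^esub>g\<in>?F. hcomp g \<one>\<^bsub>T\<^esub>)" by (rule sum_hcomp) (use F in auto)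
  have "e = \<one>\<^bsub>T\<^esub> \<otimes>\<^bsub>T\<^esub> e" using eT by simp
  also have "\<dots> = (\<Oplus>\<^bsub>T\<^esub>g\<in>?F. hcomp g \<one>\<^bsub>T\<^esub>) \<otimes>\<^bsub>T\<^esub> e" using one by simp
  also have "\<dots> = (\<Oplus>\<^bsub>T\<^esub>g\<in>?F. hcomp g \<one>\<^bsub>T\<^esub> \<otimes>\<^bsub>T\<^esub> e)"
    using F eT by (intro T.finsum_ldistr) (auto intro: hcomp_carrier)
  also have "\<dots> = (\<Oplus>\<^bsub>T\<^esub>g\<in>?F. hcomp g \<one>\<^bsub>T\<^esub>)"
    by (intro T.finsum_cong') (auto intro!: hcomp_carrier unit[OF hcomp_mem])
  also have "\<dots> = \<one>\<^bsub>T\<^esub>" using one by simp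
  finally show ?thesis unfolding e_def using hcomp_mem[OF G.one_closed T.one_closed] by simp
qed

abbreviation "R \<equiv> base_ring G T D"

lemma base_ring_simps:
  "carrier R = D \<one>\<^bsub>G\<^esub>" "add R = add T" "monoid.mult R = monoid.mult T"
  "\<zero>\<^bsub>R\<^esub> = \<zero>\<^bsub>T\<^esub>" "\<one>\<^bsub>R\<^esub> = \<one>\<^bsub>T\<^esub>"
  by (simp_all add: base_ring_def)

lemma ring_base_ring: "ring R"
  unfolding base_ring_def
proof (rule T.subring_is_ring, rule T.subringI)
  show "D \<one>\<^bsub>G\<^esub> \<subseteq> carrier T" using D_carrier by auto
  show "\<And>h1 h2. h1 \<in> D \<one>\<^bsub>G\<^esub> \<Longrightarrow> h2 \<in> D \<one>\<^bsub>G\<^esub> \<Longrightarrow> h1 \<otimes>\<^bsub>T\<^esub> h2 \<in> D \<one>\<^bsub>G\<^esub>"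
    using D_mult[of "\<one>\<^bsub>G\<^esub>" "\<one>\<^bsub>G\<^esub>"] by simp
qed (auto intro: one_mem_base D_minus D_add)

lemma base_ring_inclusion: "(\<lambda>x. x) \<in> ring_hom R T"
  by (auto simp: ring_hom_def base_ring_simps intro: D_carrier)

lemma finsum_base_ring:
  assumes "f \<in> A \<rightarrow> D \<one>\<^bsub>G\<^esub>"
  shows "finsum R f A = finsum T f A"
proof -
  interpret R: ring R by (rule ring_base_ring)
  show ?thesis
    using assms
    by (intro additive_map_finsum[where h = "\<lambda>x. x"] R.abelian_monoid_axioms T.abelian_monoid_axioms)
       (auto simp: base_ring_simps intro: D_carrier)
qed

lemma UGN_imp_UGN_base: "UGN T \<Longrightarrow> UGN R"
  using UGN_ring_hom[OF ring_base_ring T.ring_axioms base_ring_inclusion] .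

end

section \<open>Boundedly free gradings by amenable groups\<close>

context grading
begin

text \<open>
  The main estimate.  If \<open>A B = 1\<close> over \<open>T\<close> with \<open>A\<close> of size \<open>(n+1) \<times> n\<close>, let \<open>S\<close> be the finite set
  of degrees occurring in \<open>B\<close>, and for finite \<open>F \<subseteq> G\<close> let \<open>T\<^sub>F\<close> be the sum of the components of
  degree in \<open>F\<close>.  Left multiplication by \<open>B\<close> maps \<open>(T\<^sub>F)\<^sup>n\<^sup>+\<^sup>1\<close> into \<open>(T\<^bsub>SF\<^esub>)\<^sup>n\<close>, and \<open>A\<close> followed by the
  projection to degrees in \<open>F\<close> undoes this.  Both maps are linear over the base ring \<open>R\<close>, so
  they exhibit a free \<open>R\<close>-module of rank \<open>(n+1) \<Sum>\<^bsub>g\<in>F\<^esub> rk g\<close> as a retract of one of rank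
  \<open>n \<Sum>\<^bsub>g\<in>SF\<^esub> rk g\<close>, and UGN of \<open>R\<close> bounds the former by the latter.
\<close>

lemma right_growth:
  assumes ugn: "UGN R" and n: "0 < n" and ret: "mat_retract T {..<n + 1} {..<n::nat}"
    and iso: "\<And>g. g \<in> carrier G \<Longrightarrow>
      mod_isomorphic R (right_component T D g) (right_free_module R (rk g))"
  shows "\<exists>S. finite S \<and> S \<subseteq> carrier G \<and> (\<forall>F. finite F \<longrightarrow> F \<subseteq> carrier G \<longrightarrow>
    (n + 1) * (\<Sum>g\<in>F. rk g) \<le> n * (\<Sum>g\<in>S <#>\<^bsub>G\<^esub> F. rk g))"
proof -
  interpret R: ring R by (rule ring_base_ring)
  have "\<exists>f. f \<in> mod_hom R (right_component T D g) (right_free_module R (rk g)) \<and>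
      bij_betw f (D g) ({..<rk g} \<rightarrow>\<^sub>E D \<one>\<^bsub>G\<^esub>)" if "g \<in> carrier G" for g
    using iso[OF that]
    by (auto simp: mod_isomorphic_def right_component_def right_free_module_simps base_ring_simps)
  then obtain \<phi> where hom: "\<And>g. g \<in> carrier G \<Longrightarrow>
      \<phi> g \<in> mod_hom R (right_component T D g) (right_free_module R (rk g))"
    and bij: "\<And>g. g \<in> carrier G \<Longrightarrow> bij_betw (\<phi> g) (D g) ({..<rk g} \<rightarrow>\<^sub>E D \<one>\<^bsub>G\<^esub>)"
    by metis
  have \<phi>_mem: "\<phi> g x j \<in> D \<one>\<^bsub>G\<^esub>" if "g \<in> carrier G" "x \<in> D g" "j < rk g" for g x j
  proof -
    have "\<phi> g x \<in> {..<rk g} \<rightarrow>\<^sub>E D \<one>\<^bsub>G\<^esub>" using bij[OF that(1)] that(2) by (auto simp: bij_betw_def)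
    then show ?thesis using that(3) by auto
  qed
  have \<phi>_add: "\<phi> g (x \<oplus>\<^bsub>T\<^esub> y) j = \<phi> g x j \<oplus>\<^bsub>T\<^esub> \<phi> g y j"
    if "g \<in> carrier G" "x \<in> D g" "y \<in> D g" "j < rk g" for g x y j
    using hom[OF that(1)] that
    by (simp add: mod_hom_def right_component_def right_free_module_simps base_ring_simps)
  have \<phi>_mult: "\<phi> g (x \<otimes>\<^bsub>T\<^esub> c) j = \<phi> g x j \<otimes>\<^bsub>T\<^esub> c"
    if "g \<in> carrier G" "x \<in> D g" "c \<in> D \<one>\<^bsub>G\<^esub>" "j < rk g" for g x c j
    using hom[OF that(1)] that
    by (simp add: mod_hom_def right_component_def right_free_module_simps base_ring_simps)
  \<comment> \<open>\<open>\<xi> g j\<close> is the \<open>j\<close>-th coordinate of the component of degree \<open>g\<close>, extended to all of \<open>T\<close>.\<close>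
  define \<xi> where "\<xi> g j x = \<phi> g (hcomp g x) j" for g j x
  have \<xi>_mem: "\<xi> g j x \<in> D \<one>\<^bsub>G\<^esub>" if "g \<in> carrier G" "x \<in> carrier T" "j < rk g" for g j x
    unfolding \<xi>_def using that by (intro \<phi>_mem hcomp_mem)
  have \<xi>_car: "\<xi> g j x \<in> carrier T" if "g \<in> carrier G" "x \<in> carrier T" "j < rk g" for g j x
    using \<xi>_mem[OF that] D_carrier by blast
  have \<xi>_add: "\<xi> g j (x \<oplus>\<^bsub>T\<^esub> y) = \<xi> g j x \<oplus>\<^bsub>T\<^esub> \<xi> g j y"
    if "g \<in> carrier G" "x \<in> carrier T" "y \<in> carrier T" "j < rk g" for g j x y
    unfolding \<xi>_def using that by (simp add: hcomp_add \<phi>_add hcomp_mem)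
  have \<xi>_zero: "\<xi> g j \<zero>\<^bsub>T\<^esub> = \<zero>\<^bsub>T\<^esub>" if "g \<in> carrier G" "j < rk g" for g j
    using \<xi>_add[OF that(1) T.zero_closed T.zero_closed that(2)] \<xi>_car[OF that(1) T.zero_closed that(2)]
    by simp
  have \<xi>_sum: "\<xi> g j (\<Oplus>\<^bsub>T\<^esub>a\<in>A. f a) = (\<Oplus>\<^bsub>T\<^esub>a\<in>A. \<xi> g j (f a))"
    if "g \<in> carrier G" "j < rk g" "\<And>a. a \<in> A \<Longrightarrow> f a \<in> carrier T" for g j f and A :: "'z set"
    using that \<xi>_car \<xi>_zero \<xi>_add
    by (intro additive_map_finsum T.abelian_monoid_axioms) auto
  have \<xi>_mult: "\<xi> g j (x \<otimes>\<^bsub>T\<^esub> c) = \<xi> g j x \<otimes>\<^bsub>T\<^esub> c"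
    if "g \<in> carrier G" "x \<in> carrier T" "c \<in> D \<one>\<^bsub>G\<^esub>" "j < rk g" for g j x c
    using hcomp_mult_right[OF that(3) G.one_closed that(2,1)] that
    by (simp add: \<xi>_def \<phi>_mult hcomp_mem)
  \<comment> \<open>The basis of \<open>D g\<close> dual to the coordinates \<open>\<xi> g\<close>.\<close>
  define \<beta> where "\<beta> g j = inv_into (D g) (\<phi> g) (\<lambda>i\<in>{..<rk g}. if i = j then \<one>\<^bsub>T\<^esub> else \<zero>\<^bsub>T\<^esub>)" for g j
  have \<beta>_aux: "\<beta> g j \<in> D g \<and> \<phi> g (\<beta> g j) = (\<lambda>i\<in>{..<rk g}. if i = j then \<one>\<^bsub>T\<^esub> else \<zero>\<^bsub>T\<^esub>)"
    if g: "g \<in> carrier G" for g j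
  proof -
    have "(\<lambda>i\<in>{..<rk g}. if i = j then \<one>\<^bsub>T\<^esub> else \<zero>\<^bsub>T\<^esub>) \<in> \<phi> g ` D g"
      using bij[OF g] one_mem_base D_zero[OF G.one_closed] unfolding bij_betw_def by auto
    then show ?thesis unfolding \<beta>_def by (metis f_inv_into_f inv_into_into)
  qed
  have \<beta>_mem: "\<beta> g j \<in> D g" if "g \<in> carrier G" for g j using \<beta>_aux[OF that] by simp
  have \<beta>_car: "\<beta> g j \<in> carrier T" if "g \<in> carrier G" for g j
    using \<beta>_mem[OF that] D_carrier that by blast
  have \<xi>_\<beta>: "\<xi> h i (\<beta> g j) = (if h = g \<and> i = j then \<one>\<^bsub>T\<^esub> else \<zero>\<^bsub>T\<^esub>)"
    if "g \<in> carrier G" "h \<in> carrier G" "i < rk h" for g h i j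
  proof (cases "h = g")
    case True
    then show ?thesis using that \<beta>_aux[of g j] by (simp add: \<xi>_def hcomp_homogeneous)
  next
    case False
    then have "hcomp h (\<beta> g j) = \<zero>\<^bsub>T\<^esub>" using that \<beta>_mem by (simp add: hcomp_homogeneous)
    moreover have "hcomp h \<zero>\<^bsub>T\<^esub> = \<zero>\<^bsub>T\<^esub>"
      using hcomp_homogeneous[OF that(2) D_zero[OF that(2)] that(2)] by simp
    ultimately have "\<xi> h i (\<beta> g j) = \<xi> h i \<zero>\<^bsub>T\<^esub>" by (simp add: \<xi>_def)
    then show ?thesis using \<xi>_zero that False by simp
  qed
  have expand: "hcomp g x = (\<Oplus>\<^bsub>T\<^esub>j\<in>{..<rk g}. \<beta> g j \<otimes>\<^bsub>T\<^esub> \<xi> g j x)" (is "_ = ?s")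
    if g: "g \<in> carrier G" and x: "x \<in> carrier T" for g x
  proof -
    have term_mem: "\<beta> g j \<otimes>\<^bsub>T\<^esub> \<xi> g j x \<in> D g" if "j < rk g" for j
      using D_mult[OF g G.one_closed \<beta>_mem[OF g] \<xi>_mem[OF g x that]] g by simp
    have s_car: "?s \<in> carrier T" using g x \<beta>_car \<xi>_car by (intro T.finsum_closed) auto
    have "\<xi> g i ?s = \<xi> g i x" if i: "i < rk g" for i
    proof -
      have "\<xi> g i ?s = (\<Oplus>\<^bsub>T\<^esub>j\<in>{..<rk g}. \<xi> g i (\<beta> g j \<otimes>\<^bsub>T\<^esub> \<xi> g j x))"
        using g x i \<beta>_car \<xi>_car by (intro \<xi>_sum) auto
      also have "\<dots> = (\<Oplus>\<^bsub>T\<^esub>j\<in>{..<rk g}. if j = i then \<xi> g j x else \<zero>\<^bsub>T\<^esub>)"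
        using g x i \<beta>_car \<xi>_car \<xi>_mem by (intro T.finsum_cong') (auto simp: \<xi>_mult \<xi>_\<beta>)
      also have "\<dots> = \<xi> g i x" using g x i \<xi>_car by (intro T.finsum_delta) auto
      finally show ?thesis .
    qed
    then have eq: "\<phi> g (hcomp g ?s) i = \<phi> g (hcomp g x) i" if "i < rk g" for i
      using that by (simp add: \<xi>_def)
    have "\<phi> g (hcomp g ?s) = \<phi> g (hcomp g x)"
    proof (rule PiE_ext[of _ "{..<rk g}" "\<lambda>_. D \<one>\<^bsub>G\<^esub>"])
      show "\<phi> g (hcomp g ?s) \<in> {..<rk g} \<rightarrow>\<^sub>E D \<one>\<^bsub>G\<^esub>" "\<phi> g (hcomp g x) \<in> {..<rk g} \<rightarrow>\<^sub>E D \<one>\<^bsub>G\<^esub>"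
        using bij[OF g] hcomp_mem[OF g s_car] hcomp_mem[OF g x] by (auto simp: bij_betw_def)
    qed (use eq in auto)
    then have "hcomp g ?s = hcomp g x"
      using bij[OF g] hcomp_mem[OF g s_car] hcomp_mem[OF g x] by (auto simp: bij_betw_def dest: inj_onD)
    moreover have "?s \<in> D g"
    proof -
      have "finsum T (\<lambda>j. \<beta> g j \<otimes>\<^bsub>T\<^esub> \<xi> g j x) {..<k} \<in> D g" if "k \<le> rk g" for k
        using that
      proof (induction k)
        case 0
        then show ?case using D_zero g by simp
      next
        case (Suc k)
        then show ?case
          using term_mem[of k] \<beta>_car[OF g] \<xi>_car[OF g x] D_add[OF g]
          by (simp add: lessThan_Suc T.finsum_insert Pi_def)
      qed
      then show ?thesis by simp
    qed
    ultimately show ?thesis using g by (simp add: hcomp_homogeneous)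
  qed
  obtain A B where A: "\<And>p q. p \<in> {..<n + 1} \<Longrightarrow> q \<in> {..<n} \<Longrightarrow> A p q \<in> carrier T"
    and B: "\<And>p q. p \<in> {..<n + 1} \<Longrightarrow> q \<in> {..<n} \<Longrightarrow> B q p \<in> carrier T"
    and AB: "\<And>p p'. p \<in> {..<n + 1} \<Longrightarrow> p' \<in> {..<n + 1} \<Longrightarrow>
      (\<Oplus>\<^bsub>T\<^esub>q\<in>{..<n}. A p q \<otimes>\<^bsub>T\<^esub> B q p') = (if p = p' then \<one>\<^bsub>T\<^esub> else \<zero>\<^bsub>T\<^esub>)"
    using ret by (rule mat_retractE) (rule that)
  define S where "S = (\<Union>p<n + 1. \<Union>q<n. {s \<in> carrier G. hcomp s (B q p) \<noteq> \<zero>\<^bsub>T\<^esub>})"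
  have S: "finite S" "S \<subseteq> carrier G" using B by (auto simp: S_def intro: finite_hcomp)
  have "(n + 1) * (\<Sum>g\<in>F. rk g) \<le> n * (\<Sum>g\<in>S <#>\<^bsub>G\<^esub> F. rk g)"
    if F: "finite F" "F \<subseteq> carrier G" for F
  proof -
    let ?H = "S <#>\<^bsub>G\<^esub> F"
    have H: "finite ?H" "?H \<subseteq> carrier G"
      using F S by (simp_all add: finite_set_mult G.set_mult_closed)
    \<comment> \<open>Degrees of \<open>B q p \<cdot> \<beta> g j\<close> with \<open>g \<in> F\<close> lie in \<open>SF\<close>, so nothing is lost by
      summing over the basis elements of degree in \<open>SF\<close>.\<close>
    have spread: "y = (\<Oplus>\<^bsub>T\<^esub>h\<in>?H. \<Oplus>\<^bsub>T\<^esub>l\<in>{..<rk h}. \<beta> h l \<otimes>\<^bsub>T\<^esub> \<xi> h l y)"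
      if y: "y = B q p \<otimes>\<^bsub>T\<^esub> \<beta> g j" and "p < n + 1" "q < n" "g \<in> F" for y p q g j
    proof -
      have g: "g \<in> carrier G" and BT: "B q p \<in> carrier T" using that F B by auto
      have yT: "y \<in> carrier T" using y g BT \<beta>_car by simp
      have "y = (\<Oplus>\<^bsub>T\<^esub>h\<in>?H. hcomp h y)"
      proof (rule sum_hcomp[OF yT H])
        fix h assume h: "h \<in> carrier G" and ne: "hcomp h y \<noteq> \<zero>\<^bsub>T\<^esub>"
        define s where "s = h \<otimes>\<^bsub>G\<^esub> inv\<^bsub>G\<^esub> g"
        have s: "s \<in> carrier G" "h = s \<otimes>\<^bsub>G\<^esub> g" using h g by (simp_all add: s_def G.m_assoc)
        have "hcomp h y = hcomp s (B q p) \<otimes>\<^bsub>T\<^esub> \<beta> g j"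
          unfolding y s(2) by (intro hcomp_mult_right \<beta>_mem g BT s)
        then have "hcomp s (B q p) \<noteq> \<zero>\<^bsub>T\<^esub>" using ne \<beta>_car[OF g] by auto
        then have "s \<in> S" using s(1) that by (auto simp: S_def)
        then show "h \<in> ?H" using s(2) that by (auto simp: set_mult_def)
      qed
      also have "\<dots> = (\<Oplus>\<^bsub>T\<^esub>h\<in>?H. \<Oplus>\<^bsub>T\<^esub>l\<in>{..<rk h}. \<beta> h l \<otimes>\<^bsub>T\<^esub> \<xi> h l y)"
        using H yT expand \<beta>_car \<xi>_car by (intro T.finsum_cong') (auto intro!: T.finsum_closed)
      finally show ?thesis .
    qed
    let ?I = "Sigma {..<n + 1} (\<lambda>p. Sigma F (\<lambda>g. {..<rk g}))"
    let ?J = "Sigma {..<n} (\<lambda>q. Sigma ?H (\<lambda>h. {..<rk h}))"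
    \<comment> \<open>Basis elements of \<open>(T\<^sub>F)\<^sup>n\<^sup>+\<^sup>1\<close> and of \<open>(T\<^bsub>SF\<^esub>)\<^sup>n\<close> are triples of a position, a degree and a basis
      index; \<open>a\<close> and \<open>b\<close> are the matrices of the two maps.\<close>
    define a where "a i t = \<xi> (fst (snd i)) (snd (snd i)) (A (fst i) (fst t) \<otimes>\<^bsub>T\<^esub> \<beta> (fst (snd t)) (snd (snd t)))"
      for i t :: "nat \<times> 'g \<times> nat"
    define b where "b t i = \<xi> (fst (snd t)) (snd (snd t)) (B (fst t) (fst i) \<otimes>\<^bsub>T\<^esub> \<beta> (fst (snd i)) (snd (snd i)))"
      for t i :: "nat \<times> 'g \<times> nat"
    have a_mem: "a i t \<in> D \<one>\<^bsub>G\<^esub>" if "i \<in> ?I" "t \<in> ?J" for i t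
      unfolding a_def using that F H A \<beta>_car by (intro \<xi>_mem T.m_closed) auto
    have b_mem: "b t i \<in> D \<one>\<^bsub>G\<^esub>" if "i \<in> ?I" "t \<in> ?J" for i t
      unfolding b_def using that F H B \<beta>_car by (intro \<xi>_mem T.m_closed) auto
    have "mat_retract R ?I ?J"
    proof (rule mat_retractI[of _ _ a _ b])
      fix i k assume i: "i \<in> ?I" and k: "k \<in> ?I"
      obtain p g j where i_eq: "i = (p, g, j)" by (cases i)
      obtain p' g' j' where k_eq: "k = (p', g', j')" by (cases k)
      have ip: "p < n + 1" "g \<in> carrier G" "j < rk g" using i F by (auto simp: i_eq)
      have kp: "p' < n + 1" "g' \<in> F" "g' \<in> carrier G" "j' < rk g'" using k F by (auto simp: k_eq)
      define y where "y q = B q p' \<otimes>\<^bsub>T\<^esub> \<beta> g' j'" for q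
      have y: "y q \<in> carrier T" if "q < n" for q using that kp B \<beta>_car by (auto simp: y_def)
      have "(\<Oplus>\<^bsub>R\<^esub>t\<in>?J. a i t \<otimes>\<^bsub>R\<^esub> b t k) = (\<Oplus>\<^bsub>T\<^esub>t\<in>?J. a i t \<otimes>\<^bsub>T\<^esub> b t k)"
        using D_mult[OF G.one_closed G.one_closed a_mem[OF i] b_mem[OF k]]
        by (subst finsum_base_ring) (auto simp: base_ring_simps)
      also have "\<dots> = (\<Oplus>\<^bsub>T\<^esub>t\<in>?J. (\<lambda>q hl. \<xi> g j (A p q \<otimes>\<^bsub>T\<^esub> \<beta> (fst hl) (snd hl)) \<otimes>\<^bsub>T\<^esub>
          \<xi> (fst hl) (snd hl) (y q)) (fst t) (snd t))"
        by (simp add: a_def b_def i_eq k_eq y_def)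
      also have "\<dots> = (\<Oplus>\<^bsub>T\<^esub>q\<in>{..<n}. \<Oplus>\<^bsub>T\<^esub>hl\<in>Sigma ?H (\<lambda>h. {..<rk h}).
          (\<lambda>h l. \<xi> g j (A p q \<otimes>\<^bsub>T\<^esub> \<beta> h l) \<otimes>\<^bsub>T\<^esub> \<xi> h l (y q)) (fst hl) (snd hl))"
        using H ip kp A y \<beta>_car \<xi>_car by (intro T.finsum_Sigma) auto
      also have "\<dots> = (\<Oplus>\<^bsub>T\<^esub>q\<in>{..<n}. \<Oplus>\<^bsub>T\<^esub>h\<in>?H. \<Oplus>\<^bsub>T\<^esub>l\<in>{..<rk h}.
          \<xi> g j (A p q \<otimes>\<^bsub>T\<^esub> \<beta> h l) \<otimes>\<^bsub>T\<^esub> \<xi> h l (y q))"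
        using H ip kp A y \<beta>_car \<xi>_car
        by (intro T.finsum_cong' refl T.finsum_Sigma) (auto intro!: T.finsum_closed)
      also have "\<dots> = (\<Oplus>\<^bsub>T\<^esub>q\<in>{..<n}. \<xi> g j (A p q \<otimes>\<^bsub>T\<^esub> y q))"
      proof (intro T.finsum_cong' refl)
        fix q assume "q \<in> {..<n}"
        then have q: "q < n" by simp
        have Apq: "A p q \<in> carrier T" using A ip q by auto
        have bx: "\<beta> h l \<otimes>\<^bsub>T\<^esub> \<xi> h l (y q) \<in> carrier T" if "h \<in> ?H" "l < rk h" for h l
          using that H y[OF q] \<beta>_car \<xi>_car by auto
        have "\<xi> g j (A p q \<otimes>\<^bsub>T\<^esub> y q) =
            \<xi> g j (A p q \<otimes>\<^bsub>T\<^esub> (\<Oplus>\<^bsub>T\<^esub>h\<in>?H. \<Oplus>\<^bsub>T\<^esub>l\<in>{..<rk h}. \<beta> h l \<otimes>\<^bsub>T\<^esub> \<xi> h l (y q)))"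
          using spread[OF y_def kp(1) q kp(2)] by simp
        also have "\<dots> = \<xi> g j (\<Oplus>\<^bsub>T\<^esub>h\<in>?H. \<Oplus>\<^bsub>T\<^esub>l\<in>{..<rk h}. A p q \<otimes>\<^bsub>T\<^esub> (\<beta> h l \<otimes>\<^bsub>T\<^esub> \<xi> h l (y q)))"
        proof -
          have "A p q \<otimes>\<^bsub>T\<^esub> (\<Oplus>\<^bsub>T\<^esub>h\<in>?H. \<Oplus>\<^bsub>T\<^esub>l\<in>{..<rk h}. \<beta> h l \<otimes>\<^bsub>T\<^esub> \<xi> h l (y q)) =
              (\<Oplus>\<^bsub>T\<^esub>h\<in>?H. A p q \<otimes>\<^bsub>T\<^esub> (\<Oplus>\<^bsub>T\<^esub>l\<in>{..<rk h}. \<beta> h l \<otimes>\<^bsub>T\<^esub> \<xi> h l (y q)))"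
            using H Apq bx by (intro T.finsum_rdistr) (auto intro!: T.finsum_closed)
          also have "\<dots> = (\<Oplus>\<^bsub>T\<^esub>h\<in>?H. \<Oplus>\<^bsub>T\<^esub>l\<in>{..<rk h}. A p q \<otimes>\<^bsub>T\<^esub> (\<beta> h l \<otimes>\<^bsub>T\<^esub> \<xi> h l (y q)))"
            using H Apq bx by (intro T.finsum_cong' refl T.finsum_rdistr) (auto intro!: T.finsum_closed)
          finally show ?thesis by simp
        qed
        also have "\<dots> = (\<Oplus>\<^bsub>T\<^esub>h\<in>?H. \<xi> g j (\<Oplus>\<^bsub>T\<^esub>l\<in>{..<rk h}. A p q \<otimes>\<^bsub>T\<^esub> (\<beta> h l \<otimes>\<^bsub>T\<^esub> \<xi> h l (y q))))"
          using ip H Apq bx by (intro \<xi>_sum) (auto intro!: T.finsum_closed)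
        also have "\<dots> = (\<Oplus>\<^bsub>T\<^esub>h\<in>?H. \<Oplus>\<^bsub>T\<^esub>l\<in>{..<rk h}. \<xi> g j (A p q \<otimes>\<^bsub>T\<^esub> (\<beta> h l \<otimes>\<^bsub>T\<^esub> \<xi> h l (y q))))"
          using ip H Apq bx \<xi>_car by (intro T.finsum_cong' refl \<xi>_sum) (auto intro!: T.finsum_closed)
        also have "\<dots> = (\<Oplus>\<^bsub>T\<^esub>h\<in>?H. \<Oplus>\<^bsub>T\<^esub>l\<in>{..<rk h}.
            \<xi> g j (A p q \<otimes>\<^bsub>T\<^esub> \<beta> h l) \<otimes>\<^bsub>T\<^esub> \<xi> h l (y q))"
        proof (intro T.finsum_cong' refl)
          fix h l assume h: "h \<in> ?H" and "l \<in> {..<rk h}"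
          then have hl: "h \<in> carrier G" "l < rk h" using H by auto
          have m: "\<xi> h l (y q) \<in> D \<one>\<^bsub>G\<^esub>" "\<xi> h l (y q) \<in> carrier T" "\<beta> h l \<in> carrier T"
            using hl y[OF q] \<xi>_mem \<xi>_car \<beta>_car by auto
          show "\<xi> g j (A p q \<otimes>\<^bsub>T\<^esub> (\<beta> h l \<otimes>\<^bsub>T\<^esub> \<xi> h l (y q))) =
              \<xi> g j (A p q \<otimes>\<^bsub>T\<^esub> \<beta> h l) \<otimes>\<^bsub>T\<^esub> \<xi> h l (y q)"
            using ip Apq m by (simp add: T.m_assoc[symmetric] \<xi>_mult)
        qed (use ip H Apq y[OF q] \<beta>_car \<xi>_car in \<open>auto intro!: T.finsum_closed T.m_closed\<close>)
        finally show "(\<Oplus>\<^bsub>T\<^esub>h\<in>?H. \<Oplus>\<^bsub>T\<^esub>l\<in>{..<rk h}. \<xi> g j (A p q \<otimes>\<^bsub>T\<^esub> \<beta> h l) \<otimes>\<^bsub>T\<^esub> \<xi> h l (y q)) =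
            \<xi> g j (A p q \<otimes>\<^bsub>T\<^esub> y q)" by simp
      qed (use ip A y \<xi>_car in auto)
      also have "\<dots> = \<xi> g j (\<Oplus>\<^bsub>T\<^esub>q\<in>{..<n}. A p q \<otimes>\<^bsub>T\<^esub> y q)"
        using ip A y by (intro \<xi>_sum[symmetric]) auto
      also have "(\<Oplus>\<^bsub>T\<^esub>q\<in>{..<n}. A p q \<otimes>\<^bsub>T\<^esub> y q) = (\<Oplus>\<^bsub>T\<^esub>q\<in>{..<n}. A p q \<otimes>\<^bsub>T\<^esub> B q p') \<otimes>\<^bsub>T\<^esub> \<beta> g' j'"
      proof -
        have "(\<Oplus>\<^bsub>T\<^esub>q\<in>{..<n}. A p q \<otimes>\<^bsub>T\<^esub> y q) = (\<Oplus>\<^bsub>T\<^esub>q\<in>{..<n}. A p q \<otimes>\<^bsub>T\<^esub> B q p' \<otimes>\<^bsub>T\<^esub> \<beta> g' j')"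
          using ip kp A B \<beta>_car by (intro T.finsum_cong') (auto simp: y_def T.m_assoc)
        also have "\<dots> = (\<Oplus>\<^bsub>T\<^esub>q\<in>{..<n}. A p q \<otimes>\<^bsub>T\<^esub> B q p') \<otimes>\<^bsub>T\<^esub> \<beta> g' j'"
          using ip kp A B \<beta>_car by (intro T.finsum_ldistr[symmetric]) auto
        finally show ?thesis .
      qed
      also have "\<dots> = (if p = p' then \<beta> g' j' else \<zero>\<^bsub>T\<^esub>)"
        using AB[of p p'] ip kp \<beta>_car by auto
      also have "\<xi> g j \<dots> = (if i = k then \<one>\<^bsub>T\<^esub> else \<zero>\<^bsub>T\<^esub>)"
        using ip kp \<xi>_\<beta> \<xi>_zero by (auto simp: i_eq k_eq)
      finally show "(\<Oplus>\<^bsub>R\<^esub>t\<in>?J. a i t \<otimes>\<^bsub>R\<^esub> b t k) = (if i = k then \<one>\<^bsub>R\<^esub> else \<zero>\<^bsub>R\<^esub>)"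
        by (simp add: base_ring_simps)
    qed (simp_all add: a_mem b_mem base_ring_simps del: mem_Sigma_iff)
    then have "card ?I \<le> card ?J"
      using F H by (intro R.UGN_mat_retract_card[OF ugn]) (auto intro!: finite_SigmaI)
    then show ?thesis using F H by (simp add: card_SigmaI)
  qed
  then show ?thesis using S by blast
qed

lemma rank_pos:
  assumes full: "full_grading G T D" and g: "g \<in> carrier G"
    and iso: "mod_isomorphic R (right_component T D g) (right_free_module R i)"
  shows "0 < i"
proof (rule ccontr)
  assume "\<not> 0 < i"
  then obtain f :: "'a \<Rightarrow> nat \<Rightarrow> 'a" where f: "bij_betw f (D g) {\<lambda>_. undefined}"
    using iso by (auto simp: mod_isomorphic_def right_component_def right_free_module_simps)
  have "x = \<zero>\<^bsub>T\<^esub>" if "x \<in> D g" for x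
  proof (rule inj_onD[OF bij_betw_imp_inj_on[OF f] _ that D_zero[OF g]])
    show "f x = f \<zero>\<^bsub>T\<^esub>" using bij_betwE[OF f] that D_zero[OF g] by auto
  qed
  then have "D g = {\<zero>\<^bsub>T\<^esub>}" using D_zero[OF g] by blast
  then show False using full g by (simp add: full_grading_def)
qed

text \<open>
  The rank \<open>F \<mapsto> \<Sum>\<^bsub>g\<in>F\<^esub> rk g\<close> lies between \<open>|F|\<close> (fullness) and \<open>r |F|\<close> (bounded freeness), and by the
  main estimate it grows by the factor \<open>(n+1)/n\<close> under multiplication by \<open>S\<close>.
\<close>

lemma not_UGN_imp_doubling:
  assumes full: "full_grading G T D" and ugn: "UGN R" and not_ugn: "\<not> UGN T"
    and iso: "\<And>g. g \<in> carrier G \<Longrightarrow>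
      \<exists>i\<le>r. mod_isomorphic R (right_component T D g) (right_free_module R i)"
  shows "doubling G"
proof -
  obtain n :: nat where n: "0 < n" and ret: "mat_retract T {..<n + 1} {..<n}"
    using not_ugn T.UGN_iff_no_mat_retract by blast
  obtain rk where rk: "\<And>g. g \<in> carrier G \<Longrightarrow> rk g \<le> r"
    and iso': "\<And>g. g \<in> carrier G \<Longrightarrow>
      mod_isomorphic R (right_component T D g) (right_free_module R (rk g))"
    using iso by metis
  have pos: "1 \<le> rk g" if "g \<in> carrier G" for g
    using rank_pos[OF full that iso'[OF that]] by simp
  obtain S where S: "finite S" "S \<subseteq> carrier G"
    and grow: "\<And>F. finite F \<Longrightarrow> F \<subseteq> carrier G \<Longrightarrow>
      (n + 1) * (\<Sum>g\<in>F. rk g) \<le> n * (\<Sum>g\<in>S <#>\<^bsub>G\<^esub> F. rk g)"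
    using right_growth[OF ugn n ret iso'] by blast
  have r: "1 \<le> r" using pos[OF G.one_closed] rk[OF G.one_closed] by linarith
  show ?thesis
  proof (rule G.doublingI_expansion[OF S, where c = "(n + 1) / n" and r = r and w = "\<lambda>F. \<Sum>g\<in>F. rk g"])
    show "1 < real (n + 1) / real n" using n by simp
    show "0 < real r" using r by simp
    fix F assume F: "finite F" "F \<subseteq> carrier G"
    have "(\<Sum>g\<in>F. 1) \<le> (\<Sum>g\<in>F. rk g)" using F pos by (intro sum_mono) auto
    then have "card F \<le> (\<Sum>g\<in>F. rk g)" by simp
    then show "real (card F) \<le> real (\<Sum>g\<in>F. rk g)" by (rule of_nat_mono)
    have "(\<Sum>g\<in>F. rk g) \<le> (\<Sum>g\<in>F. r)" using F rk by (intro sum_mono) auto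
    then have "(\<Sum>g\<in>F. rk g) \<le> r * card F" by (simp add: mult.commute)
    then have "real (\<Sum>g\<in>F. rk g) \<le> real (r * card F)" by (rule of_nat_mono)
    then show "real (\<Sum>g\<in>F. rk g) \<le> real r * real (card F)" by simp
    have "real ((n + 1) * (\<Sum>g\<in>F. rk g)) \<le> real (n * (\<Sum>g\<in>S <#>\<^bsub>G\<^esub> F. rk g))"
      using grow[OF F] by (rule of_nat_mono)
    then show "real (n + 1) / real n * real (\<Sum>g\<in>F. rk g) \<le> real (\<Sum>g\<in>S <#>\<^bsub>G\<^esub> F. rk g)"
      using n by (simp add: field_simps)
  qed
qed

end

text \<open>
  The opposite group.  If \<open>T\<close> is graded by \<open>G\<close>, then the opposite ring is graded by the opposite
  group with the same components, and left modules become right modules.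
\<close>

definition opp_group :: "('g, 'n) monoid_scheme \<Rightarrow> ('g, 'n) monoid_scheme" where
  "opp_group G = G\<lparr>monoid.mult := \<lambda>x y. y \<otimes>\<^bsub>G\<^esub> x\<rparr>"

lemma opp_group_simps [simp]:
  "carrier (opp_group G) = carrier G" "\<one>\<^bsub>opp_group G\<^esub> = \<one>\<^bsub>G\<^esub>"
  "x \<otimes>\<^bsub>opp_group G\<^esub> y = y \<otimes>\<^bsub>G\<^esub> x"
  by (simp_all add: opp_group_def)

lemma group_opp_group:
  assumes "group G"
  shows "group (opp_group G)"
proof -
  interpret group G by fact
  show ?thesis
    by (rule groupI) (auto simp: m_assoc intro: bexI[of _ "inv\<^bsub>G\<^esub> x" for x])
qed

lemma doubling_opp_group:
  assumes "group G" and "doubling (opp_group G)"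
  shows "doubling G"
proof -
  interpret group G by fact
  obtain K where K: "finite K" "K \<subseteq> carrier G"
    and dbl: "\<And>F. finite F \<Longrightarrow> F \<subseteq> carrier G \<Longrightarrow> 2 * card F \<le> card (K <#>\<^bsub>opp_group G\<^esub> F)"
    using assms(2) by (auto simp: doubling_def)
  have inj: "inj_on (m_inv G) A" if "A \<subseteq> carrier G" for A
    using that by (auto intro!: inj_onI dest: inv_inj[THEN inj_onD])
  have "2 * card F \<le> card ((m_inv G ` K) <#>\<^bsub>G\<^esub> F)" if F: "finite F" "F \<subseteq> carrier G" for F
  proof -
    let ?L = "K <#>\<^bsub>opp_group G\<^esub> (m_inv G ` F)"
    have "m_inv G ` ?L = (m_inv G ` K) <#>\<^bsub>G\<^esub> F"
    proof -
      have "inv\<^bsub>G\<^esub> (inv\<^bsub>G\<^esub> f \<otimes>\<^bsub>G\<^esub> k) = inv\<^bsub>G\<^esub> k \<otimes>\<^bsub>G\<^esub> f" if "k \<in> K" "f \<in> F" for k f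
        using that K F by (auto simp: inv_mult_group subset_iff)
      then show ?thesis by (auto simp: set_mult_def image_UN)
    qed
    moreover have "card (m_inv G ` ?L) = card ?L"
      using K F by (intro card_image inj) (auto simp: set_mult_def)
    moreover have "2 * card (m_inv G ` F) \<le> card ?L" using F by (intro dbl) auto
    moreover have "card (m_inv G ` F) = card F" using F by (intro card_image inj)
    ultimately show ?thesis by simp
  qed
  moreover have "finite (m_inv G ` K)" "m_inv G ` K \<subseteq> carrier G" using K by auto
  ultimately show ?thesis unfolding doubling_def by blast
qed

lemma mod_isomorphic_opp:
  "mod_isomorphic (opp_ring S) (right_component (opp_ring T) D g) (right_free_module (opp_ring S) n) \<longleftrightarrow>
   mod_isomorphic S (left_component T D g) (left_free_module S n)"
  by (simp add: mod_isomorphic_def mod_hom_def right_component_def left_component_def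
      right_free_module_def left_free_module_def)

lemma amenable_UGN_iff:
  assumes "group G" and am: "amenable G" and gr: "graded_ring G T D"
    and full: "full_grading G T D" and free: "boundedly_free G T D"
  shows "UGN T \<longleftrightarrow> UGN (base_ring G T D)"
proof
  interpret grading G T D
    using assms by (simp add: grading_def grading_axioms_def graded_ring_def)
  show "UGN T \<Longrightarrow> UGN R" by (rule UGN_imp_UGN_base)
  assume ugn: "UGN R"
  show "UGN T"
  proof (rule ccontr)
    assume not_ugn: "\<not> UGN T"
    obtain r where "(\<forall>g\<in>carrier G. \<exists>i\<le>r. mod_isomorphic R (right_component T D g) (right_free_module R i)) \<or>
       (\<forall>g\<in>carrier G. \<exists>i\<le>r. mod_isomorphic R (left_component T D g) (left_free_module R i))"
      using free unfolding boundedly_free_def by blast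
    then have "doubling G"
    proof
      assume "\<forall>g\<in>carrier G. \<exists>i\<le>r. mod_isomorphic R (right_component T D g) (right_free_module R i)"
      then show ?thesis by (intro not_UGN_imp_doubling[OF full ugn not_ugn]) blast
    next
      assume left: "\<forall>g\<in>carrier G. \<exists>i\<le>r. mod_isomorphic R (left_component T D g) (left_free_module R i)"
      have base: "base_ring (opp_group G) (opp_ring T) D = opp_ring R"
        by (simp add: base_ring_def opp_ring_def)
      have "graded_ring (opp_group G) (opp_ring T) D"
      proof -
        have "additive_subgroup (D g) (opp_ring T)" if "g \<in> carrier G" for g
          using D_subgroup[OF that] by (simp add: additive_subgroup_def)
        then show ?thesis using gr ring_opp_ring[of T] by (simp add: graded_ring_def)
      qed
      then interpret op: grading "opp_group G" "opp_ring T" D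
        using ring_opp_ring[OF T.ring_axioms] group_opp_group[OF assms(1)]
        by (simp add: grading_def grading_axioms_def)
      have "doubling (opp_group G)"
      proof (rule op.not_UGN_imp_doubling)
        show "full_grading (opp_group G) (opp_ring T) D" using full by (simp add: full_grading_def)
        show "UGN (base_ring (opp_group G) (opp_ring T) D)"
          using ugn unfolding base by (simp add: UGN_opp_ring ring_base_ring)
        show "\<not> UGN (opp_ring T)" using not_ugn by (simp add: UGN_opp_ring T.ring_axioms)
        show "\<exists>i\<le>r. mod_isomorphic (base_ring (opp_group G) (opp_ring T) D)
            (right_component (opp_ring T) D g) (right_free_module (base_ring (opp_group G) (opp_ring T) D) i)"
          if "g \<in> carrier (opp_group G)" for g
          using left that unfolding base mod_isomorphic_opp by simp
      qed
      then show ?thesis by (rule doubling_opp_group[OF assms(1)])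
    qed
    then show False using G.doubling_imp_not_amenable am by blast
  qed
qed

lemma crossed_product_full_free:
  assumes "group G" and cp: "crossed_product G S T D" and nz: "carrier T \<noteq> {\<zero>\<^bsub>T\<^esub>}"
  shows "full_grading G T D" "boundedly_free G T D"
proof -
  have gr: "graded_ring G T D" using cp by (simp add: crossed_product_def)
  interpret grading G T D
    using gr assms(1) by (simp add: grading_def grading_axioms_def graded_ring_def)
  have ne: "\<one>\<^bsub>T\<^esub> \<noteq> \<zero>\<^bsub>T\<^esub>" using nz T.one_zeroD by blast
  have ex: "\<exists>u\<in>Units T. u \<in> D g" if "g \<in> carrier G" for g
    using cp that by (simp add: crossed_product_def)
  show "full_grading G T D"
    unfolding full_grading_def
  proof
    fix g assume "g \<in> carrier G"
    then obtain u where u: "u \<in> Units T" "u \<in> D g" using ex by blast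
    have "u \<noteq> \<zero>\<^bsub>T\<^esub>"
    proof
      assume "u = \<zero>\<^bsub>T\<^esub>"
      then have "\<one>\<^bsub>T\<^esub> = \<zero>\<^bsub>T\<^esub>" using T.Units_r_inv[OF u(1)] T.Units_inv_closed[OF u(1)] by simp
      then show False using ne by simp
    qed
    then show "D g \<noteq> {\<zero>\<^bsub>T\<^esub>}" using u by blast
  qed
  have "mod_isomorphic R (right_component T D g) (right_free_module R 1)" if g: "g \<in> carrier G" for g
  proof -
    obtain u where u: "u \<in> Units T" "u \<in> D g" using ex[OF g] by blast
    let ?v = "inv\<^bsub>T\<^esub> u"
    have uT: "u \<in> carrier T" and vT: "?v \<in> carrier T" and uv: "u \<otimes>\<^bsub>T\<^esub> ?v = \<one>\<^bsub>T\<^esub>" "?v \<otimes>\<^bsub>T\<^esub> u = \<one>\<^bsub>T\<^esub>"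
      using u by auto
    have cancel: "?v \<otimes>\<^bsub>T\<^esub> (u \<otimes>\<^bsub>T\<^esub> x) = x" "u \<otimes>\<^bsub>T\<^esub> (?v \<otimes>\<^bsub>T\<^esub> x) = x" if "x \<in> carrier T" for x
      using that uT vT uv by (simp_all add: T.m_assoc[symmetric])
    have vx: "?v \<otimes>\<^bsub>T\<^esub> x \<in> D \<one>\<^bsub>G\<^esub>" if x: "x \<in> D g" for x
    proof -
      have xT: "x \<in> carrier T" using x g D_carrier by blast
      have "u \<otimes>\<^bsub>T\<^esub> hcomp \<one>\<^bsub>G\<^esub> (?v \<otimes>\<^bsub>T\<^esub> x) = hcomp g (u \<otimes>\<^bsub>T\<^esub> (?v \<otimes>\<^bsub>T\<^esub> x))"
        using hcomp_mult_left[OF u(2) g _ G.one_closed, of "?v \<otimes>\<^bsub>T\<^esub> x"] g xT vT by simp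
      also have "\<dots> = x" using cancel(2)[OF xT] hcomp_homogeneous[OF g x g] by simp
      finally have "?v \<otimes>\<^bsub>T\<^esub> x = hcomp \<one>\<^bsub>G\<^esub> (?v \<otimes>\<^bsub>T\<^esub> x)"
        using cancel(1)[OF hcomp_carrier[OF G.one_closed, of "?v \<otimes>\<^bsub>T\<^esub> x"]] xT vT by simp
      then show ?thesis using hcomp_mem[OF G.one_closed, of "?v \<otimes>\<^bsub>T\<^esub> x"] xT vT by simp
    qed
    have uc: "u \<otimes>\<^bsub>T\<^esub> c \<in> D g" if "c \<in> D \<one>\<^bsub>G\<^esub>" for c
      using D_mult[OF g G.one_closed u(2) that] g by simp
    let ?f = "\<lambda>x. \<lambda>i\<in>{..<1::nat}. ?v \<otimes>\<^bsub>T\<^esub> x"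
    have "?f \<in> mod_hom R (right_component T D g) (right_free_module R 1)"
      using vx vT D_carrier[OF g] D_carrier[OF G.one_closed]
      by (auto simp: mod_hom_def right_component_def right_free_module_simps base_ring_simps
          T.r_distr T.m_assoc fun_eq_iff extensional_def)
    moreover have "bij_betw ?f (D g) ({..<1::nat} \<rightarrow>\<^sub>E D \<one>\<^bsub>G\<^esub>)"
    proof (rule bij_betw_byWitness[where f' = "\<lambda>w. u \<otimes>\<^bsub>T\<^esub> w 0"])
      show "\<forall>x\<in>D g. u \<otimes>\<^bsub>T\<^esub> ?f x 0 = x" using cancel D_carrier[OF g] by simp
      show "\<forall>w\<in>{..<1::nat} \<rightarrow>\<^sub>E D \<one>\<^bsub>G\<^esub>. ?f (u \<otimes>\<^bsub>T\<^esub> w 0) = w"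
      proof
        fix w assume w: "w \<in> {..<1::nat} \<rightarrow>\<^sub>E D \<one>\<^bsub>G\<^esub>"
        then have "w 0 \<in> D \<one>\<^bsub>G\<^esub>" by auto
        then have "?v \<otimes>\<^bsub>T\<^esub> (u \<otimes>\<^bsub>T\<^esub> w 0) = w 0" using cancel D_carrier[OF G.one_closed] by blast
        then show "?f (u \<otimes>\<^bsub>T\<^esub> w 0) = w" using w by (auto simp: fun_eq_iff PiE_def extensional_def)
      qed
      show "?f ` D g \<subseteq> {..<1::nat} \<rightarrow>\<^sub>E D \<one>\<^bsub>G\<^esub>" using vx by (auto split: if_splits)
      show "(\<lambda>w. u \<otimes>\<^bsub>T\<^esub> w 0) ` ({..<1::nat} \<rightarrow>\<^sub>E D \<one>\<^bsub>G\<^esub>) \<subseteq> D g" using uc by auto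
    qed
    ultimately show ?thesis
      by (auto simp: mod_isomorphic_def right_component_def right_free_module_simps base_ring_simps)
  qed
  then show "boundedly_free G T D"
    unfolding boundedly_free_def by (intro exI[of _ 1]) auto
qed

lemma crossed_product_trivial:
  assumes "group G" and cp: "crossed_product G S T D" and trivial: "carrier T = {\<zero>\<^bsub>T\<^esub>}"
  shows "S = T"
proof -
  interpret grading G T D
    using cp assms(1) by (simp add: crossed_product_def grading_def grading_axioms_def graded_ring_def)
  have "D \<one>\<^bsub>G\<^esub> = carrier T"
  proof
    show "D \<one>\<^bsub>G\<^esub> \<subseteq> carrier T" using D_carrier[OF G.one_closed] by blast
    show "carrier T \<subseteq> D \<one>\<^bsub>G\<^esub>" unfolding trivial using D_zero[OF G.one_closed] by simp
  qed
  then have "R = T" by (simp add: base_ring_def)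
  then show ?thesis using cp unfolding crossed_product_def by simp
qed

section \<open>Constructing gradings from projections\<close>

text \<open>
  The uniqueness of components follows from the existence of additive projections \<open>\<pi> g\<close> onto the
  components.
\<close>

lemma graded_ringI:
  assumes "ring T"
    and sub: "\<And>g. g \<in> carrier G \<Longrightarrow> additive_subgroup (D g) T"
    and mult: "\<And>g h x y. g \<in> carrier G \<Longrightarrow> h \<in> carrier G \<Longrightarrow> x \<in> D g \<Longrightarrow> y \<in> D h \<Longrightarrow>
      x \<otimes>\<^bsub>T\<^esub> y \<in> D (g \<otimes>\<^bsub>G\<^esub> h)"
    and span: "\<And>x. x \<in> carrier T \<Longrightarrow>
      \<exists>F f. finite F \<and> F \<subseteq> carrier G \<and> (\<forall>g\<in>F. f g \<in> D g) \<and> x = (\<Oplus>\<^bsub>T\<^esub>g\<in>F. f g)"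
    and proj_closed: "\<And>g x. g \<in> carrier G \<Longrightarrow> x \<in> carrier T \<Longrightarrow> \<pi> g x \<in> carrier T"
    and proj_add: "\<And>g x y. g \<in> carrier G \<Longrightarrow> x \<in> carrier T \<Longrightarrow> y \<in> carrier T \<Longrightarrow>
      \<pi> g (x \<oplus>\<^bsub>T\<^esub> y) = \<pi> g x \<oplus>\<^bsub>T\<^esub> \<pi> g y"
    and proj_D: "\<And>g h x. g \<in> carrier G \<Longrightarrow> h \<in> carrier G \<Longrightarrow> x \<in> D h \<Longrightarrow>
      \<pi> g x = (if h = g then x else \<zero>\<^bsub>T\<^esub>)"
  shows "graded_ring G T D"
  unfolding graded_ring_def
proof (intro conjI ballI)
  interpret ring T by fact
  have D_carrier: "x \<in> carrier T" if "g \<in> carrier G" "x \<in> D g" for g x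
    using additive_subgroup.a_subset[OF sub[OF that(1)]] that(2) by blast
  have D_zero: "\<zero>\<^bsub>T\<^esub> \<in> D g" if "g \<in> carrier G" for g
    using additive_subgroup.zero_closed[OF sub[OF that]] .
  fix x assume x: "x \<in> carrier T"
  let ?supp = "\<lambda>f. {g \<in> carrier G. f g \<noteq> \<zero>\<^bsub>T\<^esub>}"
  let ?P = "\<lambda>f. f \<in> (\<Pi>\<^sub>E g\<in>carrier G. D g) \<and> finite (?supp f) \<and> x = finsum T f (?supp f)"
  have unique: "f = (\<lambda>g\<in>carrier G. \<pi> g x)" if f: "?P f" for f
  proof
    fix g
    show "f g = (\<lambda>g\<in>carrier G. \<pi> g x) g"
    proof (cases "g \<in> carrier G")
      case True
      have fD: "f k \<in> D k" if "k \<in> carrier G" for k using f that by auto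
      have fT: "f k \<in> carrier T" if "k \<in> carrier G" for k using fD[OF that] D_carrier that by blast
      have "\<pi> g x = \<pi> g (\<Oplus>\<^bsub>T\<^esub>k\<in>?supp f. f k)" using f by simp
      also have "\<dots> = (\<Oplus>\<^bsub>T\<^esub>k\<in>?supp f. \<pi> g (f k))"
        using True fT proj_closed proj_add proj_D[OF True True D_zero[OF True]]
        by (intro additive_map_finsum abelian_monoid_axioms) auto
      also have "\<dots> = (\<Oplus>\<^bsub>T\<^esub>k\<in>?supp f. if k = g then f k else \<zero>\<^bsub>T\<^esub>)"
        using True fD fT proj_D by (intro finsum_cong') auto
      also have "\<dots> = f g"
      proof (cases "f g = \<zero>\<^bsub>T\<^esub>")
        case True
        then show ?thesis by (intro trans[OF add.finprod_one_eqI]) auto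
      next
        case False
        then show ?thesis using f True fT by (intro finsum_delta) auto
      qed
      finally show ?thesis using True by simp
    qed (use f in \<open>auto simp: PiE_def extensional_def\<close>)
  qed
  obtain F f where F: "finite F" "F \<subseteq> carrier G" and fD: "\<And>g. g \<in> F \<Longrightarrow> f g \<in> D g"
    and xf: "x = (\<Oplus>\<^bsub>T\<^esub>g\<in>F. f g)"
    using span[OF x] by blast
  let ?f = "\<lambda>g\<in>carrier G. if g \<in> F then f g else \<zero>\<^bsub>T\<^esub>"
  have S: "?supp ?f \<subseteq> F" by auto
  have "x = finsum T ?f (?supp ?f)"
    unfolding xf using F S fD D_carrier by (intro add.finprod_mono_neutral_cong_right) auto
  moreover have "?f \<in> (\<Pi>\<^sub>E g\<in>carrier G. D g)" using fD D_zero by auto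
  ultimately have f: "?P ?f" using finite_subset[OF S F(1)] by blast
  show "\<exists>!f. ?P f"
  proof (rule ex1I[of ?P ?f, OF f])
    fix f' assume "?P f'"
    then show "f' = ?f" using unique[of f'] unique[OF f] by (simp only:)
  qed
qed (use assms in auto)

lemma graded_ring_iso_image:
  assumes "group G" and gr: "graded_ring G T D" and "ring T'" and h: "h \<in> ring_iso T T'"
  shows "graded_ring G T' (\<lambda>g. h ` D g)"
proof -
  interpret grading G T D
    using assms(1) gr by (simp add: grading_def grading_axioms_def graded_ring_def)
  interpret T': ring T' by fact
  have hom: "h \<in> ring_hom T T'" and bij: "bij_betw h (carrier T) (carrier T')"
    using h by (simp_all add: ring_iso_def)
  interpret h: ring_hom_ring T T' h by (rule ring_hom_ringI2[OF T.ring_axioms assms(3) hom])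
  define h' where "h' = inv_into (carrier T) h"
  have h'h: "h' (h x) = x" if "x \<in> carrier T" for x
    using bij that by (simp add: h'_def bij_betw_def)
  have hh': "h (h' y) = y" and h'_car: "h' y \<in> carrier T" if "y \<in> carrier T'" for y
    using bij that by (auto simp: h'_def bij_betw_def f_inv_into_f inv_into_into)
  have h_zero: "h \<zero>\<^bsub>T\<^esub> = \<zero>\<^bsub>T'\<^esub>" by (rule ring_hom_zero[OF hom T.ring_axioms assms(3)])
  have h'_add: "h' (x \<oplus>\<^bsub>T'\<^esub> y) = h' x \<oplus>\<^bsub>T\<^esub> h' y" if "x \<in> carrier T'" "y \<in> carrier T'" for x y
  proof -
    have "x \<oplus>\<^bsub>T'\<^esub> y = h (h' x \<oplus>\<^bsub>T\<^esub> h' y)"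
      using that by (simp add: ring_hom_add[OF hom] hh' h'_car)
    then have "h' (x \<oplus>\<^bsub>T'\<^esub> y) = h' (h (h' x \<oplus>\<^bsub>T\<^esub> h' y))" by (simp only:)
    also have "\<dots> = h' x \<oplus>\<^bsub>T\<^esub> h' y" using that by (intro h'h) (simp add: h'_car)
    finally show ?thesis .
  qed
  show ?thesis
  proof (rule graded_ringI[where \<pi> = "\<lambda>g x. h (hcomp g (h' x))", OF assms(3)])
    fix g assume "g \<in> carrier G"
    then have "subgroup (D g) (add_monoid T)" using D_subgroup by (simp add: additive_subgroup_def)
    then show "additive_subgroup (h ` D g) T'"
      unfolding additive_subgroup_def by (rule group_hom.subgroup_img_is_subgroup[OF h.a_group_hom])
  next
    fix g k x y assume gk: "g \<in> carrier G" "k \<in> carrier G" and "x \<in> h ` D g" "y \<in> h ` D k"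
    then obtain a b where ab: "a \<in> D g" "b \<in> D k" "x = h a" "y = h b" by blast
    then have "x \<otimes>\<^bsub>T'\<^esub> y = h (a \<otimes>\<^bsub>T\<^esub> b)" using gk D_carrier by (simp add: ring_hom_mult[OF hom])
    then show "x \<otimes>\<^bsub>T'\<^esub> y \<in> h ` D (g \<otimes>\<^bsub>G\<^esub> k)" using D_mult[OF gk ab(1,2)] by blast
  next
    fix x assume x: "x \<in> carrier T'"
    let ?F = "{g \<in> carrier G. hcomp g (h' x) \<noteq> \<zero>\<^bsub>T\<^esub>}"
    have F: "finite ?F" using finite_hcomp h'_car[OF x] by simp
    have "x = h (\<Oplus>\<^bsub>T\<^esub>g\<in>?F. hcomp g (h' x))"
      using sum_hcomp[OF h'_car[OF x] F] hh'[OF x] by simp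
    also have "\<dots> = (\<Oplus>\<^bsub>T'\<^esub>g\<in>?F. h (hcomp g (h' x)))"
      using h'_car[OF x] hcomp_carrier h_zero
      by (intro additive_map_finsum T.abelian_monoid_axioms T'.abelian_monoid_axioms)
         (auto simp: ring_hom_add[OF hom])
    finally show "\<exists>F f. finite F \<and> F \<subseteq> carrier G \<and> (\<forall>g\<in>F. f g \<in> h ` D g) \<and> x = (\<Oplus>\<^bsub>T'\<^esub>g\<in>F. f g)"
      using F hcomp_mem h'_car[OF x]
      by (intro exI[of _ ?F] exI[of _ "\<lambda>g. h (hcomp g (h' x))"]) auto
  next
    fix g k x assume gk: "g \<in> carrier G" "k \<in> carrier G" and "x \<in> h ` D k"
    then obtain a where "a \<in> D k" "x = h a" by blast
    then show "h (hcomp g (h' x)) = (if k = g then x else \<zero>\<^bsub>T'\<^esub>)"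
      using gk D_carrier[OF gk(2)] h_zero by (auto simp: h'h hcomp_homogeneous)
  next
    fix g x y assume "g \<in> carrier G" "x \<in> carrier T'" "y \<in> carrier T'"
    then show "h (hcomp g (h' (x \<oplus>\<^bsub>T'\<^esub> y))) = h (hcomp g (h' x)) \<oplus>\<^bsub>T'\<^esub> h (hcomp g (h' y))"
      by (simp add: h'_add hcomp_add h'_car hcomp_carrier ring_hom_add[OF hom])
  qed (simp add: h'_car hcomp_carrier)
qed

section \<open>A skew group ring of partial translations\<close>

text \<open>
  The closure of \<open>B\<close> under a set of binary operations.
\<close>

inductive_set closure_under :: "'x set \<Rightarrow> ('x \<Rightarrow> 'x \<Rightarrow> 'x) set \<Rightarrow> 'x set"
  for B :: "'x set" and Fs :: "('x \<Rightarrow> 'x \<Rightarrow> 'x) set" where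
  base: "b \<in> B \<Longrightarrow> b \<in> closure_under B Fs"
| step: "f \<in> Fs \<Longrightarrow> x \<in> closure_under B Fs \<Longrightarrow> y \<in> closure_under B Fs \<Longrightarrow> f x y \<in> closure_under B Fs"

lemma card_closure_under:
  assumes inf: "infinite K" and B: "|B| \<le>o |K|" and Fs: "|Fs| \<le>o |K|"
  shows "|closure_under B Fs| \<le>o |K|"
proof -
  \<comment> \<open>\<open>C n\<close> consists of the elements obtained by at most \<open>n\<close> rounds of operations.\<close>
  define C where "C n = ((\<lambda>C. C \<union> (\<lambda>(f, x, y). f x y) ` (Fs \<times> C \<times> C)) ^^ n) B" for n :: nat
  have C0: "C 0 = B" and CSuc: "C (Suc n) = C n \<union> (\<lambda>(f, x, y). f x y) ` (Fs \<times> C n \<times> C n)" for n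
    by (simp_all add: C_def)
  have cardC: "|C n| \<le>o |K|" for n
  proof (induction n)
    case 0
    then show ?case using B by (simp add: C0)
  next
    case (Suc n)
    have "|Fs \<times> C n \<times> C n| \<le>o |K|"
      using inf Fs Suc by (intro card_of_Times_ordLeq_infinite)
    then have "|(\<lambda>(f, x, y). f x y) ` (Fs \<times> C n \<times> C n)| \<le>o |K|"
      using card_of_image ordLeq_transitive by blast
    then show ?case unfolding CSuc using inf Suc by (intro card_of_Un_ordLeq_infinite)
  qed
  have mono: "C m \<subseteq> C n" if "m \<le> n" for m n
    using that by (rule lift_Suc_mono_le[rotated]) (simp add: CSuc)
  have "closure_under B Fs \<subseteq> (\<Union>n. C n)"
  proof
    fix x assume "x \<in> closure_under B Fs"
    then show "x \<in> (\<Union>n. C n)"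
    proof induction
      case (base b)
      then show ?case using C0 by blast
    next
      case (step f x y)
      then obtain m n where "x \<in> C m" "y \<in> C n" by blast
      then have "x \<in> C (max m n)" "y \<in> C (max m n)"
        using mono[of m "max m n"] mono[of n "max m n"] by auto
      then have "f x y \<in> C (Suc (max m n))" unfolding CSuc using step.hyps(1) by force
      then show ?case by blast
    qed
  qed
  then have "|closure_under B Fs| \<le>o |\<Union>n. C n|" by (rule card_of_mono1)
  also have "|\<Union>n. C n| \<le>o |K|"
    using inf cardC by (intro card_of_UNION_ordLeq_infinite) (auto simp: infinite_iff_card_of_nat)
  finally show ?thesis .
qed

text \<open>The field with two elements.\<close>

definition bool_ring :: "bool ring" where
  "bool_ring = \<lparr>carrier = UNIV, monoid.mult = (\<and>), one = True, ring.zero = False, add = (\<noteq>)\<rparr>"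

lemma ring_bool_ring: "ring bool_ring"
proof (rule ringI)
  show "abelian_group bool_ring"
    by (rule abelian_groupI) (auto simp: bool_ring_def)
  show "monoid bool_ring"
    by (rule monoidI) (auto simp: bool_ring_def)
qed (auto simp: bool_ring_def)

lemma UGN_bool_ring: "UGN bool_ring"
  by (rule ring.UGN_finite_ring[OF ring_bool_ring]) (simp_all add: bool_ring_def)

text \<open>
  A Boolean algebra \<open>\<A>\<close> of subsets of \<open>G\<close> that is closed under left translation.  With symmetric
  difference and intersection it is a ring on which \<open>G\<close> acts.  Its skew group ring is realised as
  a ring of operators on subsets of \<open>G\<close>, so that associativity and distributivity come from
  composition of additive maps.
\<close>

locale translation_algebra = group G for G :: "('g, 'n) monoid_scheme" (structure) +
  fixes \<A> :: "'g set set"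
  assumes sub: "A \<in> \<A> \<Longrightarrow> A \<subseteq> carrier G"
    and top: "carrier G \<in> \<A>"
    and symdiff: "A \<in> \<A> \<Longrightarrow> B \<in> \<A> \<Longrightarrow> sym_diff A B \<in> \<A>"
    and inter: "A \<in> \<A> \<Longrightarrow> B \<in> \<A> \<Longrightarrow> A \<inter> B \<in> \<A>"
    and transl: "g \<in> carrier G \<Longrightarrow> A \<in> \<A> \<Longrightarrow> g <# A \<in> \<A>"
begin

text \<open>
  Translation by \<open>g\<close> followed by intersection with \<open>A\<close>; for \<open>A \<subseteq> carrier G\<close> this is
  \<open>Y \<mapsto> A \<inter> g Y\<close>, and only the part of \<open>Y\<close> inside \<open>carrier G\<close> matters.
\<close>

definition ptrans :: "'g \<Rightarrow> 'g set \<Rightarrow> 'g set \<Rightarrow> 'g set" where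
  "ptrans g A Y = {x \<in> A. inv g \<otimes> x \<in> Y}"

text \<open>Pointwise sum of operators, the sum of two sets being their symmetric difference.\<close>

definition sadd :: "('g set \<Rightarrow> 'g set) \<Rightarrow> ('g set \<Rightarrow> 'g set) \<Rightarrow> 'g set \<Rightarrow> 'g set" where
  "sadd E F Y = sym_diff (E Y) (F Y)"

text \<open>The operators in the skew group ring: finite sums of the operators \<open>ptrans g A\<close>.\<close>

inductive_set ops :: "('g set \<Rightarrow> 'g set) set" where
  base: "g \<in> carrier G \<Longrightarrow> A \<in> \<A> \<Longrightarrow> ptrans g A \<in> ops"
| sadd: "E \<in> ops \<Longrightarrow> F \<in> ops \<Longrightarrow> sadd E F \<in> ops"

text \<open>The skew group ring, with composition as multiplication.\<close>

definition W :: "('g set \<Rightarrow> 'g set) ring" where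
  "W = \<lparr>carrier = ops, monoid.mult = (\<circ>), one = ptrans \<one> (carrier G),
        ring.zero = (\<lambda>Y. {}), add = sadd\<rparr>"

text \<open>The homogeneous component of degree \<open>g\<close>.\<close>

definition homog :: "'g \<Rightarrow> ('g set \<Rightarrow> 'g set) set" where
  "homog g = {ptrans g A | A. A \<in> \<A>}"

lemma W_simps [simp]:
  "carrier W = ops" "x \<otimes>\<^bsub>W\<^esub> y = x \<circ> y" "\<one>\<^bsub>W\<^esub> = ptrans \<one> (carrier G)"
  "\<zero>\<^bsub>W\<^esub> = (\<lambda>Y. {})" "x \<oplus>\<^bsub>W\<^esub> y = sadd x y"
  by (simp_all add: W_def)

lemma empty: "{} \<in> \<A>"
  using symdiff[OF top top] by simp

lemma zero_ops: "(\<lambda>Y. {}) \<in> ops"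
proof -
  have "ptrans \<one> {} = (\<lambda>Y. {})" by (auto simp: ptrans_def)
  then show ?thesis using ops.base[OF one_closed empty] by simp
qed

lemma ops_subset: "E \<in> ops \<Longrightarrow> E Y \<subseteq> carrier G"
  by (induction rule: ops.induct) (use sub in \<open>auto simp: ptrans_def sadd_def\<close>)

lemma ops_restrict: "E \<in> ops \<Longrightarrow> E (carrier G \<inter> Y) = E Y"
proof (induction rule: ops.induct)
  case (base g A)
  then show ?case using sub[of A] by (auto simp: ptrans_def)
qed (simp add: sadd_def)

lemma ops_symdiff: "E \<in> ops \<Longrightarrow> E (sym_diff Y Z) = sym_diff (E Y) (E Z)"
  by (induction rule: ops.induct) (auto simp: ptrans_def sadd_def)

lemma ptrans_one: "ptrans \<one> A Y = carrier G \<inter> A \<inter> Y" if "A \<subseteq> carrier G"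
  using that by (auto simp: ptrans_def)

lemma ptrans_comp:
  assumes "g \<in> carrier G" "h \<in> carrier G" "A \<subseteq> carrier G" "B \<subseteq> carrier G"
  shows "ptrans g A \<circ> ptrans h B = ptrans (g \<otimes> h) (A \<inter> (g <# B))"
proof
  fix Y
  have "inv g \<otimes> x \<in> B \<longleftrightarrow> x \<in> g <# B" if "x \<in> A" for x
  proof
    assume "inv g \<otimes> x \<in> B"
    moreover have "x = g \<otimes> (inv g \<otimes> x)" using assms that by (auto simp: m_assoc[symmetric])
    ultimately show "x \<in> g <# B" unfolding l_coset_def by blast
  next
    assume "x \<in> g <# B"
    then obtain b where b: "b \<in> B" "x = g \<otimes> b" by (auto simp: l_coset_def)
    then have "inv g \<otimes> x = b" using assms by (auto simp: m_assoc[symmetric])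
    then show "inv g \<otimes> x \<in> B" using b by simp
  qed
  moreover have "inv (g \<otimes> h) \<otimes> x = inv h \<otimes> (inv g \<otimes> x)" if "x \<in> A" for x
    using assms that by (auto simp: inv_mult_group m_assoc)
  ultimately show "(ptrans g A \<circ> ptrans h B) Y = ptrans (g \<otimes> h) (A \<inter> (g <# B)) Y"
    by (auto simp: ptrans_def)
qed

lemma ops_comp: "E \<in> ops \<Longrightarrow> F \<in> ops \<Longrightarrow> E \<circ> F \<in> ops"
proof (induction rule: ops.induct)
  case (base g A)
  from base(3) show ?case
  proof (induction rule: ops.induct)
    case (base h B)
    then show ?case
      using \<open>g \<in> carrier G\<close> \<open>A \<in> \<A>\<close> by (simp add: ptrans_comp sub ops.base inter transl)
  next
    case (sadd F F')
    have "ptrans g A \<circ> sadd F F' = sadd (ptrans g A \<circ> F) (ptrans g A \<circ> F')"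
      using ops_symdiff[OF ops.base[OF base(1,2)]] by (auto simp: sadd_def fun_eq_iff)
    then show ?case using ops.sadd[OF sadd.IH] by (simp only:)
  qed
next
  case (sadd E E')
  have "sadd E E' \<circ> F = sadd (E \<circ> F) (E' \<circ> F)" by (auto simp: sadd_def fun_eq_iff)
  then show ?case using ops.sadd[OF sadd.IH(1,2)[OF sadd.prems]] by (simp only:)
qed

lemma ring_W: "ring W"
proof (rule ringI)
  show "abelian_group W"
  proof (rule abelian_groupI)
    fix E assume "E \<in> carrier W"
    then show "\<exists>F\<in>carrier W. F \<oplus>\<^bsub>W\<^esub> E = \<zero>\<^bsub>W\<^esub>"
      by (intro bexI[of _ E]) (auto simp: sadd_def)
  qed (auto simp: ops.sadd zero_ops sadd_def fun_eq_iff)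
  show "monoid W"
  proof (rule monoidI)
    fix E assume E: "E \<in> carrier W"
    show "\<one>\<^bsub>W\<^esub> \<otimes>\<^bsub>W\<^esub> E = E"
      using ops_subset E by (auto simp: fun_eq_iff ptrans_one)
    show "E \<otimes>\<^bsub>W\<^esub> \<one>\<^bsub>W\<^esub> = E"
      using ops_restrict E by (auto simp: fun_eq_iff ptrans_one)
  qed (auto simp: ops_comp ops.base top)
  fix E F H assume "E \<in> carrier W" "F \<in> carrier W" and H: "H \<in> carrier W"
  show "(E \<oplus>\<^bsub>W\<^esub> F) \<otimes>\<^bsub>W\<^esub> H = E \<otimes>\<^bsub>W\<^esub> H \<oplus>\<^bsub>W\<^esub> F \<otimes>\<^bsub>W\<^esub> H"
    by (simp add: sadd_def fun_eq_iff)
  show "H \<otimes>\<^bsub>W\<^esub> (E \<oplus>\<^bsub>W\<^esub> F) = H \<otimes>\<^bsub>W\<^esub> E \<oplus>\<^bsub>W\<^esub> H \<otimes>\<^bsub>W\<^esub> F"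
    using ops_symdiff H by (simp add: sadd_def fun_eq_iff)
qed

text \<open>
  The coefficient of \<open>g\<close> in an operator \<open>E\<close> can be read off from its values at singletons: it is the
  set of all \<open>x\<close> with \<open>x \<in> E {g\<^sup>-\<^sup>1 x}\<close>.
\<close>

lemma graded_W: "graded_ring G W homog"
proof (rule graded_ringI[where \<pi> = "\<lambda>g E. ptrans g {x \<in> carrier G. x \<in> E {inv g \<otimes> x}}", OF ring_W])
  interpret W: ring W by (rule ring_W)
  have ptrans_empty: "ptrans g {} = (\<lambda>Y. {})" for g by (auto simp: ptrans_def)
  have ptrans_sadd: "sadd (ptrans g A) (ptrans g B) = ptrans g (sym_diff A B)" for g A B
    by (auto simp: ptrans_def sadd_def fun_eq_iff)
  have homog_ops: "homog g \<subseteq> ops" if "g \<in> carrier G" for g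
    using that ops.base by (auto simp: homog_def)
  have zero_homog: "(\<lambda>Y. {}) \<in> homog g" for g
    using empty ptrans_empty[of g] by (force simp: homog_def)
  have sadd_homog: "sadd E F \<in> homog g" if "E \<in> homog g" "F \<in> homog g" for E F g
    using that ptrans_sadd symdiff by (fastforce simp: homog_def)
  have pi_ptrans: "ptrans g {x \<in> carrier G. x \<in> ptrans h A {inv g \<otimes> x}} = (if h = g then ptrans h A else (\<lambda>Y. {}))"
    if "g \<in> carrier G" "h \<in> carrier G" "A \<in> \<A>" for g h A
  proof -
    have "{x \<in> carrier G. x \<in> ptrans h A {inv g \<otimes> x}} = (if h = g then A else {})"
      using that sub[OF that(3)] by (auto simp: ptrans_def dest: inv_inj[THEN inj_onD])
    then show ?thesis using ptrans_empty by simp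
  qed
  have pi_sadd: "ptrans g {x \<in> carrier G. x \<in> sadd E F {inv g \<otimes> x}} =
      sadd (ptrans g {x \<in> carrier G. x \<in> E {inv g \<otimes> x}}) (ptrans g {x \<in> carrier G. x \<in> F {inv g \<otimes> x}})" for g E F
    by (auto simp: ptrans_def sadd_def fun_eq_iff)
  show "ptrans g {x \<in> carrier G. x \<in> E {inv g \<otimes> x}} \<in> carrier W" if "g \<in> carrier G" "E \<in> carrier W" for g E
  proof -
    from that(2) have "E \<in> ops" by simp
    then show ?thesis
    proof (induction rule: ops.induct)
      case (base h A)
      then show ?case using that(1) by (simp add: pi_ptrans ops.base zero_ops)
    next
      case (sadd E F)
      then show ?case by (simp add: pi_sadd ops.sadd)
    qed
  qed
  show "ptrans g {x \<in> carrier G. x \<in> (E \<oplus>\<^bsub>W\<^esub> F) {inv g \<otimes> x}} =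
      ptrans g {x \<in> carrier G. x \<in> E {inv g \<otimes> x}} \<oplus>\<^bsub>W\<^esub> ptrans g {x \<in> carrier G. x \<in> F {inv g \<otimes> x}}" for g E F
    by (simp add: pi_sadd)
  show "ptrans g {x \<in> carrier G. x \<in> E {inv g \<otimes> x}} = (if h = g then E else \<zero>\<^bsub>W\<^esub>)"
    if "g \<in> carrier G" "h \<in> carrier G" "E \<in> homog h" for g h E
    using that pi_ptrans by (auto simp: homog_def)
  show "additive_subgroup (homog g) W" if g: "g \<in> carrier G" for g
    unfolding additive_subgroup_def
  proof (rule W.add.subgroupI)
    show "homog g \<noteq> {}" using zero_homog by blast
    show "\<ominus>\<^bsub>W\<^esub> E \<in> homog g" if "E \<in> homog g" for E
    proof -
      have "E \<oplus>\<^bsub>W\<^esub> E = \<zero>\<^bsub>W\<^esub>" by (auto simp: sadd_def)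
      moreover have "E \<in> carrier W" using that homog_ops[OF g] by auto
      ultimately have "\<ominus>\<^bsub>W\<^esub> E = E" by (intro W.minus_equality)
      then show ?thesis using that by simp
    qed
  qed (use homog_ops[OF g] sadd_homog in auto)
  show "E \<otimes>\<^bsub>W\<^esub> F \<in> homog (g \<otimes> h)"
    if gh: "g \<in> carrier G" "h \<in> carrier G" and EF: "E \<in> homog g" "F \<in> homog h" for g h E F
  proof -
    obtain A B where "A \<in> \<A>" "B \<in> \<A>" "E = ptrans g A" "F = ptrans h B" using EF unfolding homog_def by blast
    then show ?thesis using gh ptrans_comp sub inter transl by (auto simp: homog_def)
  qed
  show "\<exists>F f. finite F \<and> F \<subseteq> carrier G \<and> (\<forall>g\<in>F. f g \<in> homog g) \<and> E = (\<Oplus>\<^bsub>W\<^esub>g\<in>F. f g)"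
    if "E \<in> carrier W" for E
  proof -
    from that have "E \<in> ops" by simp
    then show ?thesis
    proof (induction rule: ops.induct)
      case (base g A)
      have "ptrans g A = (\<Oplus>\<^bsub>W\<^esub>g\<in>{g}. ptrans g A)"
        using base by (subst W.finsum_insert) (auto simp: ops.base sadd_def fun_eq_iff)
      then show ?case
      proof (intro exI[of _ "{g}"] exI[of _ "\<lambda>g. ptrans g A"] conjI)
        show "\<forall>g\<in>{g}. ptrans g A \<in> homog g" using base by (auto simp: homog_def)
      qed (use base in auto)
    next
      case (sadd E E')
      obtain F f where F: "finite F" "F \<subseteq> carrier G" "\<And>g. g \<in> F \<Longrightarrow> f g \<in> homog g"
        and E: "E = (\<Oplus>\<^bsub>W\<^esub>g\<in>F. f g)" using sadd by blast
      obtain F' f' where F': "finite F'" "F' \<subseteq> carrier G" "\<And>g. g \<in> F' \<Longrightarrow> f' g \<in> homog g"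
        and E': "E' = (\<Oplus>\<^bsub>W\<^esub>g\<in>F'. f' g)" using sadd by blast
      define k where "k g = (if g \<in> F then f g else \<zero>\<^bsub>W\<^esub>)" for g
      define k' where "k' g = (if g \<in> F' then f' g else \<zero>\<^bsub>W\<^esub>)" for g
      have k: "k g \<in> homog g" "k' g \<in> homog g" for g
        using F F' zero_homog by (auto simp: k_def k'_def)
      have kW: "k g \<in> carrier W" "k' g \<in> carrier W" if "g \<in> F \<union> F'" for g
        using k[of g] homog_ops[of g] F F' that by auto
      have fW: "g \<in> F \<Longrightarrow> f g \<in> ops" "g \<in> F' \<Longrightarrow> f' g \<in> ops" for g
        using homog_ops F F' by blast+
      have "E = (\<Oplus>\<^bsub>W\<^esub>g\<in>F \<union> F'. k g)"
        unfolding E using F F' kW fW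
        by (intro W.add.finprod_mono_neutral_cong_left) (auto simp: k_def)
      moreover have "E' = (\<Oplus>\<^bsub>W\<^esub>g\<in>F \<union> F'. k' g)"
        unfolding E' using F F' kW fW
        by (intro W.add.finprod_mono_neutral_cong_left) (auto simp: k'_def)
      ultimately have "E \<oplus>\<^bsub>W\<^esub> E' = (\<Oplus>\<^bsub>W\<^esub>g\<in>F \<union> F'. k g \<oplus>\<^bsub>W\<^esub> k' g)"
        using kW by (simp only:) (intro W.finsum_addf[symmetric], auto)
      then show ?case
        using F F' k sadd_homog
        by (intro exI[of _ "F \<union> F'"] exI[of _ "\<lambda>g. k g \<oplus>\<^bsub>W\<^esub> k' g"]) auto
    qed
  qed
qed

text \<open>
  The base ring consists of the operators \<open>Y \<mapsto> A \<inter> Y\<close> with \<open>A \<in> \<A>\<close>; the homomorphism to the field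
  with two elements tests whether \<open>1 \<in> A\<close>.
\<close>

lemma base_W_hom: "(\<lambda>E. \<one> \<in> E (carrier G)) \<in> ring_hom (base_ring G W homog) bool_ring"
proof (rule ring_hom_memI)
  have ev: "\<one> \<in> ptrans \<one> A (carrier G) \<longleftrightarrow> \<one> \<in> A" for A by (auto simp: ptrans_def)
  have ev_comp: "(ptrans \<one> A \<circ> ptrans \<one> B) (carrier G) = A \<inter> B" if "A \<in> \<A>" "B \<in> \<A>" for A B
    using sub[OF that(1)] sub[OF that(2)] by (auto simp: ptrans_one)
  have base: "carrier (base_ring G W homog) = homog \<one>" by (simp add: base_ring_def)
  fix E F assume "E \<in> carrier (base_ring G W homog)" "F \<in> carrier (base_ring G W homog)"
  then obtain A B where A: "A \<in> \<A>" "E = ptrans \<one> A" and B: "B \<in> \<A>" "F = ptrans \<one> B"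
    unfolding base homog_def by blast
  have "(E \<otimes>\<^bsub>base_ring G W homog\<^esub> F) (carrier G) = A \<inter> B"
    using ev_comp[OF A(1) B(1)] by (simp add: A B base_ring_def)
  then show "(\<one> \<in> (E \<otimes>\<^bsub>base_ring G W homog\<^esub> F) (carrier G)) =
      (\<one> \<in> E (carrier G)) \<otimes>\<^bsub>bool_ring\<^esub> (\<one> \<in> F (carrier G))"
    by (simp add: A B ev bool_ring_def)
  show "(\<one> \<in> (E \<oplus>\<^bsub>base_ring G W homog\<^esub> F) (carrier G)) =
      (\<one> \<in> E (carrier G)) \<oplus>\<^bsub>bool_ring\<^esub> (\<one> \<in> F (carrier G))"
    by (auto simp: base_ring_def sadd_def bool_ring_def)
qed (auto simp: base_ring_def bool_ring_def ptrans_def)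

lemma shift_mult:
  assumes "g \<in> carrier G" "h \<in> carrier G"
  shows "ptrans g (carrier G) \<circ> ptrans h (carrier G) = ptrans (g \<otimes> h) (carrier G)"
proof -
  have "carrier G \<subseteq> g <# carrier G"
  proof
    fix x assume "x \<in> carrier G"
    then have "x = g \<otimes> (inv g \<otimes> x)" "inv g \<otimes> x \<in> carrier G"
      using assms by (simp_all add: m_assoc[symmetric])
    then show "x \<in> g <# carrier G" unfolding l_coset_def by blast
  qed
  then have "carrier G \<inter> (g <# carrier G) = carrier G" by blast
  then show ?thesis using ptrans_comp[OF assms order_refl order_refl] by simp
qed

lemma shift_Units:
  assumes g: "g \<in> carrier G"
  shows "ptrans g (carrier G) \<in> Units W"
proof -
  have "ptrans g (carrier G) \<otimes>\<^bsub>W\<^esub> ptrans (inv g) (carrier G) = \<one>\<^bsub>W\<^esub>"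
    "ptrans (inv g) (carrier G) \<otimes>\<^bsub>W\<^esub> ptrans g (carrier G) = \<one>\<^bsub>W\<^esub>"
    using shift_mult[of g "inv g"] shift_mult[of "inv g" g] g by simp_all
  moreover have "ptrans g (carrier G) \<in> carrier W" "ptrans (inv g) (carrier G) \<in> carrier W"
    using g top ops.base by simp_all
  ultimately show ?thesis unfolding Units_def by blast
qed

end

context translation_algebra
begin

lemma ops_subset_closure_under:
  "ops \<subseteq> closure_under ((\<lambda>(g, A). ptrans g A) ` (carrier G \<times> \<A>)) {sadd}"
proof
  fix E assume "E \<in> ops"
  then show "E \<in> closure_under ((\<lambda>(g, A). ptrans g A) ` (carrier G \<times> \<A>)) {sadd}"
  proof (induction rule: ops.induct)
    case (base g A)
    then show ?case by (intro closure_under.base) force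
  next
    case (sadd E F)
    then show ?case by (intro closure_under.step[of sadd]) auto
  qed
qed

text \<open>
  The operator ring \<open>W\<close>, transported to another type along an injection \<open>h\<close>, is a skew group ring
  over a base ring with UGN.
\<close>

lemma skew_group_ring_image:
  fixes h :: "('g set \<Rightarrow> 'g set) \<Rightarrow> 'r"
  assumes inj: "inj_on h ops"
  defines "T \<equiv> image_ring h W" and "D \<equiv> \<lambda>g. h ` homog g"
  shows "skew_group_ring G (base_ring G T D) T D" and "UGN (base_ring G T D)"
    and "h \<in> ring_hom W T" and "ring T"
proof -
  interpret W: ring W by (rule ring_W)
  have iso: "h \<in> ring_iso W T" unfolding T_def using inj by (intro inj_imp_image_ring_iso) simp
  then show hom: "h \<in> ring_hom W T" by (simp add: ring_iso_def)
  show T: "ring T" unfolding T_def using inj by (intro W.inj_imp_image_ring_is_ring) simp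
  interpret T: ring T by (rule T)
  have gr: "graded_ring G T D"
    unfolding D_def by (rule graded_ring_iso_image[OF group_axioms graded_W T iso])
  interpret grading G T D
    using gr T group_axioms by (simp add: grading_def grading_axioms_def)
  let ?\<phi> = "\<lambda>g. h (ptrans g (carrier G))"
  have \<phi>_D: "?\<phi> g \<in> D g" for g using top by (auto simp: D_def homog_def)
  have \<phi>_unit: "?\<phi> g \<in> Units T" if g: "g \<in> carrier G" for g
  proof -
    obtain v where u: "ptrans g (carrier G) \<in> carrier W" and v: "v \<in> carrier W"
      and "v \<otimes>\<^bsub>W\<^esub> ptrans g (carrier G) = \<one>\<^bsub>W\<^esub>" "ptrans g (carrier G) \<otimes>\<^bsub>W\<^esub> v = \<one>\<^bsub>W\<^esub>"
      using shift_Units[OF g] unfolding Units_def by blast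
    then have "h v \<otimes>\<^bsub>T\<^esub> ?\<phi> g = \<one>\<^bsub>T\<^esub>" "?\<phi> g \<otimes>\<^bsub>T\<^esub> h v = \<one>\<^bsub>T\<^esub>"
      by (simp_all only: ring_hom_mult[OF hom, symmetric] ring_hom_one[OF hom])
    then show ?thesis
      unfolding Units_def using ring_hom_closed[OF hom u] ring_hom_closed[OF hom v] by blast
  qed
  have mono: "?\<phi> \<in> mon G (units_of T)"
  proof -
    have "?\<phi> (g \<otimes> k) = ?\<phi> g \<otimes>\<^bsub>T\<^esub> ?\<phi> k" if gk: "g \<in> carrier G" "k \<in> carrier G" for g k
      using ring_hom_mult[OF hom, of "ptrans g (carrier G)" "ptrans k (carrier G)"] shift_mult[OF gk]
        ops.base[OF gk(1) top] ops.base[OF gk(2) top] by simp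
    moreover have "inj_on ?\<phi> (carrier G)"
    proof (rule inj_onI)
      fix g k assume g: "g \<in> carrier G" and k: "k \<in> carrier G" and "?\<phi> g = ?\<phi> k"
      then have "ptrans g (carrier G) {\<one>} = ptrans k (carrier G) {\<one>}"
        using inj_onD[OF inj _ ops.base[OF g top] ops.base[OF k top]] by simp
      moreover have "g \<in> ptrans g (carrier G) {\<one>}" using g by (simp add: ptrans_def)
      ultimately have eq: "inv k \<otimes> g = \<one>" by (simp add: ptrans_def)
      have "g = k \<otimes> (inv k \<otimes> g)" using g k by (simp add: m_assoc[symmetric])
      also have "\<dots> = k" unfolding eq using k by simp
      finally show "g = k" .
    qed
    ultimately show ?thesis
      unfolding mon_def hom_def units_of_carrier units_of_mult using \<phi>_unit by blast
  qed
  have "\<exists>u\<in>Units T. u \<in> D g" if "g \<in> carrier G" for g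
    using \<phi>_D[of g] \<phi>_unit[OF that] by (rule bexI)
  then have "crossed_product G (base_ring G T D) T D"
    unfolding crossed_product_def using gr by simp
  moreover have "\<exists>\<phi>\<in>mon G (units_of T). \<forall>g\<in>carrier G. \<phi> g \<in> D g"
    using \<phi>_D by (intro bexI[of _ ?\<phi>] mono ballI)
  ultimately show "skew_group_ring G (base_ring G T D) T D"
    unfolding skew_group_ring_def by (rule conjI)
  let ?h' = "inv_into ops h"
  have "?h' \<in> ring_hom (base_ring G T D) (base_ring G W homog)"
  proof (rule ring_hom_memI)
    have homog_ops: "homog \<one> \<subseteq> ops" using ops.base by (auto simp: homog_def)
    have T_one: "\<one>\<^bsub>T\<^esub> = h \<one>\<^bsub>W\<^esub>" using ring_hom_one[OF hom] by simp
    have car: "carrier (base_ring G T D) = h ` homog \<one>" "carrier (base_ring G W homog) = homog \<one>"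
      by (simp_all add: base_ring_def D_def)
    have h'h: "?h' (h E) = E" if "E \<in> ops" for E using inj that by simp
    show "?h' \<one>\<^bsub>base_ring G T D\<^esub> = \<one>\<^bsub>base_ring G W homog\<^esub>"
      using h'h[of "\<one>\<^bsub>W\<^esub>"] W.one_closed by (simp add: base_ring_def T_one)
    fix x assume "x \<in> carrier (base_ring G T D)"
    then obtain E where E: "E \<in> homog \<one>" "E \<in> ops" "x = h E" using homog_ops unfolding car by blast
    then show "?h' x \<in> carrier (base_ring G W homog)" unfolding car by (simp add: h'h)
    fix y assume "y \<in> carrier (base_ring G T D)"
    then obtain F where F: "F \<in> homog \<one>" "F \<in> ops" "y = h F" using homog_ops unfolding car by blast
    have "x \<otimes>\<^bsub>T\<^esub> y = h (E \<circ> F)" "x \<oplus>\<^bsub>T\<^esub> y = h (sadd E F)"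
      using ring_hom_mult[OF hom, of E F] ring_hom_add[OF hom, of E F] E F by simp_all
    then show "?h' (x \<otimes>\<^bsub>base_ring G T D\<^esub> y) = ?h' x \<otimes>\<^bsub>base_ring G W homog\<^esub> ?h' y"
      "?h' (x \<oplus>\<^bsub>base_ring G T D\<^esub> y) = ?h' x \<oplus>\<^bsub>base_ring G W homog\<^esub> ?h' y"
      using E F by (simp_all add: base_ring_def h'h ops_comp ops.sadd)
  qed
  from ring_hom_trans[OF this base_W_hom]
  show "UGN (base_ring G T D)"
    by (rule UGN_ring_hom[OF ring_base_ring ring_bool_ring _ UGN_bool_ring])
qed

text \<open>
  An injection \<open>f\<close> that is a left translation on each of finitely many pieces from \<open>\<A>\<close> acts
  on subsets of \<open>G\<close> by image and by preimage, and both operators belong to the skew group ring.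
\<close>

lemma piecewise_translation_ops:
  assumes inj: "inj_on f (carrier G)" and K: "finite K" "K \<subseteq> carrier G"
    and f: "\<And>x. x \<in> carrier G \<Longrightarrow> \<exists>k\<in>K. f x = k \<otimes> x"
    and pieces: "\<And>k. k \<in> K \<Longrightarrow> {x \<in> carrier G. f x = k \<otimes> x} \<in> \<A>"
  shows "(\<lambda>Y. f ` (carrier G \<inter> Y)) \<in> ops" and "(\<lambda>Y. {x \<in> carrier G. f x \<in> Y}) \<in> ops"
proof -
  let ?A = "\<lambda>L. {x \<in> carrier G. \<exists>k\<in>L. f x = k \<otimes> x}"
  have "(\<lambda>Y. f ` (?A L \<inter> Y)) \<in> ops \<and> (\<lambda>Y. {x \<in> ?A L. f x \<in> Y}) \<in> ops"
    if "finite L" "L \<subseteq> K" for L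
    using that
  proof (induction L rule: finite_induct)
    case empty
    then show ?case using zero_ops by simp
  next
    case (insert k L)
    have k: "k \<in> carrier G" "k \<in> K" using insert.prems K by auto
    have un: "?A (insert k L) = ?A {k} \<union> ?A L" by auto
    have disj: "?A {k} \<inter> ?A L = {}" using insert.hyps insert.prems K k by (auto simp: subset_iff)
    have fst: "ptrans k (k <# ?A {k}) = (\<lambda>Y. f ` (?A {k} \<inter> Y))"
    proof
      fix Y
      have "inv k \<otimes> (k \<otimes> x) = x" if "x \<in> carrier G" for x
        using that k by (simp add: m_assoc[symmetric])
      then show "ptrans k (k <# ?A {k}) Y = f ` (?A {k} \<inter> Y)"
        by (auto simp: ptrans_def l_coset_def image_iff)
    qed
    have snd: "ptrans (inv k) (?A {k}) = (\<lambda>Y. {x \<in> ?A {k}. f x \<in> Y})"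
      using k by (auto simp: ptrans_def fun_eq_iff)
    have "?A {k} \<in> \<A>" using pieces[OF k(2)] by simp
    then have fst_ops: "(\<lambda>Y. f ` (?A {k} \<inter> Y)) \<in> ops" and snd_ops: "(\<lambda>Y. {x \<in> ?A {k}. f x \<in> Y}) \<in> ops"
      using ops.base[OF k(1) transl[OF k(1)]] ops.base[OF inv_closed[OF k(1)]]
      unfolding fst[symmetric] snd[symmetric] by blast+
    have "(\<lambda>Y. f ` (?A (insert k L) \<inter> Y)) = sadd (\<lambda>Y. f ` (?A {k} \<inter> Y)) (\<lambda>Y. f ` (?A L \<inter> Y))"
    proof
      fix Y
      have "f ` (?A {k} \<inter> Y) \<inter> f ` (?A L \<inter> Y) = {}"
      proof (rule ccontr)
        assume "\<not> ?thesis"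
        then obtain x y where x: "x \<in> ?A {k}" and y: "y \<in> ?A L" and "f x = f y" by blast
        then have "x = y" using inj_onD[OF inj, of x y] by simp
        then show False using x y disj by blast
      qed
      then show "f ` (?A (insert k L) \<inter> Y) = sadd (\<lambda>Y. f ` (?A {k} \<inter> Y)) (\<lambda>Y. f ` (?A L \<inter> Y)) Y"
        unfolding un sadd_def by blast
    qed
    moreover have "(\<lambda>Y. {x \<in> ?A (insert k L). f x \<in> Y}) =
        sadd (\<lambda>Y. {x \<in> ?A {k}. f x \<in> Y}) (\<lambda>Y. {x \<in> ?A L. f x \<in> Y})"
      unfolding un sadd_def using disj by blast
    moreover have "(\<lambda>Y. f ` (?A L \<inter> Y)) \<in> ops" "(\<lambda>Y. {x \<in> ?A L. f x \<in> Y}) \<in> ops"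
      using insert by auto
    ultimately show ?case using ops.sadd[OF fst_ops] ops.sadd[OF snd_ops] by (simp only:)
  qed
  from this[OF K(1) order_refl]
  moreover have "?A K = carrier G" using f by auto
  ultimately show "(\<lambda>Y. f ` (carrier G \<inter> Y)) \<in> ops" "(\<lambda>Y. {x \<in> carrier G. f x \<in> Y}) \<in> ops"
    by simp_all
qed

end

text \<open>
  The two injections \<open>f _ True\<close> and \<open>f _ False\<close> given by doubling act by operators \<open>u True\<close>,
  \<open>u False\<close> with left inverses \<open>v True\<close>, \<open>v False\<close> (preimages), and \<open>v i u j = 0\<close> for \<open>i \<noteq> j\<close> because
  the images are disjoint.  So the column \<open>v\<close> times the row \<open>u\<close> is the \<open>2 \<times> 2\<close> identity matrix.
  To fit the ring into the given type, \<open>\<A>\<close> is generated by the finitely many pieces of the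
  injections; then \<open>\<A>\<close> and the operator ring have cardinality at most that of the
  infinite set \<open>G\<close>.
\<close>

lemma not_amenable_skew_group_ring:
  fixes G :: "('g, 'n) monoid_scheme"
  assumes "group G" and na: "\<not> amenable G" and small: "carrier G \<lesssim> (UNIV :: 'r set)"
  shows "\<exists>(T :: 'r ring) D. ring (base_ring G T D) \<and> skew_group_ring G (base_ring G T D) T D \<and>
    UGN (base_ring G T D) \<and> \<not> UGN T"
proof -
  interpret group G by fact
  obtain K f where K: "finite K" "K \<subseteq> carrier G"
    and inj: "inj_on (\<lambda>(x, i). f x i) (carrier G \<times> UNIV)"
    and f: "\<And>x i. x \<in> carrier G \<Longrightarrow> \<exists>k\<in>K. f x (i::bool) = k \<otimes>\<^bsub>G\<^esub> x"
    using doubling_imp_two_to_one[OF not_amenable_imp_doubling[OF na]] by metis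
  have fG: "f x i \<in> carrier G" if "x \<in> carrier G" for x i
    using f[OF that, of i] K that by auto
  have injD: "x = y \<and> i = j" if "x \<in> carrier G" "y \<in> carrier G" "f x i = f y j" for x y i j
    using inj_onD[OF inj, of "(x, i)" "(y, j)"] that by auto
  have inf: "infinite (carrier G)"
  proof
    assume fin: "finite (carrier G)"
    have "card (carrier G \<times> (UNIV :: bool set)) \<le> card (carrier G)"
      using inj fin fG by (intro card_inj_on_le[of "\<lambda>(x, i). f x i"]) auto
    then have "carrier G = {}" using fin by (simp add: card_cartesian_product)
    then show False using one_closed by blast
  qed
  define B where "B = insert (carrier G) ((\<lambda>(i, k). {x \<in> carrier G. f x i = k \<otimes>\<^bsub>G\<^esub> x}) ` (UNIV \<times> K))"
  define Fs :: "('g set \<Rightarrow> 'g set \<Rightarrow> 'g set) set" where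
    "Fs = {\<lambda>A B. sym_diff A B, \<lambda>A B. A \<inter> B} \<union> (\<lambda>g A B. g <#\<^bsub>G\<^esub> A) ` carrier G"
  define \<A> where "\<A> = closure_under B Fs"
  interpret translation_algebra G \<A>
  proof
    show "A \<subseteq> carrier G" if "A \<in> \<A>" for A
      using that unfolding \<A>_def
    proof (induction rule: closure_under.induct)
      case (base b)
      then show ?case by (auto simp: B_def)
    next
      case (step \<psi> A A')
      consider "\<psi> = (\<lambda>A B. sym_diff A B)" | "\<psi> = (\<lambda>A B. A \<inter> B)"
        | g where "g \<in> carrier G" "\<psi> = (\<lambda>A B. g <#\<^bsub>G\<^esub> A)"
        using step.hyps(1) unfolding Fs_def by blast
      then show ?case
        using step.IH by cases (auto simp: l_coset_def)
    qed
    show "carrier G \<in> \<A>" unfolding \<A>_def by (rule closure_under.base) (simp add: B_def)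
    fix A A' assume A: "A \<in> \<A>" and A': "A' \<in> \<A>"
    show "sym_diff A A' \<in> \<A>"
      using A A' unfolding \<A>_def by (intro closure_under.step[of "\<lambda>A B. sym_diff A B"]) (auto simp: Fs_def)
    show "A \<inter> A' \<in> \<A>"
      using A A' unfolding \<A>_def by (intro closure_under.step[of "\<lambda>A B. A \<inter> B"]) (auto simp: Fs_def)
  next
    fix g A assume "g \<in> carrier G" "A \<in> \<A>"
    then show "g <#\<^bsub>G\<^esub> A \<in> \<A>"
      unfolding \<A>_def by (intro closure_under.step[of "\<lambda>A B. g <#\<^bsub>G\<^esub> A" _ A _ A]) (auto simp: Fs_def)
  qed
  have fin_le: "|Z| \<le>o |carrier G|" if "finite Z" for Z :: "'z set"
    using that inf by (simp add: card_of_ordLeq_finite ordLess_imp_ordLeq finite_ordLess_infinite2)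
  have "|B| \<le>o |carrier G|" using K by (intro fin_le) (simp add: B_def)
  moreover have "|Fs| \<le>o |carrier G|"
    unfolding Fs_def using inf by (intro card_of_Un_ordLeq_infinite fin_le card_of_image) auto
  ultimately have "|\<A>| \<le>o |carrier G|" unfolding \<A>_def by (rule card_closure_under[OF inf])
  then have "|carrier G \<times> \<A>| \<le>o |carrier G|"
    using inf by (intro card_of_Times_ordLeq_infinite) auto
  then have "|(\<lambda>(g, A). ptrans g A) ` (carrier G \<times> \<A>)| \<le>o |carrier G|"
    using card_of_image ordLeq_transitive by blast
  then have "|closure_under ((\<lambda>(g, A). ptrans g A) ` (carrier G \<times> \<A>)) {sadd}| \<le>o |carrier G|"
    by (rule card_closure_under[OF inf _ fin_le]) simp
  then have "|ops| \<le>o |carrier G|"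
    using card_of_mono1[OF ops_subset_closure_under] ordLeq_transitive by blast
  moreover have "|carrier G| \<le>o |UNIV :: 'r set|"
    using small unfolding lepoll_def card_of_ordLeq[symmetric] by blast
  ultimately have "|ops| \<le>o |UNIV :: 'r set|" by (rule ordLeq_transitive)
  then obtain h :: "('g set \<Rightarrow> 'g set) \<Rightarrow> 'r" where h: "inj_on h ops"
    unfolding card_of_ordLeq[symmetric] by blast
  let ?T = "image_ring h W" and ?D = "\<lambda>g. h ` homog g"
  have "grading G ?T ?D"
    using skew_group_ring_image[OF h] group_axioms
    by (simp add: grading_def grading_axioms_def skew_group_ring_def crossed_product_def)
  then have ring_base: "ring (base_ring G ?T ?D)" by (rule grading.ring_base_ring)
  define u where "u i Y = (\<lambda>x. f x i) ` (carrier G \<inter> Y)" for i Y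
  define v where "v i Y = {x \<in> carrier G. f x i \<in> Y}" for i Y
  have uv: "u i \<in> ops" "v i \<in> ops" for i
  proof -
    have "inj_on (\<lambda>x. f x i) (carrier G)" using injD by (auto intro!: inj_onI)
    moreover have "{x \<in> carrier G. f x i = k \<otimes>\<^bsub>G\<^esub> x} \<in> \<A>" if "k \<in> K" for k
      unfolding \<A>_def by (rule closure_under.base) (use that in \<open>auto simp: B_def\<close>)
    ultimately show "u i \<in> ops" "v i \<in> ops"
      unfolding u_def v_def using piecewise_translation_ops[of "\<lambda>x. f x i" K] K f by blast+
  qed
  have vu: "v i \<circ> u j = (if i = j then \<one>\<^bsub>W\<^esub> else \<zero>\<^bsub>W\<^esub>)" for i j
    by (auto simp: fun_eq_iff u_def v_def ptrans_one dest: injD)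
  interpret W: ring W by (rule ring_W)
  have "mat_retract W (UNIV :: bool set) {()}"
  proof (rule mat_retractI[of _ _ "\<lambda>i _. v i" _ "\<lambda>_ i. u i"])
    fix i j :: bool
    show "(\<Oplus>\<^bsub>W\<^esub>_\<in>{()}. v i \<otimes>\<^bsub>W\<^esub> u j) = (if i = j then \<one>\<^bsub>W\<^esub> else \<zero>\<^bsub>W\<^esub>)"
      using uv vu[of i j] ops_comp[OF uv(2)[of i] uv(1)[of j]] by (subst W.finsum_insert) (auto simp: sadd_def fun_eq_iff)
  qed (use uv in auto)
  then have "mat_retract ?T (UNIV :: bool set) {()}"
    using mat_retract_ring_hom[OF ring_W] skew_group_ring_image[OF h] by blast
  then have "\<not> UGN ?T"
    using ring.UGN_mat_retract_card[of ?T "UNIV :: bool set" "{()}"] skew_group_ring_image(4)[OF h] by auto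
  then show ?thesis using skew_group_ring_image[OF h] ring_base by blast
qed

section \<open>Equivalence of the four statements\<close>

theorem theoremB:
  fixes G :: "('g, 'n) monoid_scheme"
  assumes "group G"
    and "carrier G \<lesssim> (UNIV :: 'r set)"
  shows
    "(amenable G \<longleftrightarrow>
        (\<forall>(T :: 'r ring) D. graded_ring G T D \<and> full_grading G T D \<and> boundedly_free G T D \<longrightarrow>
           (UGN T \<longleftrightarrow> UGN (base_ring G T D)))) \<and>
     (amenable G \<longleftrightarrow>
        (\<forall>R :: 'r ring. ring R \<longrightarrow> (\<forall>T D. crossed_product G R T D \<longrightarrow> (UGN T \<longleftrightarrow> UGN R)))) \<and>
     (amenable G \<longleftrightarrow>
        (\<forall>R :: 'r ring. ring R \<longrightarrow> (\<forall>T D. skew_group_ring G R T D \<longrightarrow> (UGN T \<longleftrightarrow> UGN R))))"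
proof -
  let ?ii = "\<forall>(T :: 'r ring) D. graded_ring G T D \<and> full_grading G T D \<and> boundedly_free G T D \<longrightarrow>
    (UGN T \<longleftrightarrow> UGN (base_ring G T D))"
  let ?iii = "\<forall>R :: 'r ring. ring R \<longrightarrow> (\<forall>T D. crossed_product G R T D \<longrightarrow> (UGN T \<longleftrightarrow> UGN R))"
  let ?iv = "\<forall>R :: 'r ring. ring R \<longrightarrow> (\<forall>T D. skew_group_ring G R T D \<longrightarrow> (UGN T \<longleftrightarrow> UGN R))"
  have am_ii: "amenable G \<Longrightarrow> ?ii" using amenable_UGN_iff[OF assms(1)] by blast
  have ii_iii: "?iii" if ii: "?ii"
  proof (intro allI impI)
    fix S T :: "'r ring" and D assume cp: "crossed_product G S T D"
    show "UGN T \<longleftrightarrow> UGN S"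
    proof (cases "carrier T = {\<zero>\<^bsub>T\<^esub>}")
      case True
      then show ?thesis using crossed_product_trivial[OF assms(1) cp] by simp
    next
      case False
      then show ?thesis
        using ii crossed_product_full_free[OF assms(1) cp] cp unfolding crossed_product_def by blast
    qed
  qed
  have iii_iv: "?iii \<Longrightarrow> ?iv" by (auto simp: skew_group_ring_def)
  have iv_am: "amenable G" if "?iv"
    using that not_amenable_skew_group_ring[OF assms(1) _ assms(2)] by blast
  show ?thesis using am_ii ii_iii iii_iv iv_am by argo
qed

end
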